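(* Let $(M,g)$ be a Riemannian manifold with constant curvature. If $\mathbf F$ is a bundle-like foliation with totally umbilical leaves and the dimension of the leaves is $p\ge 2$, then: (a) $\tau$ is parallel in the transversal distribution along leaves, i.e. $\mathcal H D_V\tau=0$ for every vertical vector field $V$; (b) $\tau$ is basic, which implies that the one-form $\kappa$ is basic; (c) $A_\tau=0$.
   Context: All objects are $C^\infty$. $\mathbf V$ is the distribution tangent to $\mathbf F$, $\mathbf H=\mathbf V^\perp$ its orthogonal complement (the transversal distribution); $\mathcal V E,\mathcal H E$ are the projections of $E$ to $\mathbf V,\mathbf H$. Sections of $\mathbf V$ (resp. $\mathbf H$) are vertical (resp. horizontal). A (local) basic vector field is a horizontal vector field which projects to a well-defined vector field under the local submersions defining $\mathbf F$. A differential form $\phi$ is basic if $i(W)\phi=0$ and $\theta(W)\phi=0$ (interior product and Lie derivative) for all vertical $W$. $\mathbf F$ is bundle-like with respect to $g$ if $W\,g(X,X)=0$ for every local basic $X$ and vertical $W$. $D$ is the Levi-Civita connection of $g$. The O'Neill tensors are $T_EF=\mathcal V D_{\mathcal V E}\mathcal H F+\mathcal H D_{\mathcal V E}\mathcal V F$ and $A_EF=\mathcal V D_{\mathcal H E}\mathcal H F+\mathcal H D_{\mathcal H E}\mathcal V F$. The mean curvature vector field is $\tau=\sum_{i=1}^pT_{V_i}V_i$ for a local orthonormal frame $\{V_i\}$ of $\mathbf V$, and $\kappa(E)=g(E,\tau)$ is the mean curvature one-form. The leaves are totally umbilical if $T_UV=\frac1p g(U,V)\tau$ for all vertical $U,V$.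 $A_\tau=0$ means $A_\tau E=0$ for all vectors $E$. *)

theory Defs
  imports "HOL-Analysis.Analysis" "HOL-Library.Function_Algebras"
begin

text \<open>Tangent vectors are linear functionals on functions, and vector fields are functions with
  values in tangent vectors; both are added and scaled pointwise.\<close>

instantiation "fun" :: (type, real_vector) real_vector
begin

definition scaleR_fun :: "real \<Rightarrow> ('a \<Rightarrow> 'b) \<Rightarrow> 'a \<Rightarrow> 'b" where
  "scaleR_fun c f = (\<lambda>x. c *\<^sub>R f x)"

instance
  by standard (simp_all add: scaleR_fun_def fun_eq_iff scaleR_add_right scaleR_add_left)

end


section \<open>Smooth manifolds\<close>

text \<open>The predicates below are only used on open sets \<open>S\<close>.\<close>

primrec cont_diff_on ::
  "nat \<Rightarrow> 'e::real_normed_vector set \<Rightarrow> ('e \<Rightarrow> 'f::real_normed_vector) \<Rightarrow> bool" where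
  "cont_diff_on 0 S f \<longleftrightarrow> continuous_on S f"
| "cont_diff_on (Suc k) S f \<longleftrightarrow>
     (\<forall>x\<in>S. f differentiable (at x)) \<and>
     (\<forall>v. cont_diff_on k S (\<lambda>x. frechet_derivative f (at x) v))"

definition smooth_on ::
  "'e::real_normed_vector set \<Rightarrow> ('e \<Rightarrow> 'f::real_normed_vector) \<Rightarrow> bool" where
  "smooth_on S f \<longleftrightarrow> (\<forall>k. cont_diff_on k S f)"

type_synonym ('a, 'e) chart = "'a set \<times> ('a \<Rightarrow> 'e)"
type_synonym 'a tangent = "('a \<Rightarrow> real) \<Rightarrow> real"
type_synonym 'a vfield = "'a \<Rightarrow> 'a tangent"
type_synonym 'a metric = "'a \<Rightarrow> 'a tangent \<Rightarrow> 'a tangent \<Rightarrow> real"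
type_synonym 'a connection = "'a vfield \<Rightarrow> 'a vfield \<Rightarrow> 'a vfield"

definition is_chart :: "('a::topological_space, 'e::euclidean_space) chart \<Rightarrow> bool" where
  "is_chart c \<longleftrightarrow> (case c of (U, \<phi>) \<Rightarrow>
     open U \<and> open (\<phi> ` U) \<and> homeomorphism U (\<phi> ` U) \<phi> (inv_into U \<phi>))"

text \<open>The manifold is the whole type \<open>'a\<close>, its smooth structure is given by an atlas (not
  necessarily maximal) of charts with values in the model space \<open>'e\<close>.\<close>

definition smooth_atlas ::
  "('a::{t2_space, second_countable_topology}, 'e::euclidean_space) chart set \<Rightarrow> bool" where
  "smooth_atlas A \<longleftrightarrow>
     (\<forall>c\<in>A. is_chart c) \<and> (\<Union>(U, \<phi>)\<in>A. U) = UNIV \<and>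
     (\<forall>(U, \<phi>)\<in>A. \<forall>(V, \<psi>)\<in>A. smooth_on (\<phi> ` (U \<inter> V)) (\<psi> \<circ> inv_into U \<phi>))"

definition smooth_fun ::
  "('a::topological_space, 'e::euclidean_space) chart set \<Rightarrow> 'a set \<Rightarrow> ('a \<Rightarrow> real) \<Rightarrow> bool" where
  "smooth_fun A S f \<longleftrightarrow> (\<forall>(U, \<phi>)\<in>A. smooth_on (\<phi> ` (S \<inter> U)) (f \<circ> inv_into U \<phi>))"

definition smooth_near ::
  "('a::topological_space, 'e::euclidean_space) chart set \<Rightarrow> 'a \<Rightarrow> ('a \<Rightarrow> real) \<Rightarrow> bool" where
  "smooth_near A x f \<longleftrightarrow> (\<exists>S. open S \<and> x \<in> S \<and> smooth_fun A S f)"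

text \<open>Directional derivative at \<open>x\<close> in the direction \<open>w\<close>, in the coordinates of the given chart.
  It acts on functions that are smooth in some neighbourhood of \<open>x\<close>; on all other functions it is
  set to \<open>0\<close>, so that equality of tangent vectors is equality of functionals on germs.\<close>

definition chart_deriv ::
  "('a::topological_space, 'e::euclidean_space) chart set \<Rightarrow> ('a, 'e) chart \<Rightarrow> 'a \<Rightarrow> 'e \<Rightarrow> 'a tangent"
  where
  "chart_deriv A c x w = (case c of (U, \<phi>) \<Rightarrow>
     (\<lambda>f. if smooth_near A x f then frechet_derivative (f \<circ> inv_into U \<phi>) (at (\<phi> x)) w else 0))"

definition tangent_space ::
  "('a::topological_space, 'e::euclidean_space) chart set \<Rightarrow> 'a \<Rightarrow> 'a tangent set" where
  "tangent_space A x = {chart_deriv A (U, \<phi>) x w | U \<phi> w. (U, \<phi>) \<in> A \<and> x \<in> U}"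

text \<open>Smooth vector fields on the open set \<open>S\<close>; values outside \<open>S\<close> are irrelevant.\<close>

definition vector_field ::
  "('a::topological_space, 'e::euclidean_space) chart set \<Rightarrow> 'a set \<Rightarrow> 'a vfield \<Rightarrow> bool" where
  "vector_field A S X \<longleftrightarrow>
     (\<forall>x\<in>S. X x \<in> tangent_space A x) \<and>
     (\<forall>N f. open N \<and> N \<subseteq> S \<and> smooth_fun A N f \<longrightarrow> smooth_fun A N (\<lambda>x. X x f))"

definition lie_bracket ::
  "('a::topological_space, 'e::euclidean_space) chart set \<Rightarrow> 'a vfield \<Rightarrow> 'a vfield \<Rightarrow> 'a vfield" where
  "lie_bracket A X Y = (\<lambda>x f.
     if smooth_near A x f then X x (\<lambda>y. Y y f) - Y x (\<lambda>y. X y f) else 0)"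


section \<open>Riemannian geometry\<close>

definition riemannian_metric ::
  "('a::topological_space, 'e::euclidean_space) chart set \<Rightarrow> 'a metric \<Rightarrow> bool" where
  "riemannian_metric A g \<longleftrightarrow>
     (\<forall>x. \<forall>u\<in>tangent_space A x. \<forall>v\<in>tangent_space A x. \<forall>w\<in>tangent_space A x. \<forall>a b.
        g x (a *\<^sub>R u + b *\<^sub>R v) w = a * g x u w + b * g x v w \<and>
        g x u v = g x v u \<and>
        (u \<noteq> 0 \<longrightarrow> g x u u > 0)) \<and>
     (\<forall>S X Y. open S \<and> vector_field A S X \<and> vector_field A S Y \<longrightarrow>
        smooth_fun A S (\<lambda>x. g x (X x) (Y x)))"

text \<open>The connection operates on local vector fields: its values on an open set are prescribed by
  the axioms as soon as the arguments are smooth there. Locality, i.e. independence of the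
  values of the arguments outside \<open>S\<close>, follows from the axioms by the Koszul formula on \<open>S\<close>.\<close>

definition levi_civita ::
  "('a::topological_space, 'e::euclidean_space) chart set \<Rightarrow> 'a metric \<Rightarrow> 'a connection \<Rightarrow> bool" where
  "levi_civita A g D \<longleftrightarrow>
     (\<forall>S X Y Z f. open S \<and> vector_field A S X \<and> vector_field A S Y \<and> vector_field A S Z \<and>
        smooth_fun A S f \<longrightarrow>
        vector_field A S (D X Y) \<and>
        (\<forall>x\<in>S.
          D (X + Y) Z x = D X Z x + D Y Z x \<and>
          D (\<lambda>y. f y *\<^sub>R X y) Y x = f x *\<^sub>R D X Y x \<and>
          D X (Y + Z) x = D X Y x + D X Z x \<and>
          D X (\<lambda>y. f y *\<^sub>R Y y) x = X x f *\<^sub>R Y x + f x *\<^sub>R D X Y x \<and>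
          X x (\<lambda>y. g y (Y y) (Z y)) = g x (D X Y x) (Z x) + g x (Y x) (D X Z x) \<and>
          D X Y x - D Y X x = lie_bracket A X Y x))"

definition riemann_curvature ::
  "('a::topological_space, 'e::euclidean_space) chart set \<Rightarrow> 'a connection \<Rightarrow>
   'a vfield \<Rightarrow> 'a vfield \<Rightarrow> 'a vfield \<Rightarrow> 'a vfield" where
  "riemann_curvature A D X Y Z = D X (D Y Z) - D Y (D X Z) - D (lie_bracket A X Y) Z"

definition sectional_curvature ::
  "('a::topological_space, 'e::euclidean_space) chart set \<Rightarrow> 'a metric \<Rightarrow> 'a connection \<Rightarrow>
   'a vfield \<Rightarrow> 'a vfield \<Rightarrow> 'a \<Rightarrow> real" where
  "sectional_curvature A g D X Y x =
     g x (riemann_curvature A D X Y Y x) (X x) /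
     (g x (X x) (X x) * g x (Y x) (Y x) - (g x (X x) (Y x))\<^sup>2)"

definition constant_curvature ::
  "('a::topological_space, 'e::euclidean_space) chart set \<Rightarrow> 'a metric \<Rightarrow> 'a connection \<Rightarrow> bool" where
  "constant_curvature A g D \<longleftrightarrow>
     (\<exists>c. \<forall>S X Y. open S \<and> vector_field A S X \<and> vector_field A S Y \<longrightarrow>
        (\<forall>x\<in>S. X x \<noteq> Y x \<and> independent {X x, Y x} \<longrightarrow> sectional_curvature A g D X Y x = c))"


section \<open>Foliations\<close>

text \<open>The model space is split orthogonally by a set \<open>L\<close> of basis vectors, the directions of the
  leaves. The map \<open>transverse L \<circ> \<phi>\<close> is then the local submersion that a foliated chart
  \<open>(U, \<phi>)\<close> defines, its target being the span of \<open>Basis - L\<close>.\<close>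

definition transverse :: "'e::euclidean_space set \<Rightarrow> 'e \<Rightarrow> 'e" where
  "transverse L y = (\<Sum>b\<in>Basis - L. (y \<bullet> b) *\<^sub>R b)"

definition open_box :: "'e::euclidean_space set \<Rightarrow> bool" where
  "open_box B \<longleftrightarrow> (\<exists>a b. B = box a b)"

text \<open>A foliation with leaves of dimension \<open>card L\<close>, given by an atlas \<open>F\<close> of foliated charts of
  the manifold. The charts have boxes as images, so that the fibres of the submersions are
  connected (plaques). On overlaps the submersions differ locally by a map \<open>\<gamma>\<close> of the transverse
  coordinates; \<open>\<gamma>\<close> is automatically a local diffeomorphism, by symmetry and because the charts
  are smoothly compatible.\<close>

definition foliation ::
  "('a::{t2_space, second_countable_topology}, 'e::euclidean_space) chart set \<Rightarrow>
   'e set \<Rightarrow> ('a, 'e) chart set \<Rightarrow> bool" where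
  "foliation A L F \<longleftrightarrow>
     L \<subseteq> Basis \<and> smooth_atlas F \<and> smooth_atlas (A \<union> F) \<and>
     (\<forall>(U, \<phi>)\<in>F. open_box (\<phi> ` U)) \<and>
     (\<forall>(U, \<phi>)\<in>F. \<forall>(V, \<psi>)\<in>F. \<forall>x\<in>U \<inter> V. \<exists>N \<gamma>. open N \<and> x \<in> N \<and> N \<subseteq> U \<inter> V \<and>
        (\<forall>y\<in>N. transverse L (\<psi> y) = \<gamma> (transverse L (\<phi> y))))"

text \<open>The differential of the submersion \<open>transverse L \<circ> \<phi>\<close>, applied to a tangent vector.\<close>

definition push_transverse :: "'e::euclidean_space set \<Rightarrow> ('a \<Rightarrow> 'e) \<Rightarrow> 'a tangent \<Rightarrow> 'e" where
  "push_transverse L \<phi> v = (\<Sum>b\<in>Basis - L. v (\<lambda>y. transverse L (\<phi> y) \<bullet> b) *\<^sub>R b)"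

definition vertical_space ::
  "('a::topological_space, 'e::euclidean_space) chart set \<Rightarrow> 'e set \<Rightarrow> ('a, 'e) chart set \<Rightarrow>
   'a \<Rightarrow> 'a tangent set" where
  "vertical_space A L F x =
     {v \<in> tangent_space A x. \<forall>(U, \<phi>)\<in>F. x \<in> U \<longrightarrow> push_transverse L \<phi> v = 0}"

definition horizontal_space ::
  "('a::topological_space, 'e::euclidean_space) chart set \<Rightarrow> 'a metric \<Rightarrow> 'e set \<Rightarrow>
   ('a, 'e) chart set \<Rightarrow> 'a \<Rightarrow> 'a tangent set" where
  "horizontal_space A g L F x =
     {v \<in> tangent_space A x. \<forall>u\<in>vertical_space A L F x. g x u v = 0}"

definition vert ::
  "('a::topological_space, 'e::euclidean_space) chart set \<Rightarrow> 'a metric \<Rightarrow> 'e set \<Rightarrow>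
   ('a, 'e) chart set \<Rightarrow> 'a vfield \<Rightarrow> 'a vfield" where
  "vert A g L F E = (\<lambda>x. THE u. u \<in> vertical_space A L F x \<and> E x - u \<in> horizontal_space A g L F x)"

definition hor ::
  "('a::topological_space, 'e::euclidean_space) chart set \<Rightarrow> 'a metric \<Rightarrow> 'e set \<Rightarrow>
   ('a, 'e) chart set \<Rightarrow> 'a vfield \<Rightarrow> 'a vfield" where
  "hor A g L F E = E - vert A g L F E"

definition vertical_field ::
  "('a::topological_space, 'e::euclidean_space) chart set \<Rightarrow> 'e set \<Rightarrow> ('a, 'e) chart set \<Rightarrow>
   'a set \<Rightarrow> 'a vfield \<Rightarrow> bool" where
  "vertical_field A L F S X \<longleftrightarrow>
     vector_field A S X \<and> (\<forall>x\<in>S. X x \<in> vertical_space A L F x)"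

definition horizontal_field ::
  "('a::topological_space, 'e::euclidean_space) chart set \<Rightarrow> 'a metric \<Rightarrow> 'e set \<Rightarrow>
   ('a, 'e) chart set \<Rightarrow> 'a set \<Rightarrow> 'a vfield \<Rightarrow> bool" where
  "horizontal_field A g L F S X \<longleftrightarrow>
     vector_field A S X \<and> (\<forall>x\<in>S. X x \<in> horizontal_space A g L F x)"

text \<open>A basic vector field on \<open>S\<close> projects, under every submersion of the foliation, to a vector
  field \<open>Z\<close> on the transverse space. The submersions are restricted to subsets \<open>N\<close> of \<open>S\<close> with box
  image, because on an arbitrary \<open>U \<inter> S\<close> their fibres may be disconnected; for \<open>S = UNIV\<close> the
  choice \<open>N = U\<close> is included. Smoothness of \<open>Z\<close> is automatic since the submersion has smooth
  local sections.\<close>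

definition basic_field ::
  "('a::topological_space, 'e::euclidean_space) chart set \<Rightarrow> 'a metric \<Rightarrow> 'e set \<Rightarrow>
   ('a, 'e) chart set \<Rightarrow> 'a set \<Rightarrow> 'a vfield \<Rightarrow> bool" where
  "basic_field A g L F S X \<longleftrightarrow>
     horizontal_field A g L F S X \<and>
     (\<forall>(U, \<phi>)\<in>F. \<forall>N. open N \<and> N \<subseteq> U \<inter> S \<and> open_box (\<phi> ` N) \<longrightarrow>
        (\<exists>Z. \<forall>x\<in>N. push_transverse L \<phi> (X x) = Z (transverse L (\<phi> x))))"

definition bundle_like ::
  "('a::topological_space, 'e::euclidean_space) chart set \<Rightarrow> 'a metric \<Rightarrow> 'e set \<Rightarrow>
   ('a, 'e) chart set \<Rightarrow> bool" where
  "bundle_like A g L F \<longleftrightarrow>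
     (\<forall>S X W. open S \<and> basic_field A g L F S X \<and> vertical_field A L F S W \<longrightarrow>
        (\<forall>x\<in>S. W x (\<lambda>y. g y (X y) (X y)) = 0))"

definition one_form ::
  "('a::topological_space, 'e::euclidean_space) chart set \<Rightarrow> ('a \<Rightarrow> 'a tangent \<Rightarrow> real) \<Rightarrow> bool" where
  "one_form A \<omega> \<longleftrightarrow>
     (\<forall>x. \<forall>u\<in>tangent_space A x. \<forall>v\<in>tangent_space A x. \<forall>a b.
        \<omega> x (a *\<^sub>R u + b *\<^sub>R v) = a * \<omega> x u + b * \<omega> x v) \<and>
     (\<forall>S X. open S \<and> vector_field A S X \<longrightarrow> smooth_fun A S (\<lambda>x. \<omega> x (X x)))"

definition lie_derivative ::
  "('a::topological_space, 'e::euclidean_space) chart set \<Rightarrow> 'a vfield \<Rightarrow>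
   ('a \<Rightarrow> 'a tangent \<Rightarrow> real) \<Rightarrow> 'a vfield \<Rightarrow> 'a \<Rightarrow> real" where
  "lie_derivative A W \<omega> E = (\<lambda>x. W x (\<lambda>y. \<omega> y (E y)) - \<omega> x (lie_bracket A W E x))"

definition basic_one_form ::
  "('a::topological_space, 'e::euclidean_space) chart set \<Rightarrow> 'e set \<Rightarrow> ('a, 'e) chart set \<Rightarrow>
   ('a \<Rightarrow> 'a tangent \<Rightarrow> real) \<Rightarrow> bool" where
  "basic_one_form A L F \<omega> \<longleftrightarrow>
     one_form A \<omega> \<and>
     (\<forall>S W. open S \<and> vertical_field A L F S W \<longrightarrow>
        (\<forall>x\<in>S. \<omega> x (W x) = 0) \<and>
        (\<forall>E. vector_field A S E \<longrightarrow> (\<forall>x\<in>S. lie_derivative A W \<omega> E x = 0)))"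


section \<open>O'Neill tensors and mean curvature\<close>

definition oneill_T ::
  "('a::topological_space, 'e::euclidean_space) chart set \<Rightarrow> 'a metric \<Rightarrow> 'a connection \<Rightarrow>
   'e set \<Rightarrow> ('a, 'e) chart set \<Rightarrow> 'a vfield \<Rightarrow> 'a vfield \<Rightarrow> 'a vfield" where
  "oneill_T A g D L F E G =
     vert A g L F (D (vert A g L F E) (hor A g L F G)) +
     hor A g L F (D (vert A g L F E) (vert A g L F G))"

definition oneill_A ::
  "('a::topological_space, 'e::euclidean_space) chart set \<Rightarrow> 'a metric \<Rightarrow> 'a connection \<Rightarrow>
   'e set \<Rightarrow> ('a, 'e) chart set \<Rightarrow> 'a vfield \<Rightarrow> 'a vfield \<Rightarrow> 'a vfield" where
  "oneill_A A g D L F E G =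
     vert A g L F (D (hor A g L F E) (hor A g L F G)) +
     hor A g L F (D (hor A g L F E) (vert A g L F G))"

text \<open>The vertical spaces have dimension \<open>card L\<close>, so an orthonormal family of \<open>card L\<close> fields is a
  frame.\<close>

definition vertical_frame ::
  "('a::topological_space, 'e::euclidean_space) chart set \<Rightarrow> 'a metric \<Rightarrow> 'e set \<Rightarrow>
   ('a, 'e) chart set \<Rightarrow> 'a set \<Rightarrow> (nat \<Rightarrow> 'a vfield) \<Rightarrow> bool" where
  "vertical_frame A g L F S V \<longleftrightarrow>
     (\<forall>i\<in>{1..card L}. vertical_field A L F S (V i)) \<and>
     (\<forall>i\<in>{1..card L}. \<forall>j\<in>{1..card L}. \<forall>x\<in>S. g x (V i x) (V j x) = (if i = j then 1 else 0))"

text \<open>At each point an arbitrary orthonormal frame near that point is used; the value does not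
  depend on this choice because \<open>oneill_T\<close> is tensorial.\<close>

definition mean_curvature ::
  "('a::topological_space, 'e::euclidean_space) chart set \<Rightarrow> 'a metric \<Rightarrow> 'a connection \<Rightarrow>
   'e set \<Rightarrow> ('a, 'e) chart set \<Rightarrow> 'a vfield" where
  "mean_curvature A g D L F = (\<lambda>x.
     let V = (SOME V. \<exists>S. open S \<and> x \<in> S \<and> vertical_frame A g L F S V)
     in \<Sum>i = 1..card L. oneill_T A g D L F (V i) (V i) x)"

definition mean_curvature_form ::
  "('a::topological_space, 'e::euclidean_space) chart set \<Rightarrow> 'a metric \<Rightarrow> 'a connection \<Rightarrow>
   'e set \<Rightarrow> ('a, 'e) chart set \<Rightarrow> 'a \<Rightarrow> 'a tangent \<Rightarrow> real" where
  "mean_curvature_form A g D L F = (\<lambda>x v. g x v (mean_curvature A g D L F x))"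

definition totally_umbilical ::
  "('a::topological_space, 'e::euclidean_space) chart set \<Rightarrow> 'a metric \<Rightarrow> 'a connection \<Rightarrow>
   'e set \<Rightarrow> ('a, 'e) chart set \<Rightarrow> bool" where
  "totally_umbilical A g D L F \<longleftrightarrow>
     (\<forall>S U V. open S \<and> vertical_field A L F S U \<and> vertical_field A L F S V \<longrightarrow>
        (\<forall>x\<in>S. oneill_T A g D L F U V x =
           (g x (U x) (V x) / real (card L)) *\<^sub>R mean_curvature A g D L F x))"

end

theory Submission
  imports Defs
begin

text \<open>Put \<open>H = \<tau> / p\<close>, so that the leaves are umbilical if and only if the horizontal part of
  \<open>D\<^sub>U V\<close> is \<open>g(U,V) H\<close> for vertical \<open>U\<close>, \<open>V\<close>. That the foliation is bundle-like means that \<open>D\<^sub>X X\<close>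
  is horizontal for horizontal \<open>X\<close> (lemma \<open>horizontal_D_self\<close>). Constant sectional curvature \<open>c\<close>
  determines the whole tensor, \<open>R(X,Y)Z = c (g(Y,Z) X - g(X,Z) Y)\<close>
  (lemma \<open>constant_curvature_R4\<close>), and the theorem is obtained by comparing this with three mixed
  components of the curvature. All vector fields below are local; \<open>U\<close>, \<open>V\<close>, \<open>W\<close> are vertical and
  \<open>X\<close>, \<open>Y\<close>, \<open>Z\<close> horizontal.

  The component \<open>g(R(V,W)W, X)\<close> equals \<open>|W|\<^sup>2 g(D\<^sub>V H, X) - g(V,W) g(D\<^sub>W H, X)\<close>, and it vanishes
  because the curvature is constant. As \<open>p \<ge> 2\<close> there is \<open>W \<noteq> 0\<close> orthogonal to \<open>V\<close> at any given point,
  so \<open>D\<^sub>V H\<close> is vertical (lemma \<open>D_vert_H_vertical\<close>). This is part (a).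

  Write \<open>J\<^sub>V X\<close> for the horizontal part of \<open>D\<^sub>X V\<close>, which is \<open>A\<^sub>X V\<close>. The component \<open>g(R(X,V)X, W)\<close>
  gives \<open>g(J\<^sub>V X, J\<^sub>W X) = \<mu>\<^sub>X g(V,W)\<close> with a function \<open>\<mu>\<^sub>X\<close> (lemma \<open>conformal\<close>). The component
  \<open>g(R(X,Y)Z, V) = 0\<close> determines, after a cyclic summation, the derivatives of \<open>A\<close> in
  horizontal directions, and hence the derivative of \<open>J\<^sub>V X\<close> in the direction \<open>H\<close>. If the conformality
  relation is differentiated along \<open>H\<close> at a point where \<open>V\<close> and \<open>W\<close> are orthogonal, everything cancels
  except \<open>2 g(J\<^sub>V H, X) g(J\<^sub>W H, X) = 0\<close> (lemma \<open>D_H_orthogonal_product\<close>). With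
  \<open>X = J\<^sub>V H + J\<^sub>W H\<close> this reads \<open>(\<mu>\<^sub>H)\<^sup>2 |V|\<^sup>2 |W|\<^sup>2 = 0\<close>, and since such \<open>V\<close>, \<open>W\<close> exist for \<open>p \<ge> 2\<close>, one gets
  \<open>\<mu>\<^sub>H = 0\<close> and therefore \<open>J\<^sub>V H = 0\<close> for all \<open>V\<close> (lemma \<open>D_H_vertical\<close>). This is part (c).

  Both results together say that \<open>[V,\<tau>] = D\<^sub>V \<tau> - D\<^sub>\<tau> V\<close> is vertical. A horizontal field with this property
  is basic (lemma \<open>basic_fieldI\<close>): in a foliated chart its transverse components have vanishing
  derivatives along the plaques. The Lie derivative of \<open>\<kappa>\<close> along a vertical field is computed from the
  same two facts. This is part (b).

  The first half of the file supplies the calculus that these computations use: smooth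
  functions in coordinates, tangent vectors as derivations on germs, the local nature of the
  Levi-Civita connection, the symmetries of its curvature, and the smoothness of the orthogonal
  projections to the leaves.\<close>

section \<open>Functions of class C^k\<close>

lemma cont_diff_on_subset:
  "cont_diff_on k S f \<Longrightarrow> T \<subseteq> S \<Longrightarrow> cont_diff_on k T f"
  by (induction k arbitrary: f) (auto intro: continuous_on_subset)

lemma cont_diff_on_cong_imp:
  assumes "open S" "\<And>x. x \<in> S \<Longrightarrow> f x = g x" "cont_diff_on k S f"
  shows "cont_diff_on k S g"
  using assms
proof (induction k arbitrary: f g)
  case 0
  then show ?case using continuous_on_cong[of S S f g] by auto
next
  case (Suc k)
  have d: "g differentiable (at x)" if "x \<in> S" for x
    using Suc.prems that has_derivative_transform_within_open[of f _ x UNIV S g]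
    unfolding differentiable_def cont_diff_on.simps by blast
  have e: "frechet_derivative f (at x) = frechet_derivative g (at x)" if "x \<in> S" for x
    using Suc.prems that by (intro frechet_derivative_transform_within_open[of _ _ S]) auto
  show ?case
    using Suc.IH[OF Suc.prems(1), of "\<lambda>x. frechet_derivative f (at x) v"
        "\<lambda>x. frechet_derivative g (at x) v" for v] Suc.prems d e
    by auto
qed

lemma cont_diff_on_Suc_D:
  assumes "open S" "cont_diff_on (Suc k) S f"
  shows "cont_diff_on k S f"
  using assms(2)
proof (induction k arbitrary: f)
  case 0
  then show ?case
    by (auto intro!: continuous_at_imp_continuous_on differentiable_imp_continuous_within)
next
  case (Suc k)
  then show ?case by (subst cont_diff_on.simps) (auto simp del: cont_diff_on.simps simp: cont_diff_on.simps(2)[of "Suc k"])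
qed

lemma cont_diff_on_local:
  assumes "\<And>x. x \<in> S \<Longrightarrow> \<exists>T. open T \<and> x \<in> T \<and> cont_diff_on k T f"
  shows "cont_diff_on k S f"
  using assms
proof (induction k arbitrary: f)
  case 0
  then show ?case
    by (auto intro!: continuous_at_imp_continuous_on)
       (meson continuous_on_eq_continuous_at)
next
  case (Suc k)
  have "f differentiable (at x)" if "x \<in> S" for x
    using Suc.prems[OF that] by auto
  moreover have "cont_diff_on k S (\<lambda>x. frechet_derivative f (at x) v)" for v
  proof (rule Suc.IH)
    fix x assume "x \<in> S"
    from Suc.prems[OF this] show "\<exists>T. open T \<and> x \<in> T \<and>
        cont_diff_on k T (\<lambda>x. frechet_derivative f (at x) v)"
      by auto
  qed
  ultimately show ?case by simp
qed

lemma cont_diff_on_const: "cont_diff_on k S (\<lambda>x. c)"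
proof (induction k arbitrary: c)
  case (Suc k)
  then show ?case by simp
qed simp

text \<open>Closure properties are proved by computing a candidate for the derivative and showing that its
  directional values are of class \<open>C^k\<close>.\<close>

lemma cont_diff_on_SucI:
  assumes "open S" "\<And>x. x \<in> S \<Longrightarrow> (f has_derivative f' x) (at x)"
    and "\<And>v. cont_diff_on k S (\<lambda>x. f' x v)"
  shows "cont_diff_on (Suc k) S f"
proof -
  have "frechet_derivative f (at x) = f' x" if "x \<in> S" for x
    using frechet_derivative_at[OF assms(2)[OF that]] by simp
  then have "cont_diff_on k S (\<lambda>x. frechet_derivative f (at x) v)" for v
    using cont_diff_on_cong_imp[OF assms(1) _ assms(3)] by simp
  moreover have "f differentiable (at x)" if "x \<in> S" for x
    using assms(2)[OF that] by (auto simp: differentiable_def)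
  ultimately show ?thesis by simp
qed

lemma cont_diff_on_bounded_linear:
  assumes "open S" "bounded_linear h" "cont_diff_on k S f"
  shows "cont_diff_on k S (\<lambda>x. h (f x))"
  using assms(3)
proof (induction k arbitrary: f)
  case 0
  then show ?case using bounded_linear.continuous_on[OF assms(2)] by auto
next
  case (Suc k)
  have d: "((\<lambda>x. h (f x)) has_derivative (\<lambda>v. h (frechet_derivative f (at x) v))) (at x)"
    if "x \<in> S" for x
    using bounded_linear.has_derivative[OF assms(2)] Suc.prems that frechet_derivative_works
    by fastforce
  show ?case
    by (rule cont_diff_on_SucI[OF assms(1) d]) (use Suc in auto)
qed

lemma cont_diff_on_add:
  assumes "open S" "cont_diff_on k S f" "cont_diff_on k S g"
  shows "cont_diff_on k S (\<lambda>x. f x + g x)"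
  using assms(2,3)
proof (induction k arbitrary: f g)
  case 0
  then show ?case by (auto intro: continuous_on_add)
next
  case (Suc k)
  have d: "((\<lambda>x. f x + g x) has_derivative
      (\<lambda>v. frechet_derivative f (at x) v + frechet_derivative g (at x) v)) (at x)"
    if "x \<in> S" for x
    using Suc.prems that frechet_derivative_works
    by (intro has_derivative_add) (auto simp: frechet_derivative_works[symmetric])
  show ?case
    by (rule cont_diff_on_SucI[OF assms(1) d]) (use Suc in auto)
qed

lemma cont_diff_on_sum:
  assumes "open S" "finite I" "\<And>i. i \<in> I \<Longrightarrow> cont_diff_on k S (f i)"
  shows "cont_diff_on k S (\<lambda>x. \<Sum>i\<in>I. f i x)"
  using assms(2,3)
proof (induction I rule: finite_induct)
  case empty
  then show ?case by (simp add: cont_diff_on_const)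
next
  case (insert i I)
  then show ?case using cont_diff_on_add[OF assms(1), of k "f i" "\<lambda>x. \<Sum>i\<in>I. f i x"] by simp
qed

lemma cont_diff_on_scaleR:
  assumes "open S" "cont_diff_on k S f" "cont_diff_on k S g"
  shows "cont_diff_on k S (\<lambda>x. f x *\<^sub>R g x)"
  using assms(2,3)
proof (induction k arbitrary: f g)
  case 0
  then show ?case by (auto intro: continuous_on_scaleR)
next
  case (Suc k)
  let ?h = "\<lambda>v x. f x *\<^sub>R frechet_derivative g (at x) v + frechet_derivative f (at x) v *\<^sub>R g x"
  have d: "((\<lambda>x. f x *\<^sub>R g x) has_derivative (\<lambda>v. ?h v x)) (at x)" if "x \<in> S" for x
    using Suc.prems that
    by (intro has_derivative_scaleR) (auto simp: frechet_derivative_works[symmetric])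
  have c: "cont_diff_on k S (?h v)" for v
    using Suc.prems cont_diff_on_Suc_D[OF assms(1) Suc.prems(1)]
      cont_diff_on_Suc_D[OF assms(1) Suc.prems(2)]
    by (intro cont_diff_on_add Suc.IH assms) auto
  show ?case by (rule cont_diff_on_SucI[OF assms(1) d c])
qed

lemma cont_diff_on_inverse:
  fixes f :: "'e::real_normed_vector \<Rightarrow> real"
  assumes "open S" "cont_diff_on k S f" "\<And>x. x \<in> S \<Longrightarrow> f x \<noteq> 0"
  shows "cont_diff_on k S (\<lambda>x. inverse (f x))"
  using assms(2)
proof (induction k)
  case 0
  then show ?case using assms(3) by (auto intro: continuous_on_inverse)
next
  case (Suc k)
  let ?h = "\<lambda>v x. (inverse (f x) * inverse (f x)) *\<^sub>R ((-1) *\<^sub>R frechet_derivative f (at x) v)"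
  have d: "((\<lambda>x. inverse (f x)) has_derivative (\<lambda>v. ?h v x)) (at x)" if "x \<in> S" for x
  proof -
    have "(f has_derivative frechet_derivative f (at x)) (at x)"
      using Suc.prems that by (simp add: frechet_derivative_works[symmetric])
    from Deriv.has_derivative_inverse[OF _ this] assms(3)[OF that] show ?thesis
      by (auto simp: algebra_simps)
  qed
  have i: "cont_diff_on k S (\<lambda>x. inverse (f x))"
    by (rule Suc.IH[OF cont_diff_on_Suc_D[OF assms(1) Suc.prems]])
  have c: "cont_diff_on k S (?h v)" for v
    using Suc.prems i cont_diff_on_scaleR[OF assms(1) i i]
    by (intro cont_diff_on_scaleR cont_diff_on_const assms) auto
  show ?case by (rule cont_diff_on_SucI[OF assms(1) d c])
qed

text \<open>The chain rule expresses the derivative of \<open>h \<circ> f\<close> by the partial derivatives of \<open>h\<close>, composed with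
  \<open>f\<close>, so that the composition of maps of class \<open>C^k\<close> only has to be treated for scalar combinations.\<close>

lemma cont_diff_on_compose_Suc:
  fixes f :: "'d::real_normed_vector \<Rightarrow> 'e::euclidean_space"
    and h :: "'e \<Rightarrow> 'f::real_normed_vector"
  assumes "open S" "f ` S \<subseteq> T"
    and IH: "\<And>h :: 'e \<Rightarrow> 'f. cont_diff_on k T h \<Longrightarrow> cont_diff_on k S (h \<circ> f)"
    and f: "cont_diff_on (Suc k) S f" and h: "cont_diff_on (Suc k) T h"
  shows "cont_diff_on (Suc k) S (h \<circ> f)"
proof -
  let ?h = "\<lambda>v x. \<Sum>b\<in>Basis.
      (frechet_derivative f (at x) v \<bullet> b) *\<^sub>R ((\<lambda>y. frechet_derivative h (at y) b) \<circ> f) x"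
  have d: "((h \<circ> f) has_derivative (\<lambda>v. ?h v x)) (at x)" if "x \<in> S" for x
  proof -
    have f': "(f has_derivative frechet_derivative f (at x)) (at x)"
      using f that by (simp add: frechet_derivative_works[symmetric])
    have h': "(h has_derivative frechet_derivative h (at (f x))) (at (f x))"
      using h that assms(2) by (auto simp: frechet_derivative_works[symmetric])
    interpret h: linear "frechet_derivative h (at (f x))"
      using h' by (rule has_derivative_linear)
    have "frechet_derivative h (at (f x)) \<circ> frechet_derivative f (at x) = (\<lambda>v. ?h v x)"
    proof
      fix v
      have "frechet_derivative h (at (f x)) (frechet_derivative f (at x) v) =
          frechet_derivative h (at (f x)) (\<Sum>b\<in>Basis. (frechet_derivative f (at x) v \<bullet> b) *\<^sub>R b)"
        by (simp only: euclidean_representation)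
      then show "(frechet_derivative h (at (f x)) \<circ> frechet_derivative f (at x)) v = ?h v x"
        by (simp only: h.sum h.scale o_apply)
    qed
    with diff_chain_at[OF f' h'] show ?thesis by (simp only:)
  qed
  have c: "cont_diff_on k S (?h v)" for v
  proof (rule cont_diff_on_sum[OF assms(1) finite_Basis], rule cont_diff_on_scaleR[OF assms(1)])
    fix b :: 'e assume "b \<in> Basis"
    show "cont_diff_on k S (\<lambda>x. frechet_derivative f (at x) v \<bullet> b)"
      using f
      by (intro cont_diff_on_bounded_linear[OF assms(1) bounded_linear_inner_left]) auto
    show "cont_diff_on k S ((\<lambda>y. frechet_derivative h (at y) b) \<circ> f)"
      using h by (intro IH) auto
  qed
  show ?thesis
    by (rule cont_diff_on_SucI[where f' = "\<lambda>x v. ?h v x", OF assms(1)]) (erule d, rule c)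
qed

lemma cont_diff_on_compose:
  fixes f :: "'d::real_normed_vector \<Rightarrow> 'e::euclidean_space"
    and h :: "'e \<Rightarrow> 'f::real_normed_vector"
  assumes "open S" "f ` S \<subseteq> T" "cont_diff_on k S f" "cont_diff_on k T h"
  shows "cont_diff_on k S (h \<circ> f)"
proof -
  have "cont_diff_on k S f \<Longrightarrow> \<forall>h :: 'e \<Rightarrow> 'f. cont_diff_on k T h \<longrightarrow> cont_diff_on k S (h \<circ> f)"
  proof (induction k)
    case 0
    have "continuous_on S (h \<circ> f)" if "continuous_on S f" "continuous_on T h" for h :: "'e \<Rightarrow> 'f"
      by (rule continuous_on_compose[OF that(1) continuous_on_subset[OF that(2) assms(2)]])
    with 0 show ?case unfolding cont_diff_on.simps by blast
  next
    case (Suc k)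
    have "cont_diff_on k S f" by (rule cont_diff_on_Suc_D[OF assms(1) Suc.prems])
    with Suc.IH have "\<And>h :: 'e \<Rightarrow> 'f. cont_diff_on k T h \<Longrightarrow> cont_diff_on k S (h \<circ> f)"
      by blast
    from cont_diff_on_compose_Suc[OF assms(1,2) this Suc.prems] show ?case by blast
  qed
  with assms(3,4) show ?thesis by blast
qed

lemma smooth_on_subset: "smooth_on S f \<Longrightarrow> T \<subseteq> S \<Longrightarrow> smooth_on T f"
  by (auto simp: smooth_on_def intro: cont_diff_on_subset)

lemma smooth_on_cong:
  assumes "open S" "\<And>x. x \<in> S \<Longrightarrow> f x = g x"
  shows "smooth_on S f \<longleftrightarrow> smooth_on S g"
  using cont_diff_on_cong_imp[OF assms(1), of f g] cont_diff_on_cong_imp[OF assms(1), of g f]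
    assms(2) by (auto simp: smooth_on_def)

lemma smooth_on_local:
  assumes "\<And>x. x \<in> S \<Longrightarrow> \<exists>T. open T \<and> x \<in> T \<and> smooth_on T f"
  shows "smooth_on S f"
  unfolding smooth_on_def
proof (intro allI cont_diff_on_local)
  fix k x assume "x \<in> S"
  from assms[OF this] show "\<exists>T. open T \<and> x \<in> T \<and> cont_diff_on k T f"
    by (auto simp: smooth_on_def)
qed

lemma smooth_on_const: "smooth_on S (\<lambda>x. c)"
  by (simp add: smooth_on_def cont_diff_on_const)

lemma smooth_on_add:
  "open S \<Longrightarrow> smooth_on S f \<Longrightarrow> smooth_on S g \<Longrightarrow> smooth_on S (\<lambda>x. f x + g x)"
  by (simp add: smooth_on_def cont_diff_on_add)

lemma smooth_on_scaleR:
  "open S \<Longrightarrow> smooth_on S f \<Longrightarrow> smooth_on S g \<Longrightarrow> smooth_on S (\<lambda>x. f x *\<^sub>R g x)"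
  by (simp add: smooth_on_def cont_diff_on_scaleR)

lemma smooth_on_inverse:
  fixes f :: "'e::real_normed_vector \<Rightarrow> real"
  shows "open S \<Longrightarrow> smooth_on S f \<Longrightarrow> (\<And>x. x \<in> S \<Longrightarrow> f x \<noteq> 0) \<Longrightarrow>
    smooth_on S (\<lambda>x. inverse (f x))"
  by (simp add: smooth_on_def cont_diff_on_inverse)

lemma smooth_on_compose:
  fixes f :: "'d::real_normed_vector \<Rightarrow> 'e::euclidean_space"
  assumes "open S" "f ` S \<subseteq> T" "smooth_on S f" "smooth_on T h"
  shows "smooth_on S (h \<circ> f)"
  unfolding smooth_on_def
  by (rule allI, rule cont_diff_on_compose[OF assms(1,2)]) (use assms(3,4) in \<open>simp_all add: smooth_on_def\<close>)

lemma smooth_on_differentiable: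
  assumes "smooth_on S f" "x \<in> S"
  shows "f differentiable (at x)"
  using assms cont_diff_on.simps(2) unfolding smooth_on_def by blast

lemma smooth_on_frechet_derivative:
  assumes "smooth_on S f"
  shows "smooth_on S (\<lambda>x. frechet_derivative f (at x) v)"
  using assms cont_diff_on.simps(2) unfolding smooth_on_def by blast

lemma smooth_on_inner_left: 
  fixes w :: "'e::real_inner"
  shows "smooth_on S (\<lambda>y. y \<bullet> w)"
proof -
  have "cont_diff_on k S (\<lambda>y. y \<bullet> w)" for k
  proof (cases k)
    case 0
    then show ?thesis by (simp add: continuous_on_inner)
  next
    case (Suc m)
    have "((\<lambda>y. y \<bullet> w) has_derivative (\<lambda>v. v \<bullet> w)) (at x)" for x
      by (rule bounded_linear_imp_has_derivative[OF bounded_linear_inner_left])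
    then have "frechet_derivative (\<lambda>y. y \<bullet> w) (at x) = (\<lambda>v. v \<bullet> w)" for x
      using frechet_derivative_at[of "\<lambda>y. y \<bullet> w" "\<lambda>v. v \<bullet> w" x] by simp
    then show ?thesis by (simp add: Suc cont_diff_on_const)
  qed
  then show ?thesis by (simp add: smooth_on_def)
qed

section \<open>Charts, smooth functions and tangent vectors\<close>

lemma is_chartD:
  assumes "is_chart (U, \<phi>)"
  shows "open U" "open (\<phi> ` U)" "homeomorphism U (\<phi> ` U) \<phi> (inv_into U \<phi>)"
  using assms by (auto simp: is_chart_def)

lemma chart_inverse:
  assumes "is_chart (U, \<phi>)" "x \<in> U"
  shows "inv_into U \<phi> (\<phi> x) = x"
  using is_chartD(3)[OF assms(1)] assms(2) by (simp add: homeomorphism_def)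

lemma chart_open_image:
  assumes "is_chart (U, \<phi>)" "open N"
  shows "open (\<phi> ` (N \<inter> U))"
proof -
  have "openin (top_of_set U) (N \<inter> U)"
    using openin_open_Int[OF assms(2), of U] by (simp add: inf_commute)
  with is_chartD(3)[OF assms(1)] have "openin (top_of_set (\<phi> ` U)) (\<phi> ` (N \<inter> U))"
    by (rule homeomorphism_imp_open_map)
  with is_chartD(2)[OF assms(1)] show ?thesis
    by (simp add: openin_open_eq)
qed

lemma smooth_atlas_chart:
  assumes "smooth_atlas A" "c \<in> A" shows "is_chart c"
  using assms by (simp add: smooth_atlas_def)

lemma smooth_atlas_cover:
  assumes "smooth_atlas A" obtains U \<phi> where "(U, \<phi>) \<in> A" "x \<in> U"
  using assms unfolding smooth_atlas_def by (metis (no_types, lifting) UNIV_I UN_E case_prod_beta prod.collapse)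

lemma smooth_atlas_transition:
  assumes "smooth_atlas A" "(U, \<phi>) \<in> A" "(V, \<psi>) \<in> A"
  shows "smooth_on (\<phi> ` (U \<inter> V)) (\<psi> \<circ> inv_into U \<phi>)"
  using assms unfolding smooth_atlas_def by blast

lemma smooth_atlas_insert:
  assumes "smooth_atlas A" "smooth_atlas B" "A \<subseteq> B" "c \<in> B"
  shows "smooth_atlas (insert c A)"
proof -
  have "(\<Union>(U, \<phi>)\<in>A. U) = UNIV" using assms(1) by (simp add: smooth_atlas_def)
  then have "(\<Union>(U, \<phi>)\<in>insert c A. U) = UNIV" by auto
  moreover have sub: "x \<in> B" if "x \<in> insert c A" for x using assms that by blast
  moreover have "smooth_on (snd x ` (fst x \<inter> fst y)) (snd y \<circ> inv_into (fst x) (snd x))"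
    if "x \<in> insert c A" "y \<in> insert c A" for x y
    by (rule smooth_atlas_transition[OF assms(2)]) (use sub that in simp_all)
  moreover have "is_chart x" if "x \<in> insert c A" for x
    by (rule smooth_atlas_chart[OF assms(2) sub[OF that]])
  ultimately show ?thesis
    unfolding smooth_atlas_def case_prod_beta by (intro conjI ballI)
qed

lemma smooth_fun_subset: "smooth_fun A S f \<Longrightarrow> T \<subseteq> S \<Longrightarrow> smooth_fun A T f"
  unfolding smooth_fun_def by (fastforce intro: smooth_on_subset)

lemma smooth_funI:
  assumes "\<And>U \<phi>. (U, \<phi>) \<in> A \<Longrightarrow> smooth_on (\<phi> ` (S \<inter> U)) (f \<circ> inv_into U \<phi>)"
  shows "smooth_fun A S f"
  using assms by (auto simp: smooth_fun_def)

lemma smooth_funD: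
  assumes "smooth_fun A S f" "(U, \<phi>) \<in> A"
  shows "smooth_on (\<phi> ` (S \<inter> U)) (f \<circ> inv_into U \<phi>)"
  using assms by (auto simp: smooth_fun_def)

context
  fixes A :: "('a::{t2_space, second_countable_topology}, 'e::euclidean_space) chart set"
  assumes A: "smooth_atlas A"
begin

lemma smooth_fun_cong_imp:
  assumes "open S" "\<And>x. x \<in> S \<Longrightarrow> f x = g x" "smooth_fun A S f"
  shows "smooth_fun A S g"
proof (rule smooth_funI)
  fix U \<phi> assume c: "(U, \<phi>) \<in> A"
  note ch = smooth_atlas_chart[OF A c]
  have "f (inv_into U \<phi> y) = g (inv_into U \<phi> y)" if "y \<in> \<phi> ` (S \<inter> U)" for y
    using that assms(2) by (auto simp: chart_inverse[OF ch])
  with smooth_on_cong[OF chart_open_image[OF ch assms(1)]] smooth_funD[OF assms(3) c]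
  show "smooth_on (\<phi> ` (S \<inter> U)) (g \<circ> inv_into U \<phi>)"
    by (metis (no_types, lifting) o_apply)
qed

lemma smooth_fun_local:
  assumes "\<And>x. x \<in> S \<Longrightarrow> \<exists>T. open T \<and> x \<in> T \<and> smooth_fun A T f"
  shows "smooth_fun A S f"
proof (rule smooth_funI, rule smooth_on_local)
  fix U \<phi> y assume c: "(U, \<phi>) \<in> A" and "y \<in> \<phi> ` (S \<inter> U)"
  then obtain x where x: "x \<in> S" "x \<in> U" "y = \<phi> x" by auto
  from assms[OF x(1)] obtain T where T: "open T" "x \<in> T" "smooth_fun A T f" by blast
  show "\<exists>T. open T \<and> y \<in> T \<and> smooth_on T (f \<circ> inv_into U \<phi>)"
    using chart_open_image[OF smooth_atlas_chart[OF A c] T(1)] smooth_funD[OF T(3) c] x T(2)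
    by blast
qed

lemma smooth_fun_const: "smooth_fun A S (\<lambda>x. c)"
  by (rule smooth_funI) (simp add: o_def smooth_on_const)

lemma smooth_fun_add:
  assumes "open S" "smooth_fun A S f" "smooth_fun A S g"
  shows "smooth_fun A S (\<lambda>x. f x + g x)"
proof (rule smooth_funI)
  fix U \<phi> assume c: "(U, \<phi>) \<in> A"
  show "smooth_on (\<phi> ` (S \<inter> U)) ((\<lambda>x. f x + g x) \<circ> inv_into U \<phi>)"
    using smooth_on_add[OF chart_open_image[OF smooth_atlas_chart[OF A c] assms(1)]
        smooth_funD[OF assms(2) c] smooth_funD[OF assms(3) c]] by (simp add: o_def)
qed

lemma smooth_fun_mult:
  assumes "open S" "smooth_fun A S f" "smooth_fun A S g"
  shows "smooth_fun A S (\<lambda>x. f x * g x)"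
proof (rule smooth_funI)
  fix U \<phi> assume c: "(U, \<phi>) \<in> A"
  show "smooth_on (\<phi> ` (S \<inter> U)) ((\<lambda>x. f x * g x) \<circ> inv_into U \<phi>)"
    using smooth_on_scaleR[OF chart_open_image[OF smooth_atlas_chart[OF A c] assms(1)]
        smooth_funD[OF assms(2) c] smooth_funD[OF assms(3) c]] by (simp add: o_def)
qed

lemma smooth_fun_inverse:
  assumes "open S" "smooth_fun A S f" "\<And>x. x \<in> S \<Longrightarrow> f x \<noteq> 0"
  shows "smooth_fun A S (\<lambda>x. inverse (f x))"
proof (rule smooth_funI)
  fix U \<phi> assume c: "(U, \<phi>) \<in> A"
  note ch = smooth_atlas_chart[OF A c]
  have "(f \<circ> inv_into U \<phi>) y \<noteq> 0" if "y \<in> \<phi> ` (S \<inter> U)" for y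
    using that assms(3) by (auto simp: chart_inverse[OF ch])
  from smooth_on_inverse[OF chart_open_image[OF ch assms(1)] smooth_funD[OF assms(2) c] this]
  show "smooth_on (\<phi> ` (S \<inter> U)) ((\<lambda>x. inverse (f x)) \<circ> inv_into U \<phi>)" by (simp add: o_def)
qed

lemma smooth_fun_diff:
  assumes "open S" "smooth_fun A S f" "smooth_fun A S g"
  shows "smooth_fun A S (\<lambda>x. f x - g x)"
  using smooth_fun_add[OF assms(1,2) smooth_fun_mult[OF assms(1) smooth_fun_const[of S "-1"] assms(3)]]
  by simp

lemma smooth_nearI: "smooth_fun A S f \<Longrightarrow> open S \<Longrightarrow> x \<in> S \<Longrightarrow> smooth_near A x f"
  unfolding smooth_near_def by blast

lemma smooth_near_cong:
  assumes "open S" "x \<in> S" "\<And>y. y \<in> S \<Longrightarrow> f y = g y"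
  shows "smooth_near A x f \<longleftrightarrow> smooth_near A x g"
proof -
  have "smooth_near A x g" if "smooth_near A x f" "\<And>y. y \<in> S \<Longrightarrow> f y = g y" for f g
  proof -
    from that obtain T where T: "open T" "x \<in> T" "smooth_fun A T f"
      unfolding smooth_near_def by blast
    have "smooth_fun A (S \<inter> T) g"
      using that(2) T(1) assms(1) smooth_fun_subset[OF T(3), of "S \<inter> T"]
      by (intro smooth_fun_cong_imp[of "S \<inter> T" f g]) auto
    then show ?thesis using assms T by (intro smooth_nearI[of "S \<inter> T"]) auto
  qed
  from this[of f g] this[of g f] assms(3) show ?thesis by auto
qed

lemma smooth_near2:
  assumes "smooth_near A x f" "smooth_near A x g"
  obtains S where "open S" "x \<in> S" "smooth_fun A S f" "smooth_fun A S g"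
proof -
  from assms obtain S T where "open S" "x \<in> S" "smooth_fun A S f" "open T" "x \<in> T" "smooth_fun A T g"
    unfolding smooth_near_def by blast
  then show ?thesis
    by (intro that[of "S \<inter> T"]) (auto intro: smooth_fun_subset)
qed

lemma smooth_near_add:
  "smooth_near A x f \<Longrightarrow> smooth_near A x g \<Longrightarrow> smooth_near A x (\<lambda>y. f y + g y)"
  by (erule (1) smooth_near2) (auto intro: smooth_nearI smooth_fun_add)

lemma smooth_near_mult:
  "smooth_near A x f \<Longrightarrow> smooth_near A x g \<Longrightarrow> smooth_near A x (\<lambda>y. f y * g y)"
  by (erule (1) smooth_near2) (auto intro: smooth_nearI smooth_fun_mult)

lemma smooth_near_const: "smooth_near A x (\<lambda>y. c)"
  using smooth_nearI[OF smooth_fun_const open_UNIV] by blast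

end

text \<open>Smoothness is transported between two charts by the transition map.\<close>

lemma smooth_on_change:
  fixes f :: "'a::topological_space \<Rightarrow> real"
    and \<phi> :: "'a \<Rightarrow> 'e::euclidean_space" and \<psi> :: "'a \<Rightarrow> 'e"
  assumes "is_chart (V, \<psi>)" "open N"
    and t: "smooth_on (\<phi> ` (U \<inter> V)) (\<psi> \<circ> inv_into U \<phi>)"
    and f: "smooth_on (\<psi> ` (N \<inter> V)) (f \<circ> inv_into V \<psi>)"
    and ch: "is_chart (U, \<phi>)"
  shows "smooth_on (\<phi> ` (N \<inter> U \<inter> V)) (f \<circ> inv_into U \<phi>)"
proof -
  have "open ((N \<inter> V) \<inter> U)" "N \<inter> U \<inter> V = (N \<inter> V) \<inter> U"
    using assms(2) is_chartD(1)[OF ch] is_chartD(1)[OF assms(1)] by auto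
  then have o: "open (\<phi> ` (N \<inter> U \<inter> V))"
    using chart_open_image[OF ch, of "N \<inter> V"] assms(2) is_chartD(1)[OF assms(1)] by auto
  have "smooth_on (\<phi> ` (N \<inter> U \<inter> V)) ((f \<circ> inv_into V \<psi>) \<circ> (\<psi> \<circ> inv_into U \<phi>))"
  proof (rule smooth_on_compose[OF o _ _ f])
    show "(\<psi> \<circ> inv_into U \<phi>) ` \<phi> ` (N \<inter> U \<inter> V) \<subseteq> \<psi> ` (N \<inter> V)"
      by (auto simp: chart_inverse[OF ch])
    show "smooth_on (\<phi> ` (N \<inter> U \<inter> V)) (\<psi> \<circ> inv_into U \<phi>)"
      by (rule smooth_on_subset[OF t]) auto
  qed
  then show ?thesis
    by (rule smooth_on_cong[OF o, THEN iffD1, rotated])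
       (auto simp: chart_inverse[OF ch] chart_inverse[OF assms(1)])
qed

text \<open>A chart that is compatible with the atlas may be used to test smoothness and to represent
  tangent vectors although it need not belong to the atlas. This is needed because the charts of
  a foliation are not assumed to be members of the atlas of the manifold.\<close>

locale compatible_chart =
  fixes A :: "('a::{t2_space, second_countable_topology}, 'e::euclidean_space) chart set"
    and U :: "'a set" and \<phi> :: "'a \<Rightarrow> 'e"
  assumes atlas: "smooth_atlas A"
    and compatible: "smooth_atlas (insert (U, \<phi>) A)"
begin

lemma chart: "is_chart (U, \<phi>)"
  using smooth_atlas_chart[OF compatible] by simp

lemmas open_domain = is_chartD(1)[OF chart]
lemmas inverse_eq [simp] = chart_inverse[OF chart]

lemma open_image: "open N \<Longrightarrow> N \<subseteq> U \<Longrightarrow> open (\<phi> ` N)"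
  using chart_open_image[OF chart, of N] by (simp add: Int_absorb2)

lemma smooth_fun_iff:
  assumes N: "open N" "N \<subseteq> U"
  shows "smooth_fun A N f \<longleftrightarrow> smooth_on (\<phi> ` N) (f \<circ> inv_into U \<phi>)"
proof
  assume f: "smooth_fun A N f"
  show "smooth_on (\<phi> ` N) (f \<circ> inv_into U \<phi>)"
  proof (rule smooth_on_local)
    fix y assume "y \<in> \<phi> ` N"
    then obtain x where x: "x \<in> N" "y = \<phi> x" by auto
    obtain V \<psi> where V: "(V, \<psi>) \<in> A" "x \<in> V" by (rule smooth_atlas_cover[OF atlas])
    note ch = smooth_atlas_chart[OF atlas V(1)]
    have "smooth_on (\<phi> ` (U \<inter> V)) (\<psi> \<circ> inv_into U \<phi>)"
      by (rule smooth_atlas_transition[OF compatible]) (use V in simp_all)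
    from smooth_on_change[OF ch N(1) this smooth_funD[OF f V(1)] chart]
    have "smooth_on (\<phi> ` (N \<inter> U \<inter> V)) (f \<circ> inv_into U \<phi>)" .
    moreover have "open (\<phi> ` (N \<inter> U \<inter> V))"
      using N is_chartD(1)[OF ch] by (intro open_image) (auto intro: open_domain)
    moreover have "y \<in> \<phi> ` (N \<inter> U \<inter> V)" using x V N by auto
    ultimately show "\<exists>T. open T \<and> y \<in> T \<and> smooth_on T (f \<circ> inv_into U \<phi>)"
      by (intro exI[of _ "\<phi> ` (N \<inter> U \<inter> V)"] conjI)
  qed
next
  assume f: "smooth_on (\<phi> ` N) (f \<circ> inv_into U \<phi>)"
  show "smooth_fun A N f"
  proof (rule smooth_funI)
    fix V \<psi> assume V: "(V, \<psi>) \<in> A"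
    have NU: "N \<inter> U = N" using N by auto
    have t: "smooth_on (\<psi> ` (V \<inter> U)) (\<phi> \<circ> inv_into V \<psi>)"
      by (rule smooth_atlas_transition[OF compatible]) (use V in simp_all)
    have "smooth_on (\<phi> ` (N \<inter> U)) (f \<circ> inv_into U \<phi>)"
      using f by (simp only: NU)
    from smooth_on_change[OF chart N(1) t this smooth_atlas_chart[OF atlas V]]
    have "smooth_on (\<psi> ` (N \<inter> V \<inter> U)) (f \<circ> inv_into V \<psi>)" .
    moreover have "N \<inter> V \<inter> U = N \<inter> V" using N by auto
    ultimately show "smooth_on (\<psi> ` (N \<inter> V)) (f \<circ> inv_into V \<psi>)" by (simp only:)
  qed
qed

lemma smooth_near_differentiable:
  assumes "smooth_near A x f" "x \<in> U"
  shows "(f \<circ> inv_into U \<phi>) differentiable (at (\<phi> x))"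
proof -
  from assms(1) obtain S where S: "open S" "x \<in> S" "smooth_fun A S f"
    unfolding smooth_near_def by blast
  have "smooth_fun A (S \<inter> U) f" using S(3) by (rule smooth_fun_subset) auto
  then have "smooth_on (\<phi> ` (S \<inter> U)) (f \<circ> inv_into U \<phi>)"
    using smooth_fun_iff[of "S \<inter> U"] S open_domain by auto
  then show ?thesis using S assms(2) by (intro smooth_on_differentiable) auto
qed

lemma chart_deriv_apply:
  "chart_deriv A (U, \<phi>) x w f =
    (if smooth_near A x f then frechet_derivative (f \<circ> inv_into U \<phi>) (at (\<phi> x)) w else 0)"
  by (simp add: chart_deriv_def)

lemma linear_chart_deriv: "x \<in> U \<Longrightarrow> linear (chart_deriv A (U, \<phi>) x)"
  using linear_frechet_derivative[OF smooth_near_differentiable]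
  by (intro linearI ext)
     (auto simp: chart_deriv_apply plus_fun_def scaleR_fun_def linear_add linear_cmul)

lemma smooth_coordinate: "smooth_fun A U (\<lambda>x. \<phi> x \<bullet> w)"
proof -
  have "smooth_on (\<phi> ` U) ((\<lambda>x. \<phi> x \<bullet> w) \<circ> inv_into U \<phi>)"
    by (rule smooth_on_cong[OF open_image[OF open_domain order_refl], THEN iffD1, OF _ smooth_on_inner_left[of _ w]])
       auto
  then show ?thesis using smooth_fun_iff[OF open_domain order_refl] by blast
qed

lemma smooth_near_coordinate: "x \<in> U \<Longrightarrow> smooth_near A x (\<lambda>x. \<phi> x \<bullet> w)"
  using smooth_nearI[OF atlas smooth_coordinate open_domain] .

lemma chart_deriv_coordinate:
  assumes "x \<in> U"
  shows "chart_deriv A (U, \<phi>) x v (\<lambda>x. \<phi> x \<bullet> w) = v \<bullet> w"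
proof -
  have "((\<lambda>y. y \<bullet> w) has_derivative (\<lambda>v. v \<bullet> w)) (at (\<phi> x))"
    by (rule bounded_linear_imp_has_derivative[OF bounded_linear_inner_left])
  then have "(((\<lambda>x. \<phi> x \<bullet> w) \<circ> inv_into U \<phi>) has_derivative (\<lambda>v. v \<bullet> w)) (at (\<phi> x))"
    by (rule has_derivative_transform_within_open[OF _ open_image[OF open_domain order_refl]])
       (use assms in auto)
  from fun_cong[OF frechet_derivative_at[OF this, symmetric]] show ?thesis
    using smooth_near_coordinate[OF assms] by (simp add: chart_deriv_apply)
qed

lemma smooth_fun_chart_deriv:
  assumes "smooth_fun A N f" "open N" "N \<subseteq> U"
  shows "smooth_fun A N (\<lambda>x. chart_deriv A (U, \<phi>) x w f)"
proof -
  let ?d = "\<lambda>y. frechet_derivative (f \<circ> inv_into U \<phi>) (at y) w"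
  have "smooth_on (\<phi> ` N) ?d"
    using assms smooth_fun_iff by (intro smooth_on_frechet_derivative) blast
  then have "smooth_on (\<phi> ` N) ((\<lambda>x. chart_deriv A (U, \<phi>) x w f) \<circ> inv_into U \<phi>)"
    by (rule smooth_on_cong[OF open_image[OF assms(2,3)], THEN iffD1, rotated])
       (use assms in \<open>auto simp: chart_deriv_apply smooth_nearI[OF atlas assms(1,2)] subset_iff\<close>)
  then show ?thesis using smooth_fun_iff[OF assms(2,3)] by blast
qed

end

lemma compatible_chartI:
  assumes "smooth_atlas A" "smooth_atlas B" "A \<subseteq> B" "(U, \<phi>) \<in> B"
  shows "compatible_chart A U \<phi>"
  using assms smooth_atlas_insert by unfold_locales auto

text \<open>The chain rule: the coordinate expressions of a derivation in two charts are related by the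
  differential of the transition map.\<close>

lemma chart_deriv_change:
  assumes A: "smooth_atlas A" and B: "smooth_atlas B" "A \<subseteq> B"
    and c: "(U, \<phi>) \<in> B" "(V, \<psi>) \<in> B" and x: "x \<in> U" "x \<in> V"
  shows "chart_deriv A (V, \<psi>) x w =
    chart_deriv A (U, \<phi>) x (frechet_derivative (\<phi> \<circ> inv_into V \<psi>) (at (\<psi> x)) w)"
proof
  fix f
  interpret U: compatible_chart A U \<phi> using compatible_chartI[OF A B c(1)] .
  interpret V: compatible_chart A V \<psi> using compatible_chartI[OF A B c(2)] .
  show "chart_deriv A (V, \<psi>) x w f =
    chart_deriv A (U, \<phi>) x (frechet_derivative (\<phi> \<circ> inv_into V \<psi>) (at (\<psi> x)) w) f"
  proof (cases "smooth_near A x f")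
    case True
    have o: "open (\<psi> ` (V \<inter> U))"
      by (intro V.open_image) (auto intro: U.open_domain V.open_domain)
    have "(\<phi> \<circ> inv_into V \<psi>) differentiable (at (\<psi> x))"
      using smooth_atlas_transition[OF B(1) c(2,1)] x by (intro smooth_on_differentiable) auto
    moreover have "(f \<circ> inv_into U \<phi>) differentiable (at ((\<phi> \<circ> inv_into V \<psi>) (\<psi> x)))"
      using U.smooth_near_differentiable[OF True x(1)] x by simp
    ultimately have "frechet_derivative ((f \<circ> inv_into U \<phi>) \<circ> (\<phi> \<circ> inv_into V \<psi>)) (at (\<psi> x)) =
        frechet_derivative (f \<circ> inv_into U \<phi>) (at (\<phi> x)) \<circ>
        frechet_derivative (\<phi> \<circ> inv_into V \<psi>) (at (\<psi> x))"
      using x by (subst frechet_derivative_compose) auto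
    moreover have "frechet_derivative (f \<circ> inv_into V \<psi>) (at (\<psi> x)) =
        frechet_derivative ((f \<circ> inv_into U \<phi>) \<circ> (\<phi> \<circ> inv_into V \<psi>)) (at (\<psi> x))"
      by (rule frechet_derivative_transform_within_open[OF V.smooth_near_differentiable[OF True x(2)] o])
         (use x in auto)
    ultimately show ?thesis
      using True by (simp add: U.chart_deriv_apply V.chart_deriv_apply)
  qed (simp add: U.chart_deriv_apply V.chart_deriv_apply)
qed

context compatible_chart
begin

lemma tangent_space_eq:
  assumes "x \<in> U"
  shows "tangent_space A x = range (chart_deriv A (U, \<phi>) x)"
proof (intro set_eqI iffI)
  fix v assume "v \<in> tangent_space A x"
  then obtain V \<psi> w where "v = chart_deriv A (V, \<psi>) x w" "(V, \<psi>) \<in> A" "x \<in> V"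
    by (auto simp: tangent_space_def)
  then show "v \<in> range (chart_deriv A (U, \<phi>) x)"
    using chart_deriv_change[OF atlas compatible, of U \<phi> V \<psi> x w] assms by auto
next
  fix v assume "v \<in> range (chart_deriv A (U, \<phi>) x)"
  then obtain w where w: "v = chart_deriv A (U, \<phi>) x w" by auto
  obtain V \<psi> where V: "(V, \<psi>) \<in> A" "x \<in> V" by (rule smooth_atlas_cover[OF atlas])
  then show "v \<in> tangent_space A x"
    using chart_deriv_change[OF atlas compatible, of V \<psi> U \<phi> x w] assms w
    by (auto simp: tangent_space_def)
qed

lemma chart_deriv_in_tangent_space: "x \<in> U \<Longrightarrow> chart_deriv A (U, \<phi>) x w \<in> tangent_space A x"
  by (simp add: tangent_space_eq)

lemma subspace_tangent_space_aux: "x \<in> U \<Longrightarrow> subspace (tangent_space A x)"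
  using linear_subspace_image[OF linear_chart_deriv subspace_UNIV] by (simp add: tangent_space_eq)

text \<open>The coordinate functions of a chart recover the components of a tangent vector.\<close>

lemma tangent_expansion:
  assumes "x \<in> U" "v \<in> tangent_space A x"
  shows "v = chart_deriv A (U, \<phi>) x (\<Sum>b\<in>Basis. v (\<lambda>y. \<phi> y \<bullet> b) *\<^sub>R b)"
proof -
  obtain w where w: "v = chart_deriv A (U, \<phi>) x w"
    using assms tangent_space_eq by auto
  have "(\<Sum>b\<in>Basis. v (\<lambda>y. \<phi> y \<bullet> b) *\<^sub>R b) = (\<Sum>b\<in>Basis. (w \<bullet> b) *\<^sub>R b)"
    by (simp add: w chart_deriv_coordinate[OF assms(1)])
  then show ?thesis using w euclidean_representation[of w] by metis
qed

lemma coordinate_field: "vector_field A U (\<lambda>x. chart_deriv A (U, \<phi>) x w)"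
  unfolding vector_field_def
  by (auto simp: chart_deriv_in_tangent_space intro: smooth_fun_chart_deriv)

end

lemma compatible_chart_at:
  assumes "smooth_atlas A"
  obtains U \<phi> where "compatible_chart A U \<phi>" "x \<in> U"
proof -
  obtain U \<phi> where "(U, \<phi>) \<in> A" "x \<in> U" by (rule smooth_atlas_cover[OF assms])
  then show ?thesis using compatible_chartI[OF assms assms order_refl] that by blast
qed

context
  fixes A :: "('a::{t2_space, second_countable_topology}, 'e::euclidean_space) chart set"
  assumes A: "smooth_atlas A"
begin

lemma subspace_tangent_space: "subspace (tangent_space A x)"
  by (rule compatible_chart_at[OF A, of x]) (rule compatible_chart.subspace_tangent_space_aux)

text \<open>Tangent vectors are derivations on germs.\<close>

lemma tangent_cong:
  assumes "v \<in> tangent_space A x" "open S" "x \<in> S" "\<And>y. y \<in> S \<Longrightarrow> f y = h y"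
  shows "v f = v h"
proof -
  obtain U \<phi> where U: "compatible_chart A U \<phi>" "x \<in> U" by (rule compatible_chart_at[OF A])
  interpret compatible_chart A U \<phi> by fact
  obtain w where w: "v = chart_deriv A (U, \<phi>) x w"
    using assms tangent_space_eq[OF U(2)] by auto
  have sn: "smooth_near A x f \<longleftrightarrow> smooth_near A x h"
    by (rule smooth_near_cong[OF A assms(2-4)])
  have "frechet_derivative (f \<circ> inv_into U \<phi>) (at (\<phi> x)) = frechet_derivative (h \<circ> inv_into U \<phi>) (at (\<phi> x))"
    if "smooth_near A x f"
    by (rule frechet_derivative_transform_within_open[OF smooth_near_differentiable[OF that U(2)]
        open_image[of "S \<inter> U"]]) (use assms U open_domain in auto)
  with sn show ?thesis by (simp add: w chart_deriv_apply)
qed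

lemma tangent_mult:
  assumes "v \<in> tangent_space A x" "smooth_near A x f" "smooth_near A x h"
  shows "v (\<lambda>y. f y * h y) = f x * v h + v f * h x"
proof -
  obtain U \<phi> where U: "compatible_chart A U \<phi>" "x \<in> U" by (rule compatible_chart_at[OF A])
  interpret compatible_chart A U \<phi> by fact
  obtain w where w: "v = chart_deriv A (U, \<phi>) x w"
    using assms tangent_space_eq[OF U(2)] by auto
  note d = smooth_near_differentiable[OF _ U(2), unfolded frechet_derivative_works]
  from fun_cong[OF frechet_derivative_at[OF has_derivative_mult[OF d[OF assms(2)] d[OF assms(3)]], symmetric], of w]
  show ?thesis
    using smooth_near_mult[OF A assms(2,3)] assms U
    by (simp add: w chart_deriv_apply o_def)
qed

lemma tangent_add:
  assumes "v \<in> tangent_space A x" "smooth_near A x f" "smooth_near A x h"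
  shows "v (\<lambda>y. f y + h y) = v f + v h"
proof -
  obtain U \<phi> where U: "compatible_chart A U \<phi>" "x \<in> U" by (rule compatible_chart_at[OF A])
  interpret compatible_chart A U \<phi> by fact
  obtain w where w: "v = chart_deriv A (U, \<phi>) x w"
    using assms tangent_space_eq[OF U(2)] by auto
  note d = smooth_near_differentiable[OF _ U(2), unfolded frechet_derivative_works]
  from fun_cong[OF frechet_derivative_at[OF has_derivative_add[OF d[OF assms(2)] d[OF assms(3)]], symmetric], of w]
  show ?thesis
    using smooth_near_add[OF A assms(2,3)] assms U
    by (simp add: w chart_deriv_apply o_def)
qed

lemma tangent_const:
  assumes "v \<in> tangent_space A x"
  shows "v (\<lambda>y. c) = 0"
proof -
  obtain U \<phi> where U: "compatible_chart A U \<phi>" "x \<in> U" by (rule compatible_chart_at[OF A])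
  interpret compatible_chart A U \<phi> by fact
  obtain w where w: "v = chart_deriv A (U, \<phi>) x w"
    using assms tangent_space_eq[OF U(2)] by auto
  show ?thesis by (simp add: w chart_deriv_apply o_def)
qed

lemma tangent_cmult:
  assumes "v \<in> tangent_space A x" "smooth_near A x f"
  shows "v (\<lambda>y. c * f y) = c * v f"
  using tangent_mult[OF assms(1) smooth_near_const[OF A] assms(2)] tangent_const[OF assms(1)] by simp

lemma tangent_diff:
  assumes "v \<in> tangent_space A x" "smooth_near A x f" "smooth_near A x h"
  shows "v (\<lambda>y. f y - h y) = v f - v h"
  using tangent_add[OF assms(1,2) smooth_near_mult[OF A smooth_near_const[OF A, of x "-1"] assms(3)]]
    tangent_cmult[OF assms(1,3), of "-1"] by simp

section \<open>Local vector fields\<close>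

lemma vector_fieldI:
  assumes "\<And>x. x \<in> S \<Longrightarrow> X x \<in> tangent_space A x"
    and "\<And>N f. open N \<Longrightarrow> N \<subseteq> S \<Longrightarrow> smooth_fun A N f \<Longrightarrow> smooth_fun A N (\<lambda>x. X x f)"
  shows "vector_field A S X"
  using assms by (auto simp: vector_field_def)

lemma vector_fieldD:
  assumes "vector_field A S X"
  shows "x \<in> S \<Longrightarrow> X x \<in> tangent_space A x"
    and "open N \<Longrightarrow> N \<subseteq> S \<Longrightarrow> smooth_fun A N f \<Longrightarrow> smooth_fun A N (\<lambda>x. X x f)"
  using assms by (auto simp: vector_field_def)

lemma vector_field_subset: "vector_field A S X \<Longrightarrow> T \<subseteq> S \<Longrightarrow> vector_field A T X"
  by (auto simp: vector_field_def)

lemma vector_field_cong: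
  assumes "vector_field A S X" "\<And>x. x \<in> S \<Longrightarrow> X x = Y x"
  shows "vector_field A S Y"
proof (rule vector_fieldI)
  fix N f assume N: "open N" "N \<subseteq> S" "smooth_fun A N f"
  have "X x f = Y x f" if "x \<in> N" for x
    using assms(2) N(2) that by (simp only: subset_iff)
  from smooth_fun_cong_imp[OF A N(1) this vector_fieldD(2)[OF assms(1) N]]
  show "smooth_fun A N (\<lambda>x. Y x f)" .
next
  fix x assume "x \<in> S"
  with vector_fieldD(1)[OF assms(1) this] assms(2)[OF this] show "Y x \<in> tangent_space A x"
    by simp
qed

lemma vector_field_local:
  assumes "\<And>x. x \<in> S \<Longrightarrow> \<exists>T. open T \<and> x \<in> T \<and> vector_field A T X"
  shows "vector_field A S X"
proof (rule vector_fieldI)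
  fix x assume "x \<in> S"
  with assms show "X x \<in> tangent_space A x" using vector_fieldD(1) by blast
next
  fix N f assume N: "open N" "N \<subseteq> S" "smooth_fun A N f"
  show "smooth_fun A N (\<lambda>x. X x f)"
  proof (rule smooth_fun_local[OF A])
    fix x assume x: "x \<in> N"
    with N assms obtain T where T: "open T" "x \<in> T" "vector_field A T X" by blast
    have "smooth_fun A (N \<inter> T) (\<lambda>x. X x f)"
      using N T by (intro vector_fieldD(2)[OF T(3)]) (auto intro: smooth_fun_subset)
    with x N T show "\<exists>T. open T \<and> x \<in> T \<and> smooth_fun A T (\<lambda>x. X x f)"
      by (intro exI[of _ "N \<inter> T"]) auto
  qed
qed

lemma vector_field_add:
  assumes "vector_field A S X" "vector_field A S Y"
  shows "vector_field A S (X + Y)"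
proof (rule vector_fieldI)
  fix x assume "x \<in> S"
  then show "(X + Y) x \<in> tangent_space A x"
    using subspace_add[OF subspace_tangent_space] vector_fieldD(1) assms by simp
next
  fix N f assume N: "open N" "N \<subseteq> S" "smooth_fun A N f"
  then show "smooth_fun A N (\<lambda>x. (X + Y) x f)"
    using smooth_fun_add[OF A N(1)] vector_fieldD(2)[OF assms(1) N] vector_fieldD(2)[OF assms(2) N]
    by simp
qed

lemma vector_field_scale:
  assumes "vector_field A S X" "smooth_fun A S f"
  shows "vector_field A S (\<lambda>x. f x *\<^sub>R X x)"
proof (rule vector_fieldI)
  fix x assume "x \<in> S"
  then show "f x *\<^sub>R X x \<in> tangent_space A x"
    using subspace_mul[OF subspace_tangent_space] vector_fieldD(1) assms by simp
next
  fix N h assume N: "open N" "N \<subseteq> S" "smooth_fun A N h"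
  then show "smooth_fun A N (\<lambda>x. (f x *\<^sub>R X x) h)"
    using smooth_fun_mult[OF A N(1) smooth_fun_subset[OF assms(2) N(2)] vector_fieldD(2)[OF assms(1) N]]
    by (simp add: scaleR_fun_def)
qed

lemma vector_field_cscale: "vector_field A S X \<Longrightarrow> vector_field A S (\<lambda>x. c *\<^sub>R X x)"
  by (rule vector_field_scale[OF _ smooth_fun_const[OF A]])

lemma vector_field_diff:
  assumes "vector_field A S X" "vector_field A S Y"
  shows "vector_field A S (X - Y)"
  by (rule vector_field_cong[OF vector_field_add[OF assms(1) vector_field_cscale[OF assms(2), of "-1"]]])
     simp

lemma vector_field_zero: "vector_field A S (\<lambda>x. 0)"
proof (rule vector_fieldI)
  fix x show "0 \<in> tangent_space A x" by (rule subspace_0[OF subspace_tangent_space])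
next
  fix N :: "'a set" and f :: "'a \<Rightarrow> real"
  show "smooth_fun A N (\<lambda>x. 0 f)"
    using smooth_fun_const[OF A, of N 0] by (simp only: zero_fun_apply)
qed

end

section \<open>The Levi-Civita connection and its curvature on an open set\<close>

locale riemannian_on =
  fixes A :: "('a::{t2_space, second_countable_topology}, 'e::euclidean_space) chart set"
    and g :: "'a metric" and D :: "'a connection" and S :: "'a set"
  assumes atlas: "smooth_atlas A" and metric: "riemannian_metric A g"
    and lc: "levi_civita A g D" and open_S: "open S"
begin

text \<open>Fields and functions that are smooth on \<open>S\<close>; their values outside \<open>S\<close> are arbitrary.\<close>

abbreviation vf :: "'a vfield \<Rightarrow> bool" where "vf \<equiv> vector_field A S"
abbreviation sm :: "('a \<Rightarrow> real) \<Rightarrow> bool" where "sm \<equiv> smooth_fun A S"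

lemma restrict: "open T \<Longrightarrow> riemannian_on A g D T"
  using atlas metric lc by unfold_locales

lemma vf_tangent [simp]: "vf X \<Longrightarrow> x \<in> S \<Longrightarrow> X x \<in> tangent_space A x"
  by (rule vector_fieldD(1)[OF atlas])

lemma tangent_space_closed [simp]:
  "0 \<in> tangent_space A x"
  "u \<in> tangent_space A x \<Longrightarrow> v \<in> tangent_space A x \<Longrightarrow> u + v \<in> tangent_space A x"
  "u \<in> tangent_space A x \<Longrightarrow> v \<in> tangent_space A x \<Longrightarrow> u - v \<in> tangent_space A x"
  "u \<in> tangent_space A x \<Longrightarrow> c *\<^sub>R u \<in> tangent_space A x"
  using subspace_tangent_space[OF atlas, of x]
  by (blast intro: subspace_0 subspace_add subspace_diff subspace_mul)+

lemma g_linear: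
  assumes "u \<in> tangent_space A x" "v \<in> tangent_space A x" "w \<in> tangent_space A x"
  shows "g x (a *\<^sub>R u + b *\<^sub>R v) w = a * g x u w + b * g x v w"
  using metric assms unfolding riemannian_metric_def by blast

lemma g_sym:
  assumes "u \<in> tangent_space A x" "v \<in> tangent_space A x"
  shows "g x u v = g x v u"
  using metric assms unfolding riemannian_metric_def by blast

lemma g_pos:
  assumes "u \<in> tangent_space A x" "u \<noteq> 0"
  shows "g x u u > 0"
  using metric assms unfolding riemannian_metric_def by blast

lemma g_zero: "w \<in> tangent_space A x \<Longrightarrow> g x 0 w = 0" "w \<in> tangent_space A x \<Longrightarrow> g x w 0 = 0"
  using g_linear[of w x w w 0 0] g_sym[of 0 x w] by simp_all

lemma g_scale:
  assumes "u \<in> tangent_space A x" "w \<in> tangent_space A x"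
  shows "g x (c *\<^sub>R u) w = c * g x u w" "g x w (c *\<^sub>R u) = c * g x w u"
proof -
  show 1: "g x (c *\<^sub>R u) w = c * g x u w" using g_linear[OF assms(1,1,2), of c 0] by simp
  show "g x w (c *\<^sub>R u) = c * g x w u"
    using 1 g_sym[OF assms] g_sym[of "c *\<^sub>R u" x w] assms by simp
qed

lemma g_add:
  assumes "u \<in> tangent_space A x" "v \<in> tangent_space A x" "w \<in> tangent_space A x"
  shows "g x (u + v) w = g x u w + g x v w" "g x w (u + v) = g x w u + g x w v"
proof -
  show 1: "g x (u + v) w = g x u w + g x v w" using g_linear[OF assms, of 1 1] by simp
  show "g x w (u + v) = g x w u + g x w v"
    using 1 g_sym[OF assms(1,3)] g_sym[OF assms(2,3)] g_sym[of "u + v" x w] assms by simp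
qed

lemma g_diff:
  assumes "u \<in> tangent_space A x" "v \<in> tangent_space A x" "w \<in> tangent_space A x"
  shows "g x (u - v) w = g x u w - g x v w" "g x w (u - v) = g x w u - g x w v"
proof -
  show 1: "g x (u - v) w = g x u w - g x v w" using g_linear[OF assms, of 1 "-1"] by simp
  show "g x w (u - v) = g x w u - g x w v"
    using 1 g_sym[OF assms(1,3)] g_sym[OF assms(2,3)] g_sym[of "u - v" x w] assms by simp
qed

lemmas g_bilinear = g_zero g_scale g_add g_diff

lemma g_eq_0_iff: "u \<in> tangent_space A x \<Longrightarrow> g x u u = 0 \<longleftrightarrow> u = 0"
  using g_pos[of u x] g_zero[of u x] by (cases "u = 0") auto

lemma sm_g: "vf X \<Longrightarrow> vf Y \<Longrightarrow> sm (\<lambda>x. g x (X x) (Y x))"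
  using metric open_S unfolding riemannian_metric_def by blast

lemma sm_const: "sm (\<lambda>x. c)"
  by (rule smooth_fun_const[OF atlas])

lemma sm_near: "sm f \<Longrightarrow> x \<in> S \<Longrightarrow> smooth_near A x f"
  by (rule smooth_nearI[OF atlas _ open_S])

lemma sm_near_g: "vf X \<Longrightarrow> vf Y \<Longrightarrow> x \<in> S \<Longrightarrow> smooth_near A x (\<lambda>x. g x (X x) (Y x))"
  by (rule sm_near[OF sm_g])

lemma sm_deriv: "vf X \<Longrightarrow> sm f \<Longrightarrow> sm (\<lambda>x. X x f)"
  by (rule vector_fieldD(2)[OF atlas _ open_S order_refl])

lemma vf_zero: "vf (\<lambda>x. 0)" by (rule vector_field_zero[OF atlas])
lemma vf_add: "vf X \<Longrightarrow> vf Y \<Longrightarrow> vf (X + Y)" by (rule vector_field_add[OF atlas])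
lemma vf_diff: "vf X \<Longrightarrow> vf Y \<Longrightarrow> vf (X - Y)" by (rule vector_field_diff[OF atlas])
lemma vf_scale: "vf X \<Longrightarrow> sm f \<Longrightarrow> vf (\<lambda>x. f x *\<^sub>R X x)" by (rule vector_field_scale[OF atlas])
lemma vf_cscale: "vf X \<Longrightarrow> vf (\<lambda>x. c *\<^sub>R X x)" by (rule vector_field_cscale[OF atlas])

lemma connection:
  assumes "vf X" "vf Y" "vf Z" "sm f"
  shows "vf (D X Y)"
    "x \<in> S \<Longrightarrow> D (X + Y) Z x = D X Z x + D Y Z x"
    "x \<in> S \<Longrightarrow> D (\<lambda>y. f y *\<^sub>R X y) Y x = f x *\<^sub>R D X Y x"
    "x \<in> S \<Longrightarrow> D X (Y + Z) x = D X Y x + D X Z x"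
    "x \<in> S \<Longrightarrow> D X (\<lambda>y. f y *\<^sub>R Y y) x = X x f *\<^sub>R Y x + f x *\<^sub>R D X Y x"
    "x \<in> S \<Longrightarrow> X x (\<lambda>y. g y (Y y) (Z y)) = g x (D X Y x) (Z x) + g x (Y x) (D X Z x)"
    "x \<in> S \<Longrightarrow> D X Y x - D Y X x = lie_bracket A X Y x"
  using lc[unfolded levi_civita_def, rule_format, of S X Y Z f] open_S assms by blast+

lemma vf_D: "vf X \<Longrightarrow> vf Y \<Longrightarrow> vf (D X Y)"
  by (rule connection(1)[OF _ _ _ sm_const])

lemma D_add_left: "vf X \<Longrightarrow> vf Y \<Longrightarrow> vf Z \<Longrightarrow> x \<in> S \<Longrightarrow> D (X + Y) Z x = D X Z x + D Y Z x"
  by (rule connection(2)[OF _ _ _ sm_const])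

lemma D_add_right: "vf X \<Longrightarrow> vf Y \<Longrightarrow> vf Z \<Longrightarrow> x \<in> S \<Longrightarrow> D X (Y + Z) x = D X Y x + D X Z x"
  by (rule connection(4)[OF _ _ _ sm_const])

lemma D_scale_left:
  "vf X \<Longrightarrow> vf Y \<Longrightarrow> sm f \<Longrightarrow> x \<in> S \<Longrightarrow> D (\<lambda>y. f y *\<^sub>R X y) Y x = f x *\<^sub>R D X Y x"
  by (rule connection(3))

lemma D_scale_right:
  "vf X \<Longrightarrow> vf Y \<Longrightarrow> sm f \<Longrightarrow> x \<in> S \<Longrightarrow>
    D X (\<lambda>y. f y *\<^sub>R Y y) x = X x f *\<^sub>R Y x + f x *\<^sub>R D X Y x"
  by (rule connection(5))

lemma D_metric:
  "vf X \<Longrightarrow> vf Y \<Longrightarrow> vf Z \<Longrightarrow> x \<in> S \<Longrightarrow>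
    X x (\<lambda>y. g y (Y y) (Z y)) = g x (D X Y x) (Z x) + g x (Y x) (D X Z x)"
  by (rule connection(6)[OF _ _ _ sm_const])

lemma D_torsion: "vf X \<Longrightarrow> vf Y \<Longrightarrow> x \<in> S \<Longrightarrow> lie_bracket A X Y x = D X Y x - D Y X x"
  by (rule connection(7)[OF _ _ _ sm_const, symmetric])

lemma vf_bracket: "vf X \<Longrightarrow> vf Y \<Longrightarrow> vf (lie_bracket A X Y)"
  by (rule vector_field_cong[OF atlas vf_diff[OF vf_D vf_D]]) (simp_all add: D_torsion)

lemma bracket_cong:
  assumes "vf X" "vf Y" "vf X'" "vf Y'" "\<And>y. y \<in> S \<Longrightarrow> X y = X' y" "\<And>y. y \<in> S \<Longrightarrow> Y y = Y' y" "x \<in> S"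
  shows "lie_bracket A X Y x = lie_bracket A X' Y' x"
proof
  fix f
  have "X x (\<lambda>y. Y y f) = X x (\<lambda>y. Y' y f)"
    by (rule tangent_cong[OF atlas vf_tangent[OF assms(1,7)] open_S assms(7)]) (simp only: assms(6))
  moreover have "Y x (\<lambda>y. X y f) = Y x (\<lambda>y. X' y f)"
    by (rule tangent_cong[OF atlas vf_tangent[OF assms(2,7)] open_S assms(7)]) (simp only: assms(5))
  ultimately show "lie_bracket A X Y x f = lie_bracket A X' Y' x f"
    by (simp add: lie_bracket_def assms(5,6)[OF assms(7)])
qed

lemma koszul:
  assumes X: "vf X" and Y: "vf Y" and Z: "vf Z" and x: "x \<in> S"
  shows "2 * g x (D X Y x) (Z x) =
    X x (\<lambda>y. g y (Y y) (Z y)) + Y x (\<lambda>y. g y (X y) (Z y)) - Z x (\<lambda>y. g y (X y) (Y y))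
    + g x (lie_bracket A X Y x) (Z x) - g x (lie_bracket A X Z x) (Y x) - g x (lie_bracket A Y Z x) (X x)"
proof -
  note v = X Y Z vf_D[OF X Y] vf_D[OF Y X] vf_D[OF X Z] vf_D[OF Z X] vf_D[OF Y Z] vf_D[OF Z Y]
  note t = v[THEN vf_tangent[OF _ x]]
  have s: "g x (D X Y x) (Z x) = g x (Z x) (D X Y x)" "g x (D Y X x) (Z x) = g x (Z x) (D Y X x)"
    "g x (D X Z x) (Y x) = g x (Y x) (D X Z x)" "g x (D Z X x) (Y x) = g x (Y x) (D Z X x)"
    "g x (D Y Z x) (X x) = g x (X x) (D Y Z x)" "g x (D Z Y x) (X x) = g x (X x) (D Z Y x)"
    using t by (auto intro: g_sym)
  show ?thesis
    unfolding D_metric[OF X Y Z x] D_metric[OF Y X Z x] D_metric[OF Z X Y x]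
      D_torsion[OF X Y x] D_torsion[OF X Z x] D_torsion[OF Y Z x]
    using t s by (simp add: g_bilinear)
qed

text \<open>By the Koszul formula the connection only depends on the values of the fields on \<open>S\<close>.\<close>

lemma D_cong:
  assumes "vf X" "vf Y" "\<And>y. y \<in> S \<Longrightarrow> X y = X' y" "\<And>y. y \<in> S \<Longrightarrow> Y y = Y' y" and x: "x \<in> S"
  shows "D X Y x = D X' Y' x"
proof -
  have v': "vf X'" "vf Y'"
    using vector_field_cong[OF atlas assms(1,3)] vector_field_cong[OF atlas assms(2,4)] by auto
  \<comment> \<open>Testing the Koszul formula with the difference itself avoids a choice of test fields.\<close>
  let ?Z = "D X Y - D X' Y'"
  have Z: "vf ?Z" by (rule vf_diff[OF vf_D[OF assms(1,2)] vf_D[OF v']])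
  have "2 * g x (D X Y x) (?Z x) = 2 * g x (D X' Y' x) (?Z x)"
  proof -
    have "X x (\<lambda>y. g y (Y y) (?Z y)) = X x (\<lambda>y. g y (Y' y) (?Z y))"
      by (rule tangent_cong[OF atlas vf_tangent[OF assms(1) x] open_S x]) (simp only: assms(4))
    moreover have "Y x (\<lambda>y. g y (X y) (?Z y)) = Y x (\<lambda>y. g y (X' y) (?Z y))"
      by (rule tangent_cong[OF atlas vf_tangent[OF assms(2) x] open_S x]) (simp only: assms(3))
    moreover have "?Z x (\<lambda>y. g y (X y) (Y y)) = ?Z x (\<lambda>y. g y (X' y) (Y' y))"
      by (rule tangent_cong[OF atlas vf_tangent[OF Z x] open_S x]) (simp only: assms(3,4))
    moreover have "lie_bracket A X Y x = lie_bracket A X' Y' x"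
      by (rule bracket_cong[OF assms(1,2) v' assms(3,4) x])
    moreover have "lie_bracket A X ?Z x = lie_bracket A X' ?Z x"
      by (rule bracket_cong[OF assms(1) Z v'(1) Z assms(3) refl x])
    moreover have "lie_bracket A Y ?Z x = lie_bracket A Y' ?Z x"
      by (rule bracket_cong[OF assms(2) Z v'(2) Z assms(4) refl x])
    ultimately show ?thesis
      unfolding koszul[OF assms(1,2) Z x] koszul[OF v' Z x] by (simp only: assms(3,4)[OF x])
  qed
  then have "g x (?Z x) (?Z x) = 0"
    using vf_tangent[OF vf_D[OF assms(1,2)] x] vf_tangent[OF vf_D[OF v'] x] by (simp add: g_bilinear)
  then have "?Z x = 0" using g_eq_0_iff[OF vf_tangent[OF Z x]] by blast
  then show ?thesis by simp
qed

lemma D_cscale_left: "vf X \<Longrightarrow> vf Y \<Longrightarrow> x \<in> S \<Longrightarrow> D (\<lambda>y. c *\<^sub>R X y) Y x = c *\<^sub>R D X Y x"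
  by (rule D_scale_left[OF _ _ sm_const])

lemma D_cscale_right:
  assumes "vf X" "vf Y" "x \<in> S"
  shows "D X (\<lambda>y. c *\<^sub>R Y y) x = c *\<^sub>R D X Y x"
  using D_scale_right[OF assms(1,2) sm_const assms(3), of c]
    tangent_const[OF atlas vf_tangent[OF assms(1,3)], of c] by simp

lemma D_diff_left:
  assumes "vf X" "vf Y" "vf Z" "x \<in> S" shows "D (X - Y) Z x = D X Z x - D Y Z x"
proof -
  have "D (X - Y) Z x = D (X + (\<lambda>y. (-1) *\<^sub>R Y y)) Z x"
    by (rule D_cong[OF vf_diff[OF assms(1,2)] assms(3) _ refl assms(4)]) simp
  also have "\<dots> = D X Z x + (-1) *\<^sub>R D Y Z x"
    by (simp only: D_add_left[OF assms(1) vf_cscale[OF assms(2)] assms(3,4)]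
        D_cscale_left[OF assms(2,3,4)])
  finally show ?thesis by simp
qed

lemma D_diff_right:
  assumes "vf X" "vf Y" "vf Z" "x \<in> S" shows "D X (Y - Z) x = D X Y x - D X Z x"
proof -
  have "D X (Y - Z) x = D X (Y + (\<lambda>y. (-1) *\<^sub>R Z y)) x"
    by (rule D_cong[OF assms(1) vf_diff[OF assms(2,3)] refl _ assms(4)]) simp
  also have "\<dots> = D X Y x + (-1) *\<^sub>R D X Z x"
    by (simp only: D_add_right[OF assms(1,2) vf_cscale[OF assms(3)] assms(4)]
        D_cscale_right[OF assms(1,3,4)])
  finally show ?thesis by simp
qed

lemma D_zero_left: assumes "vf Y" "x \<in> S" shows "D (\<lambda>y. 0) Y x = 0"
  using D_cscale_left[OF vf_zero assms, of 0] by simp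

section \<open>Symmetries of the curvature tensor\<close>

abbreviation R4 :: "'a \<Rightarrow> 'a vfield \<Rightarrow> 'a vfield \<Rightarrow> 'a vfield \<Rightarrow> 'a vfield \<Rightarrow> real" where
  "R4 x X Y Z W \<equiv> g x (riemann_curvature A D X Y Z x) (W x)"

lemma curvature_apply:
  "riemann_curvature A D X Y Z x = D X (D Y Z) x - D Y (D X Z) x - D (lie_bracket A X Y) Z x"
  by (simp only: riemann_curvature_def minus_apply)

lemma vf_curvature: "vf X \<Longrightarrow> vf Y \<Longrightarrow> vf Z \<Longrightarrow> vf (riemann_curvature A D X Y Z)"
  unfolding riemann_curvature_def by (intro vf_diff vf_D vf_bracket)

lemma D_bracket:
  assumes "vf X" "vf Y" "vf Z" "x \<in> S"
  shows "D (lie_bracket A X Y) Z x = D (D X Y) Z x - D (D Y X) Z x"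
proof -
  have "D (lie_bracket A X Y) Z x = D (D X Y - D Y X) Z x"
    by (rule D_cong[OF vf_bracket[OF assms(1,2)] assms(3) _ refl assms(4)])
       (simp only: D_torsion[OF assms(1,2)] minus_apply)
  then show ?thesis by (simp only: D_diff_left[OF vf_D[OF assms(1,2)] vf_D[OF assms(2,1)] assms(3,4)])
qed

lemma R4_expand:
  assumes "vf X" "vf Y" "vf Z" "vf W" "x \<in> S"
  shows "R4 x X Y Z W = g x (D X (D Y Z) x) (W x) - g x (D Y (D X Z) x) (W x)
    - g x (D (D X Y) Z x) (W x) + g x (D (D Y X) Z x) (W x)"
proof -
  note t = vf_tangent[OF _ assms(5)]
  show ?thesis
    unfolding curvature_apply D_bracket[OF assms(1,2,3,5)]
    using assms by (simp add: g_bilinear t vf_D)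
qed

lemma R4_antisym_left:
  assumes "vf X" "vf Y" "vf Z" "vf W" "x \<in> S"
  shows "R4 x X Y Z W = - R4 x Y X Z W"
  using R4_expand[OF assms] R4_expand[OF assms(2,1,3,4,5)] by simp

lemma R4_add:
  assumes "vf X" "vf X'" "vf Y" "vf Z" "vf W" "x \<in> S"
  shows "R4 x (X + X') Y Z W = R4 x X Y Z W + R4 x X' Y Z W"
proof -
  note XX = vf_add[OF assms(1,2)]
  have 1: "D (X + X') (D Y Z) x = D X (D Y Z) x + D X' (D Y Z) x"
    by (rule D_add_left[OF assms(1,2) vf_D[OF assms(3,4)] assms(6)])
  have "D Y (D (X + X') Z) x = D Y (D X Z + D X' Z) x"
    by (rule D_cong[OF assms(3) vf_D[OF XX assms(4)] refl _ assms(6)])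
       (simp only: D_add_left[OF assms(1,2,4)] plus_fun_apply)
  also have "\<dots> = D Y (D X Z) x + D Y (D X' Z) x"
    by (rule D_add_right[OF assms(3) vf_D[OF assms(1,4)] vf_D[OF assms(2,4)] assms(6)])
  finally have 2: "D Y (D (X + X') Z) x = D Y (D X Z) x + D Y (D X' Z) x" .
  have "D (D (X + X') Y) Z x = D (D X Y + D X' Y) Z x"
    by (rule D_cong[OF vf_D[OF XX assms(3)] assms(4) _ refl assms(6)])
       (simp only: D_add_left[OF assms(1,2,3)] plus_fun_apply)
  also have "\<dots> = D (D X Y) Z x + D (D X' Y) Z x"
    by (rule D_add_left[OF vf_D[OF assms(1,3)] vf_D[OF assms(2,3)] assms(4,6)])
  finally have 3: "D (D (X + X') Y) Z x = D (D X Y) Z x + D (D X' Y) Z x" .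
  have "D (D Y (X + X')) Z x = D (D Y X + D Y X') Z x"
    by (rule D_cong[OF vf_D[OF assms(3) XX] assms(4) _ refl assms(6)])
       (simp only: D_add_right[OF assms(3,1,2)] plus_fun_apply)
  also have "\<dots> = D (D Y X) Z x + D (D Y X') Z x"
    by (rule D_add_left[OF vf_D[OF assms(3,1)] vf_D[OF assms(3,2)] assms(4,6)])
  finally have 4: "D (D Y (X + X')) Z x = D (D Y X) Z x + D (D Y X') Z x" .
  note t = vf_tangent[OF _ assms(6)]
  show ?thesis
    unfolding R4_expand[OF XX assms(3-6)] R4_expand[OF assms(1,3-6)] R4_expand[OF assms(2-6)] 1 2 3 4
    using assms by (simp add: g_bilinear t vf_D)
qed

lemma R4_cscale:
  assumes "vf X" "vf Y" "vf Z" "vf W" "x \<in> S"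
  shows "R4 x (\<lambda>y. c *\<^sub>R X y) Y Z W = c * R4 x X Y Z W"
proof -
  let ?X = "\<lambda>y. c *\<^sub>R X y"
  note cX = vf_cscale[OF assms(1), of c]
  have 1: "D ?X (D Y Z) x = c *\<^sub>R D X (D Y Z) x"
    by (rule D_cscale_left[OF assms(1) vf_D[OF assms(2,3)] assms(5)])
  have "D Y (D ?X Z) x = D Y (\<lambda>y. c *\<^sub>R D X Z y) x"
    by (rule D_cong[OF assms(2) vf_D[OF cX assms(3)] refl _ assms(5)])
       (rule D_cscale_left[OF assms(1,3)])
  also have "\<dots> = c *\<^sub>R D Y (D X Z) x"
    by (rule D_cscale_right[OF assms(2) vf_D[OF assms(1,3)] assms(5)])
  finally have 2: "D Y (D ?X Z) x = c *\<^sub>R D Y (D X Z) x" .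
  have "D (D ?X Y) Z x = D (\<lambda>y. c *\<^sub>R D X Y y) Z x"
    by (rule D_cong[OF vf_D[OF cX assms(2)] assms(3) _ refl assms(5)])
       (rule D_cscale_left[OF assms(1,2)])
  also have "\<dots> = c *\<^sub>R D (D X Y) Z x"
    by (rule D_cscale_left[OF vf_D[OF assms(1,2)] assms(3,5)])
  finally have 3: "D (D ?X Y) Z x = c *\<^sub>R D (D X Y) Z x" .
  have "D (D Y ?X) Z x = D (\<lambda>y. c *\<^sub>R D Y X y) Z x"
    by (rule D_cong[OF vf_D[OF assms(2) cX] assms(3) _ refl assms(5)])
       (rule D_cscale_right[OF assms(2,1)])
  also have "\<dots> = c *\<^sub>R D (D Y X) Z x"
    by (rule D_cscale_left[OF vf_D[OF assms(2,1)] assms(3,5)])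
  finally have 4: "D (D Y ?X) Z x = c *\<^sub>R D (D Y X) Z x" .
  note t = vf_tangent[OF _ assms(5)]
  show ?thesis
    unfolding R4_expand[OF cX assms(2-5)] R4_expand[OF assms] 1 2 3 4
    using assms by (simp add: g_bilinear t vf_D algebra_simps)
qed

text \<open>Second derivatives of the function \<open>g(Z,W)\<close> commute up to the bracket; on the other hand they are
  expanded by metric compatibility, and the mixed terms cancel.\<close>

lemma R4_antisym_right:
  assumes X: "vf X" and Y: "vf Y" and Z: "vf Z" and W: "vf W" and x: "x \<in> S"
  shows "R4 x X Y Z W = - R4 x X Y W Z"
proof -
  note t = vf_tangent[OF _ x]
  let ?f = "\<lambda>y. g y (Z y) (W y)"
  have second: "X x (\<lambda>y. Y y ?f) = g x (D X (D Y Z) x) (W x) + g x (D Y Z x) (D X W x)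
      + g x (D X Z x) (D Y W x) + g x (Z x) (D X (D Y W) x)" if X: "vf X" and Y: "vf Y" for X Y
  proof -
    have "X x (\<lambda>y. Y y ?f) = X x (\<lambda>y. g y (D Y Z y) (W y) + g y (Z y) (D Y W y))"
      by (rule tangent_cong[OF atlas t[OF X] open_S x]) (rule D_metric[OF Y Z W])
    also have "\<dots> = X x (\<lambda>y. g y (D Y Z y) (W y)) + X x (\<lambda>y. g y (Z y) (D Y W y))"
      by (rule tangent_add[OF atlas t[OF X] sm_near_g[OF vf_D[OF Y Z] W x] sm_near_g[OF Z vf_D[OF Y W] x]])
    finally show ?thesis
      using D_metric[OF X vf_D[OF Y Z] W x] D_metric[OF X Z vf_D[OF Y W] x] by simp
  qed
  have "lie_bracket A X Y x ?f = X x (\<lambda>y. Y y ?f) - Y x (\<lambda>y. X y ?f)"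
    using sm_near_g[OF Z W x] by (simp add: lie_bracket_def)
  then have "g x (D (lie_bracket A X Y) Z x) (W x) + g x (Z x) (D (lie_bracket A X Y) W x) =
      g x (D X (D Y Z) x) (W x) + g x (Z x) (D X (D Y W) x)
      - g x (D Y (D X Z) x) (W x) - g x (Z x) (D Y (D X W) x)"
    using D_metric[OF vf_bracket[OF X Y] Z W x] second[OF X Y] second[OF Y X]
    by simp
  then have "g x (riemann_curvature A D X Y Z x) (W x) + g x (Z x) (riemann_curvature A D X Y W x) = 0"
    unfolding curvature_apply using X Y Z W by (simp add: g_bilinear t vf_D vf_bracket)
  then show ?thesis
    using g_sym[OF t[OF Z] t[OF vf_curvature[OF X Y W]]] by simp
qed

lemma jacobi:
  assumes X: "vf X" and Y: "vf Y" and Z: "vf Z" and x: "x \<in> S"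
  shows "lie_bracket A X (lie_bracket A Y Z) x + lie_bracket A Y (lie_bracket A Z X) x
    + lie_bracket A Z (lie_bracket A X Y) x = 0"
proof
  fix f
  show "(lie_bracket A X (lie_bracket A Y Z) x + lie_bracket A Y (lie_bracket A Z X) x
    + lie_bracket A Z (lie_bracket A X Y) x) f = 0 f"
  proof (cases "smooth_near A x f")
    case True
    then obtain T where T: "open T" "x \<in> T" "smooth_fun A T f" unfolding smooth_near_def by blast
    let ?N = "S \<inter> T"
    have N: "open ?N" "x \<in> ?N" "smooth_fun A ?N f" "?N \<subseteq> S"
      using T open_S x smooth_fun_subset[OF T(3), of ?N] by auto
    have d1: "smooth_fun A ?N (\<lambda>y. X y f)" if "vf X" for X
      by (rule vector_fieldD(2)[OF atlas that N(1,4,3)])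
    have d2: "smooth_near A x (\<lambda>y. X y (\<lambda>z. Y z f))" if "vf X" "vf Y" for X Y
      by (rule smooth_nearI[OF atlas vector_fieldD(2)[OF atlas that(1) N(1,4) d1[OF that(2)]] N(1,2)])
    have b: "lie_bracket A X (lie_bracket A Y Z) x f =
        X x (\<lambda>y. Y y (\<lambda>z. Z z f)) - X x (\<lambda>y. Z y (\<lambda>z. Y z f))
        - (Y x (\<lambda>y. Z y (\<lambda>z. X z f)) - Z x (\<lambda>y. Y y (\<lambda>z. X z f)))"
      if X: "vf X" and Y: "vf Y" and Z: "vf Z" for X Y Z
    proof -
      have "X x (\<lambda>y. lie_bracket A Y Z y f) = X x (\<lambda>y. Y y (\<lambda>z. Z z f) - Z y (\<lambda>z. Y z f))"
        by (rule tangent_cong[OF atlas vf_tangent[OF X x] N(1,2)])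
           (simp add: lie_bracket_def smooth_nearI[OF atlas N(3,1)])
      also have "\<dots> = X x (\<lambda>y. Y y (\<lambda>z. Z z f)) - X x (\<lambda>y. Z y (\<lambda>z. Y z f))"
        by (rule tangent_diff[OF atlas vf_tangent[OF X x] d2[OF Y Z] d2[OF Z Y]])
      finally show ?thesis
        using True smooth_nearI[OF atlas d1[OF X] N(1,2)] by (simp add: lie_bracket_def)
    qed
    show ?thesis
      using b[OF X Y Z] b[OF Y Z X] b[OF Z X Y] by simp
  qed (simp add: lie_bracket_def)
qed

text \<open>Vanishing torsion turns the cyclic sum of the curvature into the cyclic sum of the Jacobi identity.\<close>

lemma bianchi:
  assumes X: "vf X" and Y: "vf Y" and Z: "vf Z" and W: "vf W" and x: "x \<in> S"
  shows "R4 x X Y Z W + R4 x Y Z X W + R4 x Z X Y W = 0"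
proof -
  note t = vf_tangent[OF _ x]
  have b: "lie_bracket A X (lie_bracket A Y Z) x =
      D X (D Y Z) x - D X (D Z Y) x - D (lie_bracket A Y Z) X x"
    if X: "vf X" and Y: "vf Y" and Z: "vf Z" for X Y Z
  proof -
    have "D X (lie_bracket A Y Z) x = D X (D Y Z - D Z Y) x"
      by (rule D_cong[OF X vf_bracket[OF Y Z] refl _ x]) (simp only: D_torsion[OF Y Z] minus_apply)
    also have "\<dots> = D X (D Y Z) x - D X (D Z Y) x"
      by (rule D_diff_right[OF X vf_D[OF Y Z] vf_D[OF Z Y] x])
    finally show ?thesis by (simp only: D_torsion[OF X vf_bracket[OF Y Z] x])
  qed
  have "riemann_curvature A D X Y Z x + riemann_curvature A D Y Z X x + riemann_curvature A D Z X Y x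
    = lie_bracket A X (lie_bracket A Y Z) x + lie_bracket A Y (lie_bracket A Z X) x
      + lie_bracket A Z (lie_bracket A X Y) x"
    unfolding b[OF X Y Z] b[OF Y Z X] b[OF Z X Y] curvature_apply by (simp only: algebra_simps)
  then have 0: "riemann_curvature A D X Y Z x + riemann_curvature A D Y Z X x
      + riemann_curvature A D Z X Y x = 0"
    by (simp only: jacobi[OF X Y Z x])
  have c: "riemann_curvature A D X Y Z x \<in> tangent_space A x"
    "riemann_curvature A D Y Z X x \<in> tangent_space A x" "riemann_curvature A D Z X Y x \<in> tangent_space A x"
    using vf_curvature X Y Z t by auto
  have "g x (riemann_curvature A D X Y Z x + riemann_curvature A D Y Z X x
      + riemann_curvature A D Z X Y x) (W x) = 0"
    unfolding 0 by (rule g_zero(1)[OF t[OF W]])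
  then show ?thesis
    using c t[OF W] by (simp only: g_add(1) tangent_space_closed(2))
qed

text \<open>The octahedron argument: the sum of four Bianchi identities, with signs from the two
  antisymmetries.\<close>

lemma R4_pair_sym:
  assumes X: "vf X" and Y: "vf Y" and Z: "vf Z" and W: "vf W" and x: "x \<in> S"
  shows "R4 x X Y Z W = R4 x Z W X Y"
proof -
  note l = R4_antisym_left[OF _ _ _ _ x] and r = R4_antisym_right[OF _ _ _ _ x] and b = bianchi[OF _ _ _ _ x]
  show ?thesis
    using b[OF X Y Z W] b[OF Y Z W X] b[OF Z W X Y] b[OF W X Y Z]
      l[OF X Y Z W] l[OF Y Z X W] l[OF Z X Y W] l[OF Z W X Y] l[OF W X Z Y] l[OF Y W Z X] l[OF W Y X Z]
      r[OF X Y Z W] r[OF Y Z X W] r[OF Z X Y W] r[OF Z W X Y] r[OF W X Z Y] r[OF Z W Y X]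
      r[OF W X Y Z] r[OF Y W Z X] r[OF Y Z W X] r[OF X Y W Z] r[OF W Y X Z] r[OF X Z W Y]
      l[OF X Z W Y] l[OF X Z Y W] r[OF X Z Y W]
    by linarith
qed

section \<open>Tensoriality of the connection in the direction of differentiation\<close>

text \<open>The components of \<open>X - X'\<close> in a chart around \<open>x\<close> vanish at \<open>x\<close>, and they are the coefficients
  that express its derivative of \<open>Y\<close> by the derivatives along coordinate fields.\<close>

lemma D_tensorial:
  assumes X: "vf X" and X': "vf X'" and Y: "vf Y" and x: "x \<in> S" and eq: "X x = X' x"
  shows "D X Y x = D X' Y x"
proof -
  obtain U \<phi> where U: "compatible_chart A U \<phi>" "x \<in> U" by (rule compatible_chart_at[OF atlas])
  interpret U: compatible_chart A U \<phi> by fact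
  let ?T = "S \<inter> U"
  interpret T: riemannian_on A g D ?T
    by (rule restrict[OF open_Int[OF open_S U.open_domain]])
  let ?Z = "X - X'"
  define E where "E b = (\<lambda>y. chart_deriv A (U, \<phi>) y b)" for b
  define f where "f b = (\<lambda>y. ?Z y (\<lambda>z. \<phi> z \<bullet> b))" for b
  have xT: "x \<in> ?T" using x U by simp
  have Z: "vf ?Z" by (rule vf_diff[OF X X'])
  have TZ: "T.vf ?Z" and TY: "T.vf Y"
    using vector_field_subset[OF atlas] Z Y by auto
  have E: "T.vf (E b)" for b
    unfolding E_def by (rule vector_field_subset[OF atlas U.coordinate_field]) simp
  have f: "T.sm (f b)" for b
    unfolding f_def by (rule T.sm_deriv[OF TZ smooth_fun_subset[OF U.smooth_coordinate]]) simp
  have sum: "T.vf (\<lambda>y. \<Sum>b\<in>I. f b y *\<^sub>R E b y) \<and>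
      D (\<lambda>y. \<Sum>b\<in>I. f b y *\<^sub>R E b y) Y x = (\<Sum>b\<in>I. f b x *\<^sub>R D (E b) Y x)"
    if "finite I" for I
    using that
  proof (induction I rule: finite_induct)
    case empty
    then show ?case by (simp only: sum.empty T.vf_zero T.D_zero_left[OF TY xT] simp_thms)
  next
    case (insert i I)
    let ?F = "\<lambda>y. f i y *\<^sub>R E i y" and ?G = "\<lambda>y. \<Sum>b\<in>I. f b y *\<^sub>R E b y"
    have F: "T.vf ?F" by (rule T.vf_scale[OF E f])
    have G: "T.vf ?G" using insert.IH by simp
    have eq: "(\<Sum>b\<in>insert i I. f b y *\<^sub>R E b y) = (?F + ?G) y" for y
      by (subst plus_fun_apply, rule sum.insert[OF insert(1,2)])
    have v: "T.vf (\<lambda>y. \<Sum>b\<in>insert i I. f b y *\<^sub>R E b y)"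
      by (rule vector_field_cong[OF atlas T.vf_add[OF F G]]) (rule eq[symmetric])
    have "D (\<lambda>y. \<Sum>b\<in>insert i I. f b y *\<^sub>R E b y) Y x = D (?F + ?G) Y x"
      by (rule T.D_cong[OF v TY eq refl xT])
    also have "\<dots> = D ?F Y x + D ?G Y x" by (rule T.D_add_left[OF F G TY xT])
    also have "D ?F Y x = f i x *\<^sub>R D (E i) Y x" by (rule T.D_scale_left[OF E TY f xT])
    finally have "D (\<lambda>y. \<Sum>b\<in>insert i I. f b y *\<^sub>R E b y) Y x =
        (\<Sum>b\<in>insert i I. f b x *\<^sub>R D (E b) Y x)"
      by (simp only: insert.IH[THEN conjunct2] sum.insert[OF insert(1,2)])
    with v show ?case by blast
  qed
  have exp: "?Z y = (\<Sum>b\<in>Basis. f b y *\<^sub>R E b y)" if y: "y \<in> ?T" for y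
  proof -
    interpret l: linear "chart_deriv A (U, \<phi>) y" by (rule U.linear_chart_deriv) (use y in simp)
    have "?Z y = chart_deriv A (U, \<phi>) y (\<Sum>b\<in>Basis. f b y *\<^sub>R b)"
      unfolding f_def using y by (intro U.tangent_expansion T.vf_tangent[OF TZ y]) simp
    then show ?thesis by (simp only: l.sum l.scale E_def)
  qed
  have f0: "f b x = 0" for b
    by (simp add: f_def eq)
  have "D ?Z Y x = D (\<lambda>y. \<Sum>b\<in>Basis. f b y *\<^sub>R E b y) Y x"
    by (rule T.D_cong[OF TZ TY exp refl xT])
  also have "\<dots> = 0"
    using sum[OF finite_Basis] by (simp only: f0 scaleR_zero_left sum.neutral_const)
  finally show ?thesis by (simp only: D_diff_left[OF X X' Y x] right_minus_eq)
qed

section \<open>Constant curvature\<close>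

text \<open>The equality case of the Cauchy-Schwarz inequality. It shows that the denominator of the sectional
  curvature of independent vectors is not \<open>0\<close>.\<close>

lemma gram_eq_0D:
  assumes u: "u \<in> tangent_space A x" and v: "v \<in> tangent_space A x" and "v \<noteq> 0"
    and gram: "g x u u * g x v v - (g x u v)\<^sup>2 = 0"
  shows "u = (g x u v / g x v v) *\<^sub>R v"
proof -
  have vv: "g x v v > 0" by (rule g_pos[OF v \<open>v \<noteq> 0\<close>])
  let ?k = "g x u v / g x v v" let ?w = "u - ?k *\<^sub>R v"
  have "g x ?w ?w = g x u u - 2 * ?k * g x u v + ?k * ?k * g x v v"
    using u v g_sym[OF u v] by (simp add: g_bilinear algebra_simps)
  also have "\<dots> = (g x u u * g x v v - (g x u v)\<^sup>2) / g x v v"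
    using vv by (simp add: field_simps power2_eq_square)
  finally have "?w = 0" using g_eq_0_iff[of ?w x] u v gram by simp
  then show ?thesis by simp
qed

text \<open>By the symmetries the form depends on \<open>X\<close> only through its value at \<open>x\<close>: the first slot can be moved
  to the last one, which is occupied by a value under the metric.\<close>

lemma R4_vanish:
  assumes "vf X" "vf Y" "vf Z" "vf W" "x \<in> S" and "X x = 0"
  shows "R4 x X Y Z W = 0"
proof -
  have "R4 x X Y Z W = - R4 x Z W Y X"
    using R4_pair_sym[OF assms(1-5)] R4_antisym_right[OF assms(3,4,1,2,5)] by simp
  then show ?thesis
    using g_zero(2)[OF vf_tangent[OF vf_curvature[OF assms(3,4,2)] assms(5)]] assms(6) by simp
qed

text \<open>The sectional curvature is only prescribed where \<open>X\<close> and \<open>Y\<close> are independent. At other points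
  both sides vanish, the left one because the curvature form is tensorial.\<close>

lemma constant_curvature_diagonal:
  assumes c: "\<And>X Y. vf X \<Longrightarrow> vf Y \<Longrightarrow> X x \<noteq> Y x \<Longrightarrow> independent {X x, Y x} \<Longrightarrow>
      sectional_curvature A g D X Y x = c"
    and X: "vf X" and Y: "vf Y" and x: "x \<in> S"
  shows "R4 x X Y Y X = c * (g x (X x) (X x) * g x (Y x) (Y x) - (g x (X x) (Y x))\<^sup>2)"
proof -
  note t = vf_tangent[OF X x] vf_tangent[OF Y x]
  consider (zero) "Y x = 0" | (dep) a where "Y x \<noteq> 0" "X x = a *\<^sub>R Y x"
    | (ind) "Y x \<noteq> 0" "X x \<notin> span {Y x}"
    by (auto simp: span_singleton)
  then show ?thesis
  proof cases
    case zero
    have "R4 x X Y Y X = R4 x Y X X Y"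
      by (rule R4_pair_sym[OF X Y Y X x])
    then show ?thesis using R4_vanish[OF Y X X Y x zero] zero t by (simp add: g_bilinear)
  next
    case dep
    let ?Y = "\<lambda>y. (-a) *\<^sub>R Y y"
    note cY = vf_cscale[OF Y, of "-a"]
    have "R4 x (X + ?Y) Y Y X = 0"
      by (rule R4_vanish[OF vf_add[OF X cY] Y Y X x]) (simp add: dep)
    moreover have "R4 x Y Y Y X = 0"
      using R4_antisym_left[OF Y Y Y X x] by simp
    ultimately have "R4 x X Y Y X = 0"
      using R4_add[OF X cY Y Y X x] R4_cscale[OF Y Y Y X x, of "-a"] by simp
    then show ?thesis using t dep by (simp add: g_bilinear power2_eq_square)
  next
    case ind
    have "X x \<noteq> Y x" using ind(2) span_base[of "Y x" "{Y x}"] by auto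
    moreover have "independent {X x, Y x}"
      using ind by (simp add: independent_insert)
    ultimately have "sectional_curvature A g D X Y x = c" by (rule c[OF X Y])
    moreover have "g x (X x) (X x) * g x (Y x) (Y x) - (g x (X x) (Y x))\<^sup>2 \<noteq> 0"
      using gram_eq_0D[OF t ind(1)] ind(2) by (auto simp: span_singleton)
    ultimately show ?thesis
      unfolding sectional_curvature_def by (simp add: field_simps)
  qed
qed

end

text \<open>Polarisation: a quadrilinear form with the symmetries of a curvature tensor is determined by
  its values on the quadruples \<open>(X, Y, Y, X)\<close>. The vanishing of these values makes the form
  alternating in all four arguments, and then the Bianchi identity says that three times it is \<open>0\<close>.\<close>

lemma curvature_form_eq_0:
  fixes Q :: "'v::plus \<Rightarrow> 'v \<Rightarrow> 'v \<Rightarrow> 'v \<Rightarrow> real"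
  assumes closed: "\<And>X Y. P X \<Longrightarrow> P Y \<Longrightarrow> P (X + Y)"
    and add: "\<And>X X' Y Z W. P X \<Longrightarrow> P X' \<Longrightarrow> P Y \<Longrightarrow> P Z \<Longrightarrow> P W \<Longrightarrow> Q (X + X') Y Z W = Q X Y Z W + Q X' Y Z W"
    and left: "\<And>X Y Z W. P X \<Longrightarrow> P Y \<Longrightarrow> P Z \<Longrightarrow> P W \<Longrightarrow> Q X Y Z W = - Q Y X Z W"
    and right: "\<And>X Y Z W. P X \<Longrightarrow> P Y \<Longrightarrow> P Z \<Longrightarrow> P W \<Longrightarrow> Q X Y Z W = - Q X Y W Z"
    and pair: "\<And>X Y Z W. P X \<Longrightarrow> P Y \<Longrightarrow> P Z \<Longrightarrow> P W \<Longrightarrow> Q X Y Z W = Q Z W X Y"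
    and cyclic: "\<And>X Y Z W. P X \<Longrightarrow> P Y \<Longrightarrow> P Z \<Longrightarrow> P W \<Longrightarrow> Q X Y Z W + Q Y Z X W + Q Z X Y W = 0"
    and diagonal: "\<And>X Y. P X \<Longrightarrow> P Y \<Longrightarrow> Q X Y Y X = 0"
    and X: "P X" and Y: "P Y" and Z: "P Z" and W: "P W"
  shows "Q X Y Z W = 0"
proof -
  have d: "Q X Y Z X = 0" if X: "P X" and Y: "P Y" and Z: "P Z" for X Y Z
  proof -
    note YZ = closed[OF Y Z]
    have "Q X (Y + Z) (Y + Z) X = Q X Y Y X + Q X Y Z X + Q X Z Y X + Q X Z Z X"
      using left[OF X YZ YZ X] add[OF Y Z X YZ X] pair[OF Y X YZ X] pair[OF Z X YZ X]
        add[OF Y Z X Y X] add[OF Y Z X Z X] pair[OF Y X Y X] pair[OF Z X Y X] pair[OF Y X Z X] pair[OF Z X Z X]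
        left[OF Y X Y X] left[OF Z X Y X] left[OF Y X Z X] left[OF Z X Z X]
      by linarith
    then show ?thesis
      using diagonal[OF X YZ] diagonal[OF X Y] diagonal[OF X Z] pair[OF X Z Y X] left[OF X Y Z X]
        right[OF Y X X Z] right[OF X Y X Z] left[OF X Y X Z] right[OF Y X Z X] left[OF Y X X Z]
      by linarith
  qed
  have swap: "Q X Y Z W = - Q W Y Z X" if X: "P X" and Y: "P Y" and Z: "P Z" and W: "P W" for X Y Z W
  proof -
    note XW = closed[OF X W]
    have "Q (X + W) Y Z (X + W) = Q X Y Z X + Q X Y Z W + Q W Y Z X + Q W Y Z W"
      using add[OF X W Y Z XW] pair[OF X Y Z XW] pair[OF W Y Z XW]
        left[OF Z XW X Y] left[OF Z XW W Y] add[OF X W Z X Y] add[OF X W Z W Y]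
        left[OF X Z X Y] left[OF W Z X Y] left[OF X Z W Y] left[OF W Z W Y]
        pair[OF X Y Z X] pair[OF X Y Z W] pair[OF W Y Z X] pair[OF W Y Z W]
      by linarith
    then show ?thesis using d[OF XW Y Z] d[OF X Y Z] d[OF W Y Z] by linarith
  qed
  have "Q Y Z X W = Q X Y Z W"
    using left[OF Y Z X W] swap[OF Z Y X W] right[OF W Y X Z] swap[OF W Y Z X] by simp
  moreover have "Q Z X Y W = Q X Y Z W"
    using swap[OF Z X Y W] right[OF W X Y Z] swap[OF W X Z Y] left[OF Y X Z W] by simp
  ultimately show ?thesis using cyclic[OF X Y Z W] by simp
qed

context riemannian_on
begin

lemma constant_curvature_R4:
  assumes "constant_curvature A g D"
  obtains c where "\<And>X Y Z W x. vf X \<Longrightarrow> vf Y \<Longrightarrow> vf Z \<Longrightarrow> vf W \<Longrightarrow> x \<in> S \<Longrightarrow>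
    R4 x X Y Z W = c * (g x (Y x) (Z x) * g x (X x) (W x) - g x (X x) (Z x) * g x (Y x) (W x))"
proof -
  obtain c where C: "\<forall>S X Y. open S \<and> vector_field A S X \<and> vector_field A S Y \<longrightarrow>
      (\<forall>x\<in>S. X x \<noteq> Y x \<and> independent {X x, Y x} \<longrightarrow> sectional_curvature A g D X Y x = c)"
    using assms unfolding constant_curvature_def by (elim exE)
  have c: "sectional_curvature A g D X Y x = c"
    if "vf X" "vf Y" "x \<in> S" "X x \<noteq> Y x" "independent {X x, Y x}" for X Y x
    by (rule C[THEN spec[of _ S], THEN spec[of _ X], THEN spec[of _ Y], THEN mp, THEN bspec, THEN mp])
       (intro conjI open_S that)+
  have "R4 x X Y Z W - c * (g x (Y x) (Z x) * g x (X x) (W x) - g x (X x) (Z x) * g x (Y x) (W x)) = 0"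
    if v: "vf X" "vf Y" "vf Z" "vf W" and x: "x \<in> S" for X Y Z W x
  proof (rule curvature_form_eq_0[of vf
        "\<lambda>X Y Z W. R4 x X Y Z W - c * (g x (Y x) (Z x) * g x (X x) (W x) - g x (X x) (Z x) * g x (Y x) (W x))",
        OF _ _ _ _ _ _ _ v])
    note t = vf_tangent[OF _ x]
    fix X X' Y Z W assume v: "vf X" "vf X'" "vf Y" "vf Z" "vf W"
    have e: "g x ((X + X') x) (W x) = g x (X x) (W x) + g x (X' x) (W x)"
      "g x ((X + X') x) (Z x) = g x (X x) (Z x) + g x (X' x) (Z x)"
      using v by (simp_all add: plus_fun_apply[of X X'] g_add t)
    show "R4 x (X + X') Y Z W - c * (g x (Y x) (Z x) * g x ((X + X') x) (W x) - g x ((X + X') x) (Z x) * g x (Y x) (W x))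
      = R4 x X Y Z W - c * (g x (Y x) (Z x) * g x (X x) (W x) - g x (X x) (Z x) * g x (Y x) (W x))
      + (R4 x X' Y Z W - c * (g x (Y x) (Z x) * g x (X' x) (W x) - g x (X' x) (Z x) * g x (Y x) (W x)))"
      unfolding R4_add[OF v x] e by (simp add: algebra_simps)
  next
    note t = vf_tangent[OF _ x]
    fix X Y Z W assume v: "vf X" "vf Y" "vf Z" "vf W"
    note s = g_sym[OF t[OF v(1)] t[OF v(3)]] g_sym[OF t[OF v(1)] t[OF v(4)]]
      g_sym[OF t[OF v(2)] t[OF v(3)]] g_sym[OF t[OF v(2)] t[OF v(4)]]
      g_sym[OF t[OF v(1)] t[OF v(2)]] g_sym[OF t[OF v(3)] t[OF v(4)]]
    show "R4 x X Y Z W - c * (g x (Y x) (Z x) * g x (X x) (W x) - g x (X x) (Z x) * g x (Y x) (W x))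
      = - (R4 x Y X Z W - c * (g x (X x) (Z x) * g x (Y x) (W x) - g x (Y x) (Z x) * g x (X x) (W x)))"
      using R4_antisym_left[OF v x] by (simp add: algebra_simps)
    show "R4 x X Y Z W - c * (g x (Y x) (Z x) * g x (X x) (W x) - g x (X x) (Z x) * g x (Y x) (W x))
      = - (R4 x X Y W Z - c * (g x (Y x) (W x) * g x (X x) (Z x) - g x (X x) (W x) * g x (Y x) (Z x)))"
      using R4_antisym_right[OF v x] by (simp add: algebra_simps)
    show "R4 x X Y Z W - c * (g x (Y x) (Z x) * g x (X x) (W x) - g x (X x) (Z x) * g x (Y x) (W x))
      = R4 x Z W X Y - c * (g x (W x) (X x) * g x (Z x) (Y x) - g x (Z x) (X x) * g x (W x) (Y x))"
      using R4_pair_sym[OF v x] s by (simp add: algebra_simps)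
    show "R4 x X Y Z W - c * (g x (Y x) (Z x) * g x (X x) (W x) - g x (X x) (Z x) * g x (Y x) (W x))
      + (R4 x Y Z X W - c * (g x (Z x) (X x) * g x (Y x) (W x) - g x (Y x) (X x) * g x (Z x) (W x)))
      + (R4 x Z X Y W - c * (g x (X x) (Y x) * g x (Z x) (W x) - g x (Z x) (Y x) * g x (X x) (W x))) = 0"
      using bianchi[OF v x] s by (simp add: algebra_simps)
    show "R4 x X Y Y X - c * (g x (Y x) (Y x) * g x (X x) (X x) - g x (X x) (Y x) * g x (Y x) (X x)) = 0"
      using constant_curvature_diagonal[OF c[OF _ _ x] v(1,2) x] s by (simp add: power2_eq_square algebra_simps)
  qed (rule vf_add)
  then show ?thesis by (intro that[of c]) (simp only: right_minus_eq)
qed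

end

section \<open>Foliated charts\<close>

lemma transverse_inner:
  assumes "b \<in> Basis - L" shows "transverse L y \<bullet> b = y \<bullet> b"
proof -
  have "transverse L y \<bullet> b = (\<Sum>c\<in>Basis - L. (y \<bullet> c) * (c \<bullet> b))"
    by (simp add: transverse_def inner_sum_left)
  also have "\<dots> = (\<Sum>c\<in>Basis - L. if c = b then y \<bullet> c else 0)"
    using assms by (intro sum.cong) (auto simp: inner_Basis)
  also have "\<dots> = y \<bullet> b" using assms by (subst sum.delta) auto
  finally show ?thesis .
qed

lemma transverse_eq_iff: "transverse L y = transverse L z \<longleftrightarrow> (\<forall>b\<in>Basis - L. y \<bullet> b = z \<bullet> b)"
proof
  assume eq: "transverse L y = transverse L z"
  show "\<forall>b\<in>Basis - L. y \<bullet> b = z \<bullet> b"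
  proof
    fix b assume b: "b \<in> Basis - L"
    show "y \<bullet> b = z \<bullet> b" using transverse_inner[OF b, of y] transverse_inner[OF b, of z] eq by simp
  qed
next
  assume "\<forall>b\<in>Basis - L. y \<bullet> b = z \<bullet> b"
  then show "transverse L y = transverse L z" unfolding transverse_def by (intro sum.cong) auto
qed

lemma push_transverse_eq:
  "push_transverse L \<phi> v = (\<Sum>b\<in>Basis - L. v (\<lambda>y. \<phi> y \<bullet> b) *\<^sub>R b)"
  unfolding push_transverse_def by (intro sum.cong refl) (simp only: transverse_inner)

lemma push_transverse_eq_0_iff:
  "push_transverse L \<phi> v = 0 \<longleftrightarrow> (\<forall>b\<in>Basis - L. v (\<lambda>y. \<phi> y \<bullet> b) = 0)"
proof
  assume 0: "push_transverse L \<phi> v = 0"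
  show "\<forall>b\<in>Basis - L. v (\<lambda>y. \<phi> y \<bullet> b) = 0"
  proof
    fix b assume b: "b \<in> Basis - L"
    have "push_transverse L \<phi> v \<bullet> b = (\<Sum>c\<in>Basis - L. v (\<lambda>y. \<phi> y \<bullet> c) * (c \<bullet> b))"
      by (simp add: push_transverse_eq inner_sum_left)
    also have "\<dots> = (\<Sum>c\<in>Basis - L. if c = b then v (\<lambda>y. \<phi> y \<bullet> c) else 0)"
      using b by (intro sum.cong) (auto simp: inner_Basis)
    also have "\<dots> = v (\<lambda>y. \<phi> y \<bullet> b)" using b by (subst sum.delta) auto
    finally show "v (\<lambda>y. \<phi> y \<bullet> b) = 0" using 0 by simp
  qed
qed (simp add: push_transverse_eq)

lemma span_subset_Basis_iff:
  fixes L :: "'e::euclidean_space set"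
  assumes "L \<subseteq> Basis"
  shows "w \<in> span L \<longleftrightarrow> (\<forall>b\<in>Basis - L. w \<bullet> b = 0)"
proof
  assume w: "w \<in> span L"
  show "\<forall>b\<in>Basis - L. w \<bullet> b = 0"
  proof
    fix b assume b: "b \<in> Basis - L"
    from w show "w \<bullet> b = 0"
    proof (induction rule: span_induct)
      case base
      show ?case by (simp add: subspace_def inner_add_left)
    next
      case (step x)
      with b assms show ?case by (auto intro!: inner_not_same_Basis)
    qed
  qed
next
  assume w: "\<forall>b\<in>Basis - L. w \<bullet> b = 0"
  have "w = (\<Sum>b\<in>Basis. (w \<bullet> b) *\<^sub>R b)" by (rule euclidean_representation[symmetric])
  also have "\<dots> = (\<Sum>b\<in>L. (w \<bullet> b) *\<^sub>R b)"
    using assms w by (intro sum.mono_neutral_right) auto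
  also have "\<dots> \<in> span L" by (intro span_sum span_scale span_base)
  finally show "w \<in> span L" .
qed

lemma derivative_zero_along_line:
  fixes h :: "'e::real_normed_vector \<Rightarrow> real"
  assumes d: "(h has_derivative h') (at z)" and N: "open N" "z \<in> N"
    and const: "\<And>t. z + t *\<^sub>R w \<in> N \<Longrightarrow> h (z + t *\<^sub>R w) = h z"
  shows "h' w = 0"
proof -
  let ?l = "\<lambda>t::real. z + t *\<^sub>R w"
  have l: "(?l has_derivative (\<lambda>t. t *\<^sub>R w)) (at 0)"
    by (auto intro!: derivative_eq_intros)
  have d0: "(h has_derivative h') (at (?l 0))" using d by simp
  have 1: "((\<lambda>t. h (?l t)) has_derivative (\<lambda>t. h' (t *\<^sub>R w))) (at 0)"
    by (rule has_derivative_compose[OF l d0])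
  have "open (?l -` N)"
    by (rule open_vimage[OF N(1)]) (intro continuous_intros)
  then have "((\<lambda>t. h (?l t)) has_derivative (\<lambda>t. 0)) (at 0)"
    by (rule has_derivative_transform_within_open[OF has_derivative_const[of "h z"]])
       (use N const in auto)
  from has_derivative_unique[OF 1 this] have "h' (1 *\<^sub>R w) = 0" by (rule fun_cong)
  then show ?thesis by simp
qed

text \<open>The set \<open>S\<close> on which the fields live is contained in the domain of one foliated chart. This is no
  restriction because all assertions are local.\<close>

locale foliated_on = riemannian_on A g D S
  for A :: "('a::{t2_space, second_countable_topology}, 'e::euclidean_space) chart set"
    and g :: "'a metric" and D :: "'a connection" and S :: "'a set" +
  fixes L :: "'e set" and F :: "('a, 'e) chart set" and U :: "'a set" and \<phi> :: "'a \<Rightarrow> 'e"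
  assumes foliation: "foliation A L F" and foliated_chart: "(U, \<phi>) \<in> F" and S_subset: "S \<subseteq> U"

sublocale foliated_on \<subseteq> chart: compatible_chart A U \<phi>
  using foliation foliated_chart unfolding foliation_def
  by (intro compatible_chartI[OF atlas, of "A \<union> F"]) auto

context foliated_on
begin

abbreviation vertical :: "'a \<Rightarrow> 'a tangent set" where "vertical \<equiv> vertical_space A L F"
abbreviation horizontal :: "'a \<Rightarrow> 'a tangent set" where "horizontal \<equiv> horizontal_space A g L F"
abbreviation ver :: "'a vfield \<Rightarrow> 'a vfield" where "ver \<equiv> vert A g L F"
abbreviation hori :: "'a vfield \<Rightarrow> 'a vfield" where "hori \<equiv> hor A g L F"
abbreviation vert_field :: "'a vfield \<Rightarrow> bool" where "vert_field \<equiv> vertical_field A L F S"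
abbreviation hor_field :: "'a vfield \<Rightarrow> bool" where "hor_field \<equiv> horizontal_field A g L F S"
abbreviation coord :: "'e \<Rightarrow> 'a vfield" where "coord w \<equiv> \<lambda>x. chart_deriv A (U, \<phi>) x w"

lemma restrict_foliated: "open T \<Longrightarrow> T \<subseteq> U \<Longrightarrow> foliated_on A g D T L F U \<phi>"
  using atlas metric lc foliation foliated_chart by unfold_locales

lemma L_Basis: "L \<subseteq> Basis" using foliation by (simp add: foliation_def)

lemma in_U [simp]: "x \<in> S \<Longrightarrow> x \<in> U" using S_subset by blast

lemma transverse_compatible:
  assumes "(V, \<psi>) \<in> F" "x \<in> U" "x \<in> V"
  obtains N \<gamma> where "open N" "x \<in> N" "N \<subseteq> U \<inter> V"
    "\<And>y. y \<in> N \<Longrightarrow> transverse L (\<psi> y) = \<gamma> (transverse L (\<phi> y))"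
proof -
  have "\<forall>c\<in>F. \<forall>d\<in>F. \<forall>x\<in>fst c \<inter> fst d. \<exists>N \<gamma>. open N \<and> x \<in> N \<and> N \<subseteq> fst c \<inter> fst d \<and>
      (\<forall>y\<in>N. transverse L (snd d y) = \<gamma> (transverse L (snd c y)))"
    using foliation by (simp add: foliation_def case_prod_beta)
  from this[THEN bspec, OF foliated_chart, THEN bspec, OF assms(1), unfolded fst_conv snd_conv,
      THEN bspec, OF IntI[OF assms(2,3)]]
  obtain N \<gamma> where N: "open N \<and> x \<in> N \<and> N \<subseteq> U \<inter> V \<and>
      (\<forall>y\<in>N. transverse L (\<psi> y) = \<gamma> (transverse L (\<phi> y)))" by (elim exE)
  show ?thesis by (rule that[of N \<gamma>]) (use N in blast)+
qed

text \<open>The transverse coordinates of another foliated chart are locally functions of those of the given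
  chart, hence constant along the lines in the directions of the leaves. So one foliated chart suffices
  to recognise vertical vectors.\<close>

lemma vertical_iff:
  assumes x: "x \<in> U"
  shows "v \<in> vertical x \<longleftrightarrow> v \<in> tangent_space A x \<and> (\<forall>b\<in>Basis - L. v (\<lambda>y. \<phi> y \<bullet> b) = 0)"
proof
  assume "v \<in> vertical x"
  then show "v \<in> tangent_space A x \<and> (\<forall>b\<in>Basis - L. v (\<lambda>y. \<phi> y \<bullet> b) = 0)"
    using foliated_chart x push_transverse_eq_0_iff[of L \<phi> v] unfolding vertical_space_def by auto
next
  assume v: "v \<in> tangent_space A x \<and> (\<forall>b\<in>Basis - L. v (\<lambda>y. \<phi> y \<bullet> b) = 0)"
  then obtain w where w: "v = coord w x" using chart.tangent_space_eq[OF x] by auto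
  have wb: "\<forall>b\<in>Basis - L. w \<bullet> b = 0"
    using v chart.chart_deriv_coordinate[OF x] by (simp add: w)
  have "v (\<lambda>y. \<psi> y \<bullet> b) = 0" if V: "(V, \<psi>) \<in> F" "x \<in> V" and b: "b \<in> Basis - L" for V \<psi> b
  proof -
    interpret V: foliated_on A g D "{}" L F V \<psi>
      using atlas metric lc foliation V by unfold_locales auto
    obtain N \<gamma> where N: "open N" "x \<in> N" "N \<subseteq> U \<inter> V"
      "\<And>y. y \<in> N \<Longrightarrow> transverse L (\<psi> y) = \<gamma> (transverse L (\<phi> y))"
      by (rule transverse_compatible[OF V(1) x V(2)]) (rule that)
    let ?h = "(\<lambda>y. \<psi> y \<bullet> b) \<circ> inv_into U \<phi>"
    have sn: "smooth_near A x (\<lambda>y. \<psi> y \<bullet> b)" by (rule V.chart.smooth_near_coordinate[OF V(2)])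
    have d: "(?h has_derivative frechet_derivative ?h (at (\<phi> x))) (at (\<phi> x))"
      using chart.smooth_near_differentiable[OF sn x] by (simp only: frechet_derivative_works)
    have "open (\<phi> ` N)" using N by (intro chart.open_image) auto
    then have "frechet_derivative ?h (at (\<phi> x)) w = 0"
    proof (rule derivative_zero_along_line[OF d])
      show "\<phi> x \<in> \<phi> ` N" using N by simp
      fix t assume "\<phi> x + t *\<^sub>R w \<in> \<phi> ` N"
      then obtain y where y: "y \<in> N" "\<phi> x + t *\<^sub>R w = \<phi> y" by auto
      have "transverse L (\<phi> y) = transverse L (\<phi> x)"
        using wb by (simp add: y(2)[symmetric] transverse_eq_iff inner_add_left)
      then have "transverse L (\<psi> y) = transverse L (\<psi> x)" using N(4) y(1) N(2) by simp
      then have "\<psi> y \<bullet> b = \<psi> x \<bullet> b" using b by (simp add: transverse_eq_iff)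
      moreover have "y \<in> U" using y(1) N(3) by auto
      ultimately show "?h (\<phi> x + t *\<^sub>R w) = ?h (\<phi> x)" using x by (simp add: y(2))
    qed
    with sn show ?thesis by (simp add: w chart.chart_deriv_apply)
  qed
  then have "push_transverse L \<psi> v = 0" if "(V, \<psi>) \<in> F" "x \<in> V" for V \<psi>
    using that by (simp add: push_transverse_eq_0_iff)
  with v show "v \<in> vertical x" unfolding vertical_space_def by auto
qed

lemma coord_vertical_iff: "x \<in> U \<Longrightarrow> coord w x \<in> vertical x \<longleftrightarrow> w \<in> span L"
  by (simp add: vertical_iff chart.chart_deriv_in_tangent_space chart.chart_deriv_coordinate
      span_subset_Basis_iff[OF L_Basis])

lemma vertical_cases:
  assumes "x \<in> U" "v \<in> vertical x"
  obtains w where "w \<in> span L" "v = coord w x"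
proof -
  have "v \<in> tangent_space A x" using assms by (simp add: vertical_space_def)
  then obtain w where "v = coord w x" using chart.tangent_space_eq[OF assms(1)] by auto
  with that assms show ?thesis using coord_vertical_iff by blast
qed

lemma coord_eq_0_iff:
  assumes "x \<in> U" shows "coord w x = 0 \<longleftrightarrow> w = 0"
proof
  assume "coord w x = 0"
  then have "w \<bullet> b = 0" for b
    using chart.chart_deriv_coordinate[OF assms, of w b] by simp
  then show "w = 0" by (metis inner_eq_zero_iff)
next
  interpret l: linear "chart_deriv A (U, \<phi>) x" by (rule chart.linear_chart_deriv[OF assms])
  show "w = 0 \<Longrightarrow> coord w x = 0" using l.zero by simp
qed

lemma vf_coord: "vf (coord w)"
  by (rule vector_field_subset[OF atlas chart.coordinate_field S_subset])

lemma vertical_tangent: "v \<in> vertical x \<Longrightarrow> v \<in> tangent_space A x"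
  by (simp add: vertical_space_def)

lemma horizontal_iff:
  "v \<in> horizontal x \<longleftrightarrow> v \<in> tangent_space A x \<and> (\<forall>u\<in>vertical x. g x u v = 0)"
  by (simp only: horizontal_space_def mem_Collect_eq)

lemma horizontal_orthogonal:
  assumes "u \<in> vertical x" "v \<in> horizontal x" shows "g x u v = 0" "g x v u = 0"
proof -
  show 1: "g x u v = 0" using assms horizontal_iff by blast
  have "v \<in> tangent_space A x" using assms horizontal_iff by blast
  then show "g x v u = 0" using g_sym[OF _ vertical_tangent[OF assms(1)]] 1 by simp
qed

lemma vertical_closed:
  assumes "x \<in> U"
  shows "0 \<in> vertical x" "u \<in> vertical x \<Longrightarrow> v \<in> vertical x \<Longrightarrow> u + v \<in> vertical x"
    "u \<in> vertical x \<Longrightarrow> v \<in> vertical x \<Longrightarrow> u - v \<in> vertical x"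
    "u \<in> vertical x \<Longrightarrow> c *\<^sub>R u \<in> vertical x"
  unfolding vertical_iff[OF assms] by simp_all (simp add: scaleR_fun_def)

lemma horizontal_closed:
  shows "0 \<in> horizontal x"
    and "u \<in> horizontal x \<Longrightarrow> v \<in> horizontal x \<Longrightarrow> u + v \<in> horizontal x"
    and "u \<in> horizontal x \<Longrightarrow> v \<in> horizontal x \<Longrightarrow> u - v \<in> horizontal x"
    and "u \<in> horizontal x \<Longrightarrow> c *\<^sub>R u \<in> horizontal x"
  unfolding horizontal_iff using vertical_tangent[of _ x] by (simp_all add: g_bilinear)

section \<open>The orthogonal splitting\<close>

text \<open>Smoothness of the orthogonal projection to the span of the coordinate fields of \<open>K\<close>, by
  induction on \<open>K\<close>: one step of Gram-Schmidt, without normalisation.\<close>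

lemma orthogonal_to_span:
  assumes "x \<in> U" "z \<in> tangent_space A x" "\<And>k. k \<in> K \<Longrightarrow> g x (coord k x) z = 0" "w \<in> span K"
  shows "g x (coord w x) z = 0"
  using assms(4)
proof (induction rule: span_induct)
  case base
  interpret l: linear "chart_deriv A (U, \<phi>) x" by (rule chart.linear_chart_deriv[OF assms(1)])
  show ?case
    using assms(1,2) chart.chart_deriv_in_tangent_space[OF assms(1)]
    by (simp add: subspace_def l.zero l.add l.scale g_bilinear)
qed (rule assms(3))

lemma smooth_projection:
  assumes "finite K" "K \<subseteq> Basis" "vf E"
  shows "\<exists>W. vf W \<and> (\<forall>x\<in>S. \<exists>w\<in>span K. W x = coord w x) \<and>
    (\<forall>x\<in>S. \<forall>k\<in>K. g x (coord k x) (E x - W x) = 0)"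
  using assms
proof (induction K arbitrary: E rule: finite_induct)
  case empty
  have "\<forall>x\<in>S. \<exists>w\<in>span {}. 0 = coord w x"
    using coord_eq_0_iff by (auto intro!: bexI[of _ 0])
  with vf_zero show ?case by blast
next
  case (insert k K)
  have K: "K \<subseteq> Basis" and k: "k \<in> Basis" using insert.prems by auto
  obtain P where P: "vf P" "\<And>x. x \<in> S \<Longrightarrow> \<exists>w\<in>span K. P x = coord w x"
    "\<And>x j. x \<in> S \<Longrightarrow> j \<in> K \<Longrightarrow> g x (coord j x) (E x - P x) = 0"
    using insert.IH[OF K insert.prems(2)] by blast
  obtain Q where Q: "vf Q" "\<And>x. x \<in> S \<Longrightarrow> \<exists>w\<in>span K. Q x = coord w x"
    "\<And>x j. x \<in> S \<Longrightarrow> j \<in> K \<Longrightarrow> g x (coord j x) (coord k x - Q x) = 0"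
    using insert.IH[OF K vf_coord] by blast
  \<comment> \<open>The component of the new coordinate field that is orthogonal to the previous ones; it has no zero
    because its coefficient at \<open>k\<close> is \<open>1\<close>.\<close>
  define N where "N = coord k - Q"
  have N: "vf N" unfolding N_def by (rule vf_diff[OF vf_coord Q(1)])
  have Nx: "N x = coord k x - Q x" for x by (simp add: N_def)
  define f where "f = (\<lambda>x. g x (E x) (N x) * inverse (g x (N x) (N x)))"
  have N0: "\<exists>w. N x = coord w x \<and> w - k \<in> span K \<and> N x \<noteq> 0" if x: "x \<in> S" for x
  proof -
    interpret l: linear "chart_deriv A (U, \<phi>) x" by (rule chart.linear_chart_deriv) (use x in simp)
    obtain w where w: "w \<in> span K" "Q x = coord w x" using Q(2)[OF x] by blast
    have "N x = coord (k - w) x" by (simp only: Nx w l.diff)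
    moreover have "w \<bullet> k = 0" using w(1) insert.hyps(2) k by (simp add: span_subset_Basis_iff[OF K])
    then have "k - w \<noteq> 0" using k by auto
    moreover have "(k - w) - k \<in> span K" using span_neg[OF w(1)] by simp
    ultimately show ?thesis using coord_eq_0_iff[of x "k - w"] x by auto
  qed
  have NN: "g x (N x) (N x) \<noteq> 0" if "x \<in> S" for x
    using N0[OF that] g_eq_0_iff[OF vf_tangent[OF N that]] by blast
  have f: "sm f"
    unfolding f_def
    by (rule smooth_fun_mult[OF atlas open_S sm_g[OF insert.prems(2) N]
          smooth_fun_inverse[OF atlas open_S sm_g[OF N N] NN]])
  let ?W = "P + (\<lambda>x. f x *\<^sub>R N x)"
  have W: "vf ?W" by (rule vf_add[OF P(1) vf_scale[OF N f]])
  have Wx: "?W x = P x + f x *\<^sub>R N x" for x by (rule plus_fun_apply)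
  have "\<exists>w\<in>span (insert k K). ?W x = coord w x" if x: "x \<in> S" for x
  proof -
    interpret l: linear "chart_deriv A (U, \<phi>) x" by (rule chart.linear_chart_deriv) (use x in simp)
    obtain p where p: "p \<in> span K" "P x = coord p x" using P(2)[OF x] by blast
    obtain n where n: "N x = coord n x" "n - k \<in> span K" using N0[OF x] by blast
    have sub: "span K \<subseteq> span (insert k K)" by (rule span_mono) auto
    have "n = (n - k) + k" by simp
    moreover have "(n - k) + k \<in> span (insert k K)"
      using n(2) sub by (intro span_add span_base[of k]) auto
    ultimately have "n \<in> span (insert k K)" by (simp only:)
    then have "p + f x *\<^sub>R n \<in> span (insert k K)"
      using p(1) sub by (intro span_add span_scale) auto
    moreover have "?W x = coord (p + f x *\<^sub>R n) x" by (simp only: Wx p n l.add l.scale)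
    ultimately show ?thesis by blast
  qed
  moreover have "g x (coord j x) (E x - ?W x) = 0" if x: "x \<in> S" and j: "j \<in> insert k K" for x j
  proof -
    note t = vf_tangent[OF _ x]
    note tt = t[OF insert.prems(2)] t[OF P(1)] t[OF Q(1)] t[OF N] t[OF vf_coord]
    have EW: "E x - ?W x = (E x - P x) - f x *\<^sub>R N x" by (simp only: Wx diff_diff_add)
    have K0: "g x (coord i x) (E x - ?W x) = 0" if "i \<in> K" for i
      using P(3)[OF x that] Q(3)[OF x that] tt unfolding EW by (simp add: g_bilinear Nx[symmetric])
    show ?thesis
    proof (cases "j \<in> K")
      case False
      with j have jk: "j = k" by simp
      obtain p where p: "p \<in> span K" "P x = coord p x" using P(2)[OF x] by blast
      obtain q where q: "q \<in> span K" "Q x = coord q x" using Q(2)[OF x] by blast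
      have "g x (coord p x) (N x) = 0"
        by (rule orthogonal_to_span[OF _ t[OF N] _ p(1)]) (use x Q(3) Nx in auto)
      then have PN: "g x (N x) (P x) = 0" using g_sym[OF t[OF N] t[OF P(1)]] p by simp
      have QE: "g x (Q x) (E x - ?W x) = 0"
        unfolding q by (rule orthogonal_to_span[OF _ _ K0 q(1)])
          (use x tangent_space_closed(3)[OF tt(1) t[OF W]] in auto)
      have "g x (N x) (E x - ?W x) = 0"
        unfolding EW using tt PN NN[OF x] g_sym[OF tt(1,4)] by (simp add: g_bilinear f_def)
      moreover have "coord k x = N x + Q x" by (simp add: Nx)
      ultimately show ?thesis
        unfolding jk using QE tt tangent_space_closed(3)[OF tt(1) t[OF W]] by (simp only: g_add add_0)
    qed (rule K0)
  qed
  ultimately show ?case using W by blast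
qed

lemma ver_eqI:
  assumes "u \<in> vertical x" "E x - u \<in> horizontal x" "x \<in> U"
  shows "ver E x = u"
  unfolding vert_def
proof (rule the_equality)
  show "u \<in> vertical x \<and> E x - u \<in> horizontal x" using assms by simp
  fix v assume v: "v \<in> vertical x \<and> E x - v \<in> horizontal x"
  have "v - u \<in> vertical x" using v assms vertical_closed(3) by blast
  moreover have "(E x - u) - (E x - v) \<in> horizontal x"
    using v assms horizontal_closed(3) by blast
  then have "v - u \<in> horizontal x" by simp
  ultimately have "g x (v - u) (v - u) = 0" by (rule horizontal_orthogonal)
  then show "v = u" using g_eq_0_iff[OF vertical_tangent[OF \<open>v - u \<in> vertical x\<close>]] by simp
qed

lemma splitting:
  assumes "vf E"
  shows "vert_field (ver E)" "hor_field (hori E)"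
proof -
  obtain W where W: "vf W" "\<And>x. x \<in> S \<Longrightarrow> \<exists>w\<in>span L. W x = coord w x"
    "\<And>x k. x \<in> S \<Longrightarrow> k \<in> L \<Longrightarrow> g x (coord k x) (E x - W x) = 0"
    using smooth_projection[OF finite_subset[OF L_Basis finite_Basis] L_Basis assms] by blast
  have Wv: "W x \<in> vertical x" if "x \<in> S" for x
    using W(2)[OF that] coord_vertical_iff that by auto
  have Wh: "E x - W x \<in> horizontal x" if x: "x \<in> S" for x
  proof -
    have t: "E x - W x \<in> tangent_space A x" using vf_tangent[OF assms x] vf_tangent[OF W(1) x] by simp
    have "g x u (E x - W x) = 0" if u: "u \<in> vertical x" for u
    proof -
      obtain w where w: "w \<in> span L" "u = coord w x" using vertical_cases[OF in_U[OF x] u] by blast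
      show ?thesis unfolding w by (rule orthogonal_to_span[OF _ t W(3)[OF x] w(1)]) (use x in simp_all)
    qed
    with t show ?thesis unfolding horizontal_iff by blast
  qed
  have eq: "ver E x = W x" if "x \<in> S" for x
    by (rule ver_eqI[where E = E, OF Wv[OF that] Wh[OF that] in_U[OF that]])
  have ver: "vf (ver E)" by (rule vector_field_cong[OF atlas W(1)]) (simp only: eq)
  then show "vert_field (ver E)" using Wv eq by (simp add: vertical_field_def)
  show "hor_field (hori E)"
    unfolding horizontal_field_def hor_def
    using vf_diff[OF assms ver] Wh eq by (simp add: minus_apply[of E])
qed

lemma hori_apply: "hori E x = E x - ver E x"
  by (simp only: hor_def minus_apply)

lemma splitting_sum: "E x = ver E x + hori E x"
  by (simp only: hori_apply) simp

lemma vert_field_vf: "vert_field X \<Longrightarrow> vf X" and vert_field_vertical: "vert_field X \<Longrightarrow> x \<in> S \<Longrightarrow> X x \<in> vertical x"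
  by (auto simp: vertical_field_def)

lemma hor_field_vf: "hor_field X \<Longrightarrow> vf X" and hor_field_horizontal: "hor_field X \<Longrightarrow> x \<in> S \<Longrightarrow> X x \<in> horizontal x"
  by (auto simp: horizontal_field_def)

lemma ver_vertical: "x \<in> S \<Longrightarrow> E x \<in> vertical x \<Longrightarrow> ver E x = E x"
  using horizontal_closed(1) by (intro ver_eqI) auto

lemma ver_horizontal: "x \<in> S \<Longrightarrow> E x \<in> horizontal x \<Longrightarrow> ver E x = 0"
  using vertical_closed(1) by (intro ver_eqI) auto

lemma g_vH: "vert_field V \<Longrightarrow> hor_field X \<Longrightarrow> x \<in> S \<Longrightarrow> g x (V x) (X x) = 0"
  and g_Hv: "vert_field V \<Longrightarrow> hor_field X \<Longrightarrow> x \<in> S \<Longrightarrow> g x (X x) (V x) = 0"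
  using horizontal_orthogonal[OF vert_field_vertical hor_field_horizontal] by auto

lemma g_ver:
  assumes "vf E" "vert_field V" "x \<in> S" shows "g x (ver E x) (V x) = g x (E x) (V x)"
proof -
  note s = splitting[OF assms(1)]
  have "g x (E x) (V x) = g x (ver E x + hori E x) (V x)" by (simp only: splitting_sum[symmetric])
  also have "\<dots> = g x (ver E x) (V x)"
    using g_add(1)[OF vf_tangent[OF vert_field_vf[OF s(1)] assms(3)] vf_tangent[OF hor_field_vf[OF s(2)] assms(3)]
        vf_tangent[OF vert_field_vf[OF assms(2)] assms(3)]] g_Hv[OF assms(2) s(2) assms(3)] by simp
  finally show ?thesis by simp
qed

lemma g_hori:
  assumes "vf E" "hor_field X" "x \<in> S" shows "g x (hori E x) (X x) = g x (E x) (X x)"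
proof -
  note s = splitting[OF assms(1)]
  have "g x (E x) (X x) = g x (ver E x + hori E x) (X x)" by (simp only: splitting_sum[symmetric])
  also have "\<dots> = g x (hori E x) (X x)"
    using g_add(1)[OF vf_tangent[OF vert_field_vf[OF s(1)] assms(3)] vf_tangent[OF hor_field_vf[OF s(2)] assms(3)]
        vf_tangent[OF hor_field_vf[OF assms(2)] assms(3)]] g_vH[OF s(1) assms(2,3)] by simp
  finally show ?thesis by simp
qed

lemma vert_field_eq_0I:
  assumes "vert_field Z" "x \<in> S" "\<And>V. vert_field V \<Longrightarrow> g x (Z x) (V x) = 0" shows "Z x = 0"
  using g_eq_0_iff[OF vf_tangent[OF vert_field_vf[OF assms(1)] assms(2)]] assms(3)[OF assms(1)] by simp

lemma hor_field_eq_0I: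
  assumes "hor_field Z" "x \<in> S" "\<And>X. hor_field X \<Longrightarrow> g x (Z x) (X x) = 0" shows "Z x = 0"
  using g_eq_0_iff[OF vf_tangent[OF hor_field_vf[OF assms(1)] assms(2)]] assms(3)[OF assms(1)] by simp

lemma vert_field_coord: "w \<in> span L \<Longrightarrow> vert_field (coord w)"
  using vf_coord coord_vertical_iff by (simp add: vertical_field_def)

lemma hor_fieldI:
  assumes "vf X" "\<And>V x. vert_field V \<Longrightarrow> x \<in> S \<Longrightarrow> g x (V x) (X x) = 0"
  shows "hor_field X"
proof -
  have "X x \<in> horizontal x" if x: "x \<in> S" for x
  proof -
    have "g x u (X x) = 0" if u: "u \<in> vertical x" for u
    proof -
      obtain w where w: "w \<in> span L" "u = coord w x" using vertical_cases[OF in_U[OF x] u] by blast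
      show ?thesis unfolding w(2) by (rule assms(2)[OF vert_field_coord[OF w(1)] x])
    qed
    with vf_tangent[OF assms(1) x] show ?thesis unfolding horizontal_iff by blast
  qed
  with assms(1) show ?thesis by (simp add: horizontal_field_def)
qed

end

section \<open>Basic vector fields\<close>

text \<open>If the brackets with vertical fields are vertical, then the transverse components of \<open>X\<close> in a foliated
  chart have vanishing derivatives in the directions of the leaves. They are therefore constant on the
  plaques, which are convex in the coordinates, and so \<open>X\<close> can be projected.\<close>

lemma basic_fieldI:
  assumes A: "smooth_atlas A" and F: "foliation A L F" and S: "open S"
    and X: "horizontal_field A g L F S X"
    and br: "\<And>T V x. open T \<Longrightarrow> T \<subseteq> S \<Longrightarrow> vertical_field A L F T V \<Longrightarrow> x \<in> T \<Longrightarrow>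
      lie_bracket A V X x \<in> vertical_space A L F x"
    and g: "riemannian_metric A g" and D: "levi_civita A g D"
  shows "basic_field A g L F S X"
proof -
  have "\<exists>Z. \<forall>x\<in>N. push_transverse L \<phi> (X x) = Z (transverse L (\<phi> x))"
    if c: "(U, \<phi>) \<in> F" and N: "open N" "N \<subseteq> U \<inter> S" and box: "open_box (\<phi> ` N)" for U \<phi> N
  proof -
    interpret foliated_on A g D N L F U \<phi>
      using A g D F c N by unfold_locales auto
    have Xv: "vf X"
      using X N by (auto simp: horizontal_field_def intro: vector_field_subset[OF A])
    have Xt: "X y \<in> tangent_space A y" if "y \<in> N" for y by (rule vf_tangent[OF Xv that])
    have comp: "X y (\<lambda>z. \<phi> z \<bullet> b) = X z (\<lambda>z. \<phi> z \<bullet> b)"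
      if yz: "y \<in> N" "z \<in> N" and eq: "transverse L (\<phi> y) = transverse L (\<phi> z)"
        and b: "b \<in> Basis - L" for y z b
    proof -
      let ?f = "\<lambda>z. \<phi> z \<bullet> b"
      let ?u = "\<lambda>y. X y ?f"
      let ?h = "?u \<circ> inv_into U \<phi>"
      have sf: "sm ?f" by (rule smooth_fun_subset[OF chart.smooth_coordinate S_subset])
      have su: "sm ?u" by (rule sm_deriv[OF Xv sf])
      have part: "frechet_derivative ?h (at (\<phi> x)) l = 0" if x: "x \<in> N" and l: "l \<in> span L" for x l
      proof -
        have V: "vertical_field A L F N (coord l)" by (rule vert_field_coord[OF l])
        have lb: "coord l z ?f = 0" if "z \<in> N" for z
          using l b that by (simp add: chart.chart_deriv_coordinate span_subset_Basis_iff[OF L_Basis])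
        have "X x (\<lambda>z. coord l z ?f) = X x (\<lambda>z. 0)"
          by (rule tangent_cong[OF A Xt[OF x] N(1) x]) (rule lb)
        then have "X x (\<lambda>z. coord l z ?f) = 0" by (simp only: tangent_const[OF A Xt[OF x]])
        moreover have "lie_bracket A (coord l) X x \<in> vertical x"
          using N by (intro br[OF N(1) _ V x]) auto
        then have "lie_bracket A (coord l) X x ?f = 0" using vertical_iff[of x] x b by auto
        ultimately have "coord l x ?u = 0"
          using sm_near[OF sf x] by (simp add: lie_bracket_def)
        then show ?thesis using sm_near[OF su x] by (simp add: chart.chart_deriv_apply)
      qed
      define w where "w = \<phi> z - \<phi> y"
      have w: "w \<in> span L"
        using eq by (auto simp: w_def span_subset_Basis_iff[OF L_Basis] transverse_eq_iff inner_diff_left)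
      have cv: "convex (\<phi> ` N)" using box by (auto simp: open_box_def)
      have seg: "\<phi> y + t *\<^sub>R w \<in> \<phi> ` N" if "t \<in> {0..1}" for t
      proof -
        have "\<phi> y + t *\<^sub>R w = (1 - t) *\<^sub>R \<phi> y + t *\<^sub>R \<phi> z" by (simp add: w_def algebra_simps)
        then show ?thesis using convexD[OF cv, of "\<phi> y" "\<phi> z" "1 - t" t] yz that by auto
      qed
      have "((\<lambda>t. ?h (\<phi> y + t *\<^sub>R w)) has_derivative (\<lambda>s. 0)) (at t within {0..1})"
        if t: "t \<in> {0..1}" for t
      proof -
        obtain x where x: "x \<in> N" "\<phi> y + t *\<^sub>R w = \<phi> x" using seg[OF t] by auto
        have d: "(?h has_derivative frechet_derivative ?h (at (\<phi> x))) (at (\<phi> x))"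
          using chart.smooth_near_differentiable[OF sm_near[OF su x(1)]] x(1) S_subset
          by (auto simp: frechet_derivative_works[symmetric])
        interpret l: linear "frechet_derivative ?h (at (\<phi> x))" using d by (rule has_derivative_linear)
        have l: "((\<lambda>t. \<phi> y + t *\<^sub>R w) has_derivative (\<lambda>s. s *\<^sub>R w)) (at t)"
          by (auto intro!: derivative_eq_intros)
        have "((\<lambda>t. ?h (\<phi> y + t *\<^sub>R w)) has_derivative
            (\<lambda>s. frechet_derivative ?h (at (\<phi> x)) (s *\<^sub>R w))) (at t)"
          by (rule has_derivative_compose[OF l]) (simp only: x d)
        then have "((\<lambda>t. ?h (\<phi> y + t *\<^sub>R w)) has_derivative (\<lambda>s. 0)) (at t)"
          by (simp only: l.scale part[OF x(1) w] scaleR_zero_right)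
        then show ?thesis by (rule has_derivative_at_withinI)
      qed
      from has_derivative_zero_constant[OF convex_real_interval(5) this]
      obtain k where k: "\<And>t. t \<in> {0..1} \<Longrightarrow> ?h (\<phi> y + t *\<^sub>R w) = k" by blast
      have "?h (\<phi> y) = k" using k[of 0] by simp
      moreover have "?h (\<phi> z) = k" using k[of 1] by (simp add: w_def)
      ultimately show ?thesis using yz S_subset by auto
    qed
    have eq: "push_transverse L \<phi> (X y) = push_transverse L \<phi> (X z)"
      if "y \<in> N" "z \<in> N" "transverse L (\<phi> y) = transverse L (\<phi> z)" for y z
      unfolding push_transverse_eq
      by (intro sum.cong refl arg_cong2[where f = scaleR] comp[OF that])
    define Z where "Z t = push_transverse L \<phi> (X (SOME y. y \<in> N \<and> transverse L (\<phi> y) = t))" for t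
    have "push_transverse L \<phi> (X x) = Z (transverse L (\<phi> x))" if x: "x \<in> N" for x
    proof -
      let ?P = "\<lambda>y. y \<in> N \<and> transverse L (\<phi> y) = transverse L (\<phi> x)"
      have "?P (SOME y. ?P y)" by (rule someI[of ?P x]) (use x in simp)
      then show ?thesis unfolding Z_def using eq[OF x] by simp
    qed
    then show ?thesis by blast
  qed
  with X show ?thesis unfolding basic_field_def by auto
qed

context foliated_on
begin

text \<open>The horizontal parts of the coordinate fields satisfy the criterion for basic fields: their
  transverse components are constant, and those of a vertical field are \<open>0\<close>. They thus provide a
  basic field with a prescribed horizontal value.\<close>

lemma hori_coord_bracket:
  assumes T: "open T" "T \<subseteq> S" and V: "vertical_field A L F T V" and x: "x \<in> T"
  shows "lie_bracket A V (hori (coord w)) x \<in> vertical x"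
proof -
  interpret T: foliated_on A g D T L F U \<phi>
    using T S_subset by (intro restrict_foliated) auto
  note s = T.splitting[OF T.vf_coord, of w]
  have "lie_bracket A V (hori (coord w)) x (\<lambda>y. \<phi> y \<bullet> b) = 0" if b: "b \<in> Basis - L" for b
  proof -
    let ?f = "\<lambda>y. \<phi> y \<bullet> b"
    have Vf: "E y ?f = 0" if "T.vert_field E" "y \<in> T" for E y
      using vertical_iff[of y] T.vert_field_vertical[OF that] T.in_U[OF that(2)] b by blast
    have "hori (coord w) x (\<lambda>y. V y ?f) = hori (coord w) x (\<lambda>y. 0)"
      by (rule tangent_cong[OF atlas T.vf_tangent[OF T.hor_field_vf[OF s(2)] x] T(1) x]) (rule Vf[OF V])
    also have "\<dots> = 0" by (rule tangent_const[OF atlas T.vf_tangent[OF T.hor_field_vf[OF s(2)] x]])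
    finally have 1: "hori (coord w) x (\<lambda>y. V y ?f) = 0" .
    have "V x (\<lambda>y. hori (coord w) y ?f) = V x (\<lambda>y. w \<bullet> b)"
      by (rule tangent_cong[OF atlas T.vf_tangent[OF T.vert_field_vf[OF V] x] T(1) x])
         (use Vf[OF s(1)] in \<open>simp add: hori_apply chart.chart_deriv_coordinate\<close>)
    also have "\<dots> = 0" by (rule tangent_const[OF atlas T.vf_tangent[OF T.vert_field_vf[OF V] x]])
    finally show ?thesis using 1 by (simp add: lie_bracket_def)
  qed
  then show ?thesis
    using vertical_iff[of x] T.vf_tangent[OF T.vf_bracket[OF T.vert_field_vf[OF V] T.hor_field_vf[OF s(2)]] x] T.in_U[OF x]
    by blast
qed

lemma basic_hori_coord: "basic_field A g L F S (hori (coord w))"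
  by (rule basic_fieldI[OF atlas foliation open_S splitting(2)[OF vf_coord] hori_coord_bracket metric lc])

text \<open>For basic \<open>X\<close> the product \<open>g(D\<^sub>X V, X)\<close> equals \<open>g(D\<^sub>V X, X)\<close>, because \<open>[V,X]\<close> is vertical, and this
  is \<open>0\<close>, because \<open>V g(X,X) = 0\<close>. A general horizontal \<open>X\<close> agrees at the given point with a basic field, and
  \<open>g(V, D\<^sub>X X) = - g(D\<^sub>X V, X)\<close> depends on \<open>X\<close> only through its value there.\<close>

lemma horizontal_D_self:
  assumes bundle_like: "bundle_like A g L F" and X: "hor_field X" and V: "vert_field V" and x: "x \<in> S"
  shows "g x (V x) (D X X x) = 0"
proof -
  note t = vf_tangent[OF _ x]
  obtain w where w: "X x = coord w x"
    using chart.tangent_space_eq[of x] t[OF hor_field_vf[OF X]] x by auto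
  \<comment> \<open>A basic field with the same value at \<open>x\<close>.\<close>
  define B where "B = hori (coord w)"
  have B: "hor_field B" unfolding B_def by (rule splitting(2)[OF vf_coord])
  have Bx: "B x = X x"
    using ver_horizontal[OF x, of "coord w"] hor_field_horizontal[OF X x] w by (simp add: B_def hori_apply)
  note Xf = hor_field_vf[OF X] and Vf = vert_field_vf[OF V] and Bf = hor_field_vf[OF B]
  have "V x (\<lambda>y. g y (B y) (B y)) = 0"
    using bundle_like open_S basic_hori_coord[of w] V x unfolding bundle_like_def B_def by blast
  then have 1: "g x (D V B x) (B x) = 0"
    using D_metric[OF Vf Bf Bf x] g_sym[OF t[OF vf_D[OF Vf Bf]] t[OF Bf]] by simp
  have "lie_bracket A V B x \<in> vertical x"
    unfolding B_def by (rule hori_coord_bracket[OF open_S order_refl V x])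
  then have "g x (lie_bracket A V B x) (B x) = 0"
    using horizontal_orthogonal(1) hor_field_horizontal[OF B x] by blast
  then have "g x (D B V x) (B x) = 0"
    using 1 D_torsion[OF Vf Bf x] g_diff(1)[OF t[OF vf_D[OF Vf Bf]] t[OF vf_D[OF Bf Vf]] t[OF Bf]] by simp
  moreover have "D B V x = D X V x" by (rule D_tensorial[OF Bf Xf Vf x Bx])
  moreover have "X x (\<lambda>y. g y (V y) (X y)) = X x (\<lambda>y. 0)"
    by (rule tangent_cong[OF atlas t[OF Xf] open_S x]) (rule g_vH[OF V X])
  then have "X x (\<lambda>y. g y (V y) (X y)) = 0" by (simp only: tangent_const[OF atlas t[OF Xf]])
  ultimately show ?thesis using D_metric[OF Xf Vf Xf x] Bx by simp
qed

end

context foliated_on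
begin

lemma vert_field_add: "vert_field V \<Longrightarrow> vert_field W \<Longrightarrow> vert_field (V + W)"
  using vf_add vertical_closed(2) by (simp add: vertical_field_def plus_fun_apply[of V W])

lemma vert_field_scale: "vert_field V \<Longrightarrow> sm f \<Longrightarrow> vert_field (\<lambda>x. f x *\<^sub>R V x)"
  using vf_scale vertical_closed(4) by (simp add: vertical_field_def)

lemma hor_field_add: "hor_field X \<Longrightarrow> hor_field Y \<Longrightarrow> hor_field (X + Y)"
  using vf_add horizontal_closed(2) by (simp add: horizontal_field_def plus_fun_apply[of X Y])

lemma hor_field_scale: "hor_field X \<Longrightarrow> sm f \<Longrightarrow> hor_field (\<lambda>x. f x *\<^sub>R X x)"
  using vf_scale horizontal_closed(4) by (simp add: horizontal_field_def)

lemma ver_cong: "E x = E' x \<Longrightarrow> ver E x = ver E' x"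
  by (simp add: vert_def)

lemma hori_cong: "E x = E' x \<Longrightarrow> hori E x = hori E' x"
  using ver_cong[of E x E'] by (simp add: hori_apply)

lemma hori_add:
  assumes "vf E" "vf E'" "x \<in> S" shows "hori (E + E') x = hori E x + hori E' x"
proof -
  note s = splitting[OF assms(1)] splitting[OF assms(2)]
  have "(E + E') x - (ver E x + ver E' x) = hori E x + hori E' x"
    by (simp only: plus_fun_apply[of E E' x] hori_apply add_diff_add)
  then have "ver (E + E') x = ver E x + ver E' x"
    using vertical_closed(2)[OF _ vert_field_vertical[OF s(1) assms(3)] vert_field_vertical[OF s(3) assms(3)]]
      horizontal_closed(2)[OF hor_field_horizontal[OF s(2) assms(3)] hor_field_horizontal[OF s(4) assms(3)]] assms(3)
    by (intro ver_eqI) simp_all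
  then show ?thesis by (simp only: hori_apply plus_fun_apply[of E E' x] add_diff_add)
qed

lemma hori_eq_0_iff:
  assumes "x \<in> S" "vf E" shows "hori E x = 0 \<longleftrightarrow> E x \<in> vertical x"
  using vert_field_vertical[OF splitting(1)[OF assms(2)] assms(1)] ver_vertical[OF assms(1), of E]
  by (auto simp: hori_apply)

lemma D_split_right:
  assumes "vf Z" "vf E" "x \<in> S" shows "D Z E x = D Z (ver E) x + D Z (hori E) x"
proof -
  note s = vert_field_vf[OF splitting(1)[OF assms(2)]] hor_field_vf[OF splitting(2)[OF assms(2)]]
  have "D Z E x = D Z (ver E + hori E) x"
    by (rule D_cong[OF assms(1,2) refl _ assms(3)]) (simp only: plus_fun_apply splitting_sum[symmetric])
  then show ?thesis by (simp only: D_add_right[OF assms(1) s assms(3)])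
qed

lemma D_split_left:
  assumes "vf Z" "vf E" "x \<in> S" shows "D E Z x = D (ver E) Z x + D (hori E) Z x"
proof -
  note s = vert_field_vf[OF splitting(1)[OF assms(2)]] hor_field_vf[OF splitting(2)[OF assms(2)]]
  have "D E Z x = D (ver E + hori E) Z x"
    by (rule D_cong[OF assms(2,1) _ refl assms(3)]) (simp only: plus_fun_apply splitting_sum[symmetric])
  then show ?thesis by (simp only: D_add_left[OF s assms(1,3)])
qed

lemma g_ver_right: "vf E \<Longrightarrow> vert_field V \<Longrightarrow> x \<in> S \<Longrightarrow> g x (V x) (ver E x) = g x (V x) (E x)"
  using g_ver g_sym[OF vf_tangent vf_tangent] vert_field_vf splitting(1) by metis

lemma g_hori_right: "vf E \<Longrightarrow> hor_field X \<Longrightarrow> x \<in> S \<Longrightarrow> g x (X x) (hori E x) = g x (X x) (E x)"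
  using g_hori g_sym[OF vf_tangent vf_tangent] hor_field_vf splitting(2) by metis

text \<open>Differentiate \<open>g(V,X) = 0\<close>.\<close>

lemma D_perp:
  assumes "vf Z" "vert_field V" "hor_field X" "x \<in> S"
  shows "g x (D Z V x) (X x) = - g x (D Z X x) (V x)"
proof -
  note t = vf_tangent[OF _ assms(4)]
  note f = vert_field_vf[OF assms(2)] hor_field_vf[OF assms(3)]
  have "Z x (\<lambda>y. g y (V y) (X y)) = Z x (\<lambda>y. 0)"
    by (rule tangent_cong[OF atlas t[OF assms(1)] open_S assms(4)]) (rule g_vH[OF assms(2,3)])
  then show ?thesis
    using D_metric[OF assms(1) f assms(4)] tangent_const[OF atlas t[OF assms(1)], of 0]
      g_sym[OF t[OF f(1)] t[OF vf_D[OF assms(1) f(2)]]] by simp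
qed

text \<open>This is where the dimension of the leaves enters: two coordinate directions of the leaf always
  combine to a nonzero vector orthogonal to \<open>v\<close>.\<close>

lemma orthogonal_vertical:
  assumes "card L \<ge> 2" "x \<in> S" "v \<in> vertical x"
  obtains W where "vert_field W" "W x \<noteq> 0" "g x v (W x) = 0"
proof -
  obtain l k where lk: "l \<in> L" "k \<in> L" "l \<noteq> k"
    using assms(1) card_le_Suc0_iff_eq[of L] finite_subset[OF L_Basis finite_Basis] by fastforce
  interpret lin: linear "chart_deriv A (U, \<phi>) x" by (rule chart.linear_chart_deriv[OF in_U[OF assms(2)]])
  let ?a = "g x v (coord l x)" and ?b = "g x v (coord k x)"
  have sp: "vert_field (coord w)" if "w \<in> span L" for w by (rule vert_field_coord[OF that])
  show ?thesis
  proof (cases "?a = 0")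
    case True
    have "l \<noteq> 0" using lk(1) L_Basis by auto
    then show ?thesis
      using True coord_eq_0_iff[OF in_U[OF assms(2)]] by (intro that[OF sp[OF span_base[OF lk(1)]]]) auto
  next
    case False
    \<comment> \<open>The rotated pair of coefficients, orthogonal to \<open>v\<close> by construction.\<close>
    let ?w = "?b *\<^sub>R l - ?a *\<^sub>R k"
    have w: "?w \<in> span L" by (intro span_diff span_scale span_base lk)
    have "l \<bullet> k = 0" "k \<bullet> k = 1" using lk L_Basis by (auto simp: inner_Basis subset_iff)
    then have "?w \<bullet> k = - ?a" by (simp add: inner_diff_left)
    then have "?w \<noteq> 0" using False by auto
    then have "coord ?w x \<noteq> 0" using coord_eq_0_iff[OF in_U[OF assms(2)]] by simp
    moreover have "g x v (coord ?w x) = 0"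
      using vertical_tangent[OF assms(3)] chart.chart_deriv_in_tangent_space[OF in_U[OF assms(2)]]
      by (simp add: lin.diff lin.scale g_bilinear)
    ultimately show ?thesis by (intro that[OF sp[OF w]])
  qed
qed

end

section \<open>Umbilical leaves\<close>

locale umbilic_on = foliated_on A g D S L F U \<phi>
  for A :: "('a::{t2_space, second_countable_topology}, 'e::euclidean_space) chart set"
    and g :: "'a metric" and D :: "'a connection" and S :: "'a set"
    and L :: "'e set" and F :: "('a, 'e) chart set" and U :: "'a set" and \<phi> :: "'a \<Rightarrow> 'e" +
  assumes bundle_like: "bundle_like A g L F" and umbilical: "totally_umbilical A g D L F"
    and space_form: "constant_curvature A g D" and dim: "card L \<ge> 2"
begin

abbreviation \<tau> :: "'a vfield" where "\<tau> \<equiv> mean_curvature A g D L F"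

text \<open>The umbilicity condition becomes \<open>T\<^sub>U V = g(U,V) H\<close> with this normalisation.\<close>

definition H :: "'a vfield" where
  "H = (\<lambda>x. (1 / real (card L)) *\<^sub>R \<tau> x)"

lemma tau_eq: "\<tau> x = real (card L) *\<^sub>R H x"
  using dim by (simp add: H_def)

text \<open>On vertical arguments the tensor \<open>T\<close> is the horizontal part of the derivative; its other summand is the
  derivative of a field that vanishes on \<open>S\<close>.\<close>

lemma umbilic_hori:
  assumes V: "vert_field V" and W: "vert_field W" and x: "x \<in> S"
  shows "hori (D V W) x = g x (V x) (W x) *\<^sub>R H x"
proof -
  note Vf = vert_field_vf[OF V] and Wf = vert_field_vf[OF W]
  have v: "ver V y = V y" "ver W y = W y" if "y \<in> S" for y
    using ver_vertical[OF that] vert_field_vertical V W that by auto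
  have vf: "vf (ver V)" "vf (ver W)" "vf (hori W)"
    using splitting[OF Vf] splitting[OF Wf] by (auto intro: vert_field_vf hor_field_vf)
  have h0: "hori W y = 0" if "y \<in> S" for y using v[OF that] by (simp add: hori_apply)
  have "D (ver V) (hori W) x = D V (\<lambda>y. 0 *\<^sub>R W y) x"
    by (rule D_cong[OF vf(1,3) v(1) _ x]) (simp_all only: h0 scaleR_zero_left)
  also have "\<dots> = 0 *\<^sub>R D V W x" by (rule D_cscale_right[OF Vf Wf x])
  also have "\<dots> = 0" by (rule scaleR_zero_left)
  finally have "ver (D (ver V) (hori W)) x = 0"
    using ver_vertical[OF x, of "D (ver V) (hori W)"] vertical_closed(1)[OF in_U[OF x]] by simp
  moreover have "hori (D (ver V) (ver W)) x = hori (D V W) x"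
    by (rule hori_cong, rule D_cong[OF vf(1,2) v x])
  moreover have "oneill_T A g D L F V W x = (g x (V x) (W x) / real (card L)) *\<^sub>R \<tau> x"
    using umbilical open_S V W x unfolding totally_umbilical_def by blast
  ultimately show ?thesis
    unfolding oneill_T_def by (simp add: plus_fun_apply[of "ver (D (ver V) (hori W))"] H_def)
qed

text \<open>The mean curvature is defined at each point by a frame chosen there, so its smoothness is not
  immediate. By umbilicity it can be read off from one nowhere vanishing vertical field \<open>V\<close>, as
  \<open>H = T\<^sub>V V / |V|\<^sup>2\<close>.\<close>

lemma hor_field_H: "hor_field H"
proof -
  obtain l where l: "l \<in> L" using dim by (metis card.empty ex_in_conv not_numeral_le_zero)
  let ?V = "coord l"
  have V: "vert_field ?V" by (rule vert_field_coord[OF span_base[OF l]])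
  have "l \<noteq> 0" using l L_Basis by auto
  then have nz: "g x (?V x) (?V x) \<noteq> 0" if "x \<in> S" for x
    using coord_eq_0_iff[OF in_U[OF that]] g_eq_0_iff[OF vf_tangent[OF vf_coord that]] by simp
  let ?f = "\<lambda>x. inverse (g x (?V x) (?V x))"
  have f: "sm ?f" by (rule smooth_fun_inverse[OF atlas open_S sm_g[OF vf_coord vf_coord] nz])
  have h: "hor_field (\<lambda>x. ?f x *\<^sub>R hori (D ?V ?V) x)"
    by (rule hor_field_scale[OF splitting(2)[OF vf_D[OF vf_coord vf_coord]] f])
  have eq: "?f x *\<^sub>R hori (D ?V ?V) x = H x" if x: "x \<in> S" for x
    using nz[OF x] by (simp add: umbilic_hori[OF V V x])
  have "vf H" by (rule vector_field_cong[OF atlas hor_field_vf[OF h] eq])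
  then show ?thesis using h eq by (simp add: horizontal_field_def)
qed

lemmas vf_H = hor_field_vf[OF hor_field_H]

text \<open>Second fundamental form and shape operator of the leaves.\<close>

lemma D_vert_vert:
  assumes "vert_field V" "vert_field W" "hor_field X" "x \<in> S"
  shows "g x (D V W x) (X x) = g x (V x) (W x) * g x (H x) (X x)"
proof -
  have "g x (D V W x) (X x) = g x (hori (D V W) x) (X x)"
    by (rule g_hori[OF vf_D[OF vert_field_vf[OF assms(1)] vert_field_vf[OF assms(2)]] assms(3,4), symmetric])
  then show ?thesis
    by (simp only: umbilic_hori[OF assms(1,2,4)] g_scale(1)[OF vf_tangent[OF vf_H assms(4)]
        vf_tangent[OF hor_field_vf[OF assms(3)] assms(4)]])
qed

lemma D_vert_hori:
  assumes "vert_field V" "hor_field X" "vert_field W" "x \<in> S"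
  shows "g x (D V X x) (W x) = - (g x (V x) (W x) * g x (H x) (X x))"
  using D_perp[OF vert_field_vf[OF assms(1)] assms(3,2,4)] D_vert_vert[OF assms(1,3,2,4)] by simp

lemma D_hori_hori:
  assumes X: "hor_field X" and Y: "hor_field Y" and V: "vert_field V" and x: "x \<in> S"
  shows "g x (D X Y x) (V x) = - g x (D Y X x) (V x)"
proof -
  note f = hor_field_vf[OF X] hor_field_vf[OF Y] and t = vf_tangent[OF _ x]
  note XY = hor_field_add[OF X Y]
  have "D (X + Y) (X + Y) x = (D X X x + D X Y x) + (D Y X x + D Y Y x)"
    by (simp only: D_add_left[OF f vf_add[OF f] x] D_add_right[OF f(1) f x] D_add_right[OF f(2) f x])
  then have "g x (V x) (D X Y x) + g x (V x) (D Y X x) = 0"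
    using horizontal_D_self[OF bundle_like XY V x] horizontal_D_self[OF bundle_like X V x]
      horizontal_D_self[OF bundle_like Y V x] f t[OF vert_field_vf[OF V]] by (simp add: g_bilinear t vf_D)
  then show ?thesis
    using g_sym[OF t[OF vert_field_vf[OF V]] t[OF vf_D[OF f]]] g_sym[OF t[OF vert_field_vf[OF V]] t[OF vf_D[OF f(2,1)]]] by simp
qed

lemma hor_field_D_self: "hor_field X \<Longrightarrow> hor_field (D X X)"
  by (rule hor_fieldI[OF vf_D]) (auto intro: hor_field_vf horizontal_D_self[OF bundle_like])

section \<open>The mean curvature is parallel along the leaves\<close>

text \<open>The derivative \<open>D\<^sub>W W'\<close> is split into its vertical part and \<open>g(W,W') H\<close> before it is differentiated
  again; the next lemma does the same when it is the direction of differentiation.\<close>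

lemma D_vert_D_vert_vert:
  assumes V: "vert_field V" and W: "vert_field W" and W': "vert_field W'" and X: "hor_field X" and x: "x \<in> S"
  shows "g x (D V (D W W') x) (X x) = g x (V x) (D W W' x) * g x (H x) (X x)
    + V x (\<lambda>y. g y (W y) (W' y)) * g x (H x) (X x) + g x (W x) (W' x) * g x (D V H x) (X x)"
proof -
  note t = vf_tangent[OF _ x]
  note Vf = vert_field_vf[OF V] and Wf = vert_field_vf[OF W] and Wf' = vert_field_vf[OF W'] and Xf = hor_field_vf[OF X]
  let ?E = "D W W'" and ?f = "\<lambda>y. g y (W y) (W' y)"
  have E: "vf ?E" by (rule vf_D[OF Wf Wf'])
  have "D V (hori ?E) x = D V (\<lambda>y. ?f y *\<^sub>R H y) x"
    by (rule D_cong[OF Vf hor_field_vf[OF splitting(2)[OF E]] refl umbilic_hori[OF W W'] x])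
  also have "\<dots> = V x ?f *\<^sub>R H x + ?f x *\<^sub>R D V H x"
    by (rule D_scale_right[OF Vf vf_H sm_g[OF Wf Wf'] x])
  finally have "D V ?E x = D V (ver ?E) x + (V x ?f *\<^sub>R H x + ?f x *\<^sub>R D V H x)"
    by (simp only: D_split_right[OF Vf E x])
  moreover have "g x (D V (ver ?E) x) (X x) = g x (V x) (?E x) * g x (H x) (X x)"
    by (simp only: D_vert_vert[OF V splitting(1)[OF E] X x] g_ver_right[OF E V x])
  ultimately show ?thesis
    using t[OF Xf] t[OF vf_H] t[OF vf_D[OF Vf vf_H]] t[OF vf_D[OF Vf vert_field_vf[OF splitting(1)[OF E]]]]
    by (simp add: g_bilinear)
qed

lemma D_D_vert_vert:
  assumes V: "vert_field V" and W: "vert_field W" and Z: "vert_field Z" and X: "hor_field X" and x: "x \<in> S"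
  shows "g x (D (D V W) Z x) (X x) = g x (D V W x) (Z x) * g x (H x) (X x)
    + g x (V x) (W x) * g x (D H Z x) (X x)"
proof -
  note t = vf_tangent[OF _ x]
  note Vf = vert_field_vf[OF V] and Wf = vert_field_vf[OF W] and Zf = vert_field_vf[OF Z] and Xf = hor_field_vf[OF X]
  let ?E = "D V W" and ?f = "\<lambda>y. g y (V y) (W y)"
  have E: "vf ?E" by (rule vf_D[OF Vf Wf])
  have "D (hori ?E) Z x = D (\<lambda>y. ?f y *\<^sub>R H y) Z x"
    by (rule D_cong[OF hor_field_vf[OF splitting(2)[OF E]] Zf umbilic_hori[OF V W] refl x])
  also have "\<dots> = ?f x *\<^sub>R D H Z x"
    by (rule D_scale_left[OF vf_H Zf sm_g[OF Vf Wf] x])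
  finally have "D ?E Z x = D (ver ?E) Z x + ?f x *\<^sub>R D H Z x"
    by (simp only: D_split_left[OF Zf E x])
  moreover have "g x (D (ver ?E) Z x) (X x) = g x (?E x) (Z x) * g x (H x) (X x)"
    by (simp only: D_vert_vert[OF splitting(1)[OF E] Z X x] g_ver[OF E Z x])
  ultimately show ?thesis
    using t[OF Xf] t[OF vf_D[OF vf_H Zf]] t[OF vf_D[OF vert_field_vf[OF splitting(1)[OF E]] Zf]]
    by (simp add: g_bilinear)
qed

text \<open>The Codazzi equation of an umbilical leaf. All terms that contain \<open>g(H,X)\<close> cancel.\<close>

lemma codazzi_vertical:
  assumes V: "vert_field V" and W: "vert_field W" and X: "hor_field X" and x: "x \<in> S"
  shows "R4 x V W W X = g x (W x) (W x) * g x (D V H x) (X x) - g x (V x) (W x) * g x (D W H x) (X x)"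
proof -
  note t = vf_tangent[OF _ x]
  note Vf = vert_field_vf[OF V] and Wf = vert_field_vf[OF W] and Xf = hor_field_vf[OF X]
  have s: "g x (W x) (D V W x) = g x (D V W x) (W x)"
    by (rule g_sym[OF t[OF Wf] t[OF vf_D[OF Vf Wf]]])
  show ?thesis
    unfolding R4_expand[OF Vf Wf Wf Xf x] D_vert_D_vert_vert[OF V W W X x] D_vert_D_vert_vert[OF W V W X x]
      D_D_vert_vert[OF V W W X x] D_D_vert_vert[OF W V W X x]
      D_metric[OF Vf Wf Wf x] D_metric[OF Wf Vf Wf x]
      g_sym[OF t[OF Wf] t[OF Vf]]
    using s by (simp add: algebra_simps)
qed

text \<open>The Codazzi component vanishes for constant curvature. It is evaluated with a vertical field \<open>W\<close> that is
  orthogonal to \<open>V\<close> and nonzero at the given point.\<close>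

lemma D_vert_H_vertical:
  assumes V: "vert_field V" and x: "x \<in> S"
  shows "D V H x \<in> vertical x"
proof -
  note t = vf_tangent[OF _ x]
  obtain c where c: "\<And>X Y Z W x. vf X \<Longrightarrow> vf Y \<Longrightarrow> vf Z \<Longrightarrow> vf W \<Longrightarrow> x \<in> S \<Longrightarrow>
    R4 x X Y Z W = c * (g x (Y x) (Z x) * g x (X x) (W x) - g x (X x) (Z x) * g x (Y x) (W x))"
    by (rule constant_curvature_R4[OF space_form]) (rule that)
  obtain W where W: "vert_field W" "W x \<noteq> 0" "g x (V x) (W x) = 0"
    by (rule orthogonal_vertical[OF dim x vert_field_vertical[OF V x]])
  note Vf = vert_field_vf[OF V] and Wf = vert_field_vf[OF W(1)]
  let ?E = "D V H"
  have E: "vf ?E" by (rule vf_D[OF Vf vf_H])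
  have "g x (hori ?E x) (X x) = 0" if X: "hor_field X" for X
  proof -
    have "R4 x V W W X = 0"
      unfolding c[OF Vf Wf Wf hor_field_vf[OF X] x] g_vH[OF V X x] g_vH[OF W(1) X x] by simp
    then have "g x (W x) (W x) * g x (?E x) (X x) = 0"
      using codazzi_vertical[OF V W(1) X x] W(3) by simp
    then show ?thesis
      using g_eq_0_iff[OF t[OF Wf]] W(2) g_hori[OF E X x] by simp
  qed
  then have "hori ?E x = 0" by (rule hor_field_eq_0I[OF splitting(2)[OF E] x])
  then show ?thesis using hori_eq_0_iff[OF x E] by simp
qed

section \<open>The integrability tensor is conformal on the leaves\<close>

lemma ver_D_vert_hori:
  assumes V: "vert_field V" and X: "hor_field X" and x: "x \<in> S"
  shows "ver (D V X) x = (- g x (H x) (X x)) *\<^sub>R V x"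
proof -
  note Vf = vert_field_vf[OF V] and Xf = hor_field_vf[OF X] and t = vf_tangent[OF _ x]
  let ?E = "D V X" and ?f = "\<lambda>y. g y (H y) (X y)"
  let ?Z = "ver ?E + (\<lambda>y. ?f y *\<^sub>R V y)"
  have E: "vf ?E" by (rule vf_D[OF Vf Xf])
  have fV: "vert_field (\<lambda>y. ?f y *\<^sub>R V y)" by (rule vert_field_scale[OF V sm_g[OF vf_H Xf]])
  have Z: "vert_field ?Z" by (rule vert_field_add[OF splitting(1)[OF E] fV])
  have Zx: "?Z x = ver ?E x + ?f x *\<^sub>R V x" by (rule plus_fun_apply)
  have "?Z x = 0"
  proof (rule vert_field_eq_0I[OF Z x])
    fix W assume W: "vert_field W"
    note tt = t[OF vert_field_vf[OF W]] t[OF Vf] t[OF vert_field_vf[OF fV]] t[OF vert_field_vf[OF splitting(1)[OF E]]]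
    have "g x (?Z x) (W x) = g x (ver ?E x) (W x) + ?f x * g x (V x) (W x)"
      unfolding Zx using tt by (simp add: g_bilinear)
    also have "\<dots> = 0" unfolding g_ver[OF E W x] D_vert_hori[OF V X W x] by simp
    finally show "g x (?Z x) (W x) = 0" .
  qed
  then have "ver ?E x = - (?f x *\<^sub>R V x)" unfolding Zx by (rule eq_neg_iff_add_eq_0[THEN iffD2])
  then show ?thesis by simp
qed

text \<open>The fields \<open>D\<^sub>V X\<close> and \<open>D\<^sub>X V\<close> are split into vertical and horizontal parts; the vertical part of \<open>D\<^sub>V X\<close>
  is \<open>- g(H,X) V\<close>, and \<open>D\<^sub>X X\<close> is horizontal. The terms with \<open>g(D\<^sub>X V, W)\<close> and with the horizontal part
  of \<open>D\<^sub>V X\<close> cancel.\<close>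

lemma R4_mixed:
  assumes X: "hor_field X" and V: "vert_field V" and W: "vert_field W" and x: "x \<in> S"
  shows "R4 x X V X W = g x (V x) (W x) * (X x (\<lambda>y. - g y (H y) (X y)) + g x (H x) (D X X x)
    + (g x (H x) (X x))\<^sup>2) - g x (hori (D X V) x) (hori (D X W) x)"
proof -
  note t = vf_tangent[OF _ x]
  note Vf = vert_field_vf[OF V] and Wf = vert_field_vf[OF W] and Xf = hor_field_vf[OF X]
  let ?h = "g x (H x) (X x)" and ?f = "\<lambda>y. - g y (H y) (X y)"
  let ?VX = "D V X" and ?XV = "D X V" and ?J = "hori (D X V)" and ?P = "hori (D V X)"
  have VX: "vf ?VX" and XV: "vf ?XV" and XW: "vf (D X W)"
    using vf_D Vf Xf Wf by auto
  have P: "hor_field ?P" and J: "hor_field ?J" and N: "vert_field (ver ?XV)" and M: "vert_field (ver ?VX)"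
    using splitting VX XV by auto
  have f: "sm ?f"
    using smooth_fun_diff[OF atlas open_S sm_const[of 0] sm_g[OF vf_H Xf]] by simp
  have sX: "g x (D X Q x) (W x) = - g x (D X W x) (Q x)" if "hor_field Q" for Q
    using D_perp[OF Xf W that x] by simp
  have sP: "g x (D Q X x) (W x) = g x (D X W x) (Q x)" if "hor_field Q" for Q
    using D_hori_hori[OF that X W x] sX[OF that] by simp
  have "D X (ver ?VX) x = D X (\<lambda>y. ?f y *\<^sub>R V y) x"
    by (rule D_cong[OF Xf vert_field_vf[OF M] refl ver_D_vert_hori[OF V X] x])
  then have "D X ?VX x = (X x ?f *\<^sub>R V x + ?f x *\<^sub>R D X V x) + D X ?P x"
    by (simp only: D_split_right[OF Xf VX x] D_scale_right[OF Xf Vf f x])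
  then have 1: "g x (D X ?VX x) (W x) = X x ?f * g x (V x) (W x) - ?h * g x (?XV x) (W x)
      - g x (D X W x) (?P x)"
    using sX[OF P] t[OF Vf] t[OF Wf] t[OF XV] t[OF vf_D[OF Xf hor_field_vf[OF P]]] by (simp add: g_bilinear)
  have 2: "g x (D V (D X X) x) (W x) = - (g x (V x) (W x) * g x (H x) (D X X x))"
    by (rule D_vert_hori[OF V hor_field_D_self[OF X] W x])
  have 3: "g x (D ?XV X x) (W x) = g x (D X W x) (?J x) - g x (?XV x) (W x) * ?h"
    unfolding D_split_left[OF Xf XV x]
    using sP[OF J] D_vert_hori[OF N X W x] g_ver[OF XV W x] t[OF Wf]
      t[OF vf_D[OF vert_field_vf[OF N] Xf]] t[OF vf_D[OF hor_field_vf[OF J] Xf]] by (simp add: g_bilinear)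
  have "D (ver ?VX) X x = D (\<lambda>y. ?f y *\<^sub>R V y) X x"
    by (rule D_cong[OF vert_field_vf[OF M] Xf ver_D_vert_hori[OF V X] refl x])
  then have "D ?VX X x = ?f x *\<^sub>R ?VX x + D ?P X x"
    by (simp only: D_split_left[OF Xf VX x] D_scale_left[OF Vf Xf f x])
  then have 4: "g x (D ?VX X x) (W x) = ?h * ?h * g x (V x) (W x) + g x (D X W x) (?P x)"
    using sP[OF P] D_vert_hori[OF V X W x] t[OF Wf] t[OF VX] t[OF vf_D[OF hor_field_vf[OF P] Xf]]
    by (simp add: g_bilinear)
  have 5: "g x (D X W x) (?J x) = g x (?J x) (hori (D X W) x)"
    using g_hori[OF XW J x] g_sym[OF t[OF hor_field_vf[OF J]] t[OF hor_field_vf[OF splitting(2)[OF XW]]]] by simp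
  show ?thesis
    unfolding R4_expand[OF Xf Vf Xf Wf x] 1 2 3 4 5 by (simp add: algebra_simps power2_eq_square)
qed

text \<open>For constant curvature the mixed component is a multiple of \<open>g(V,W)\<close>, hence so is the remaining
  term, the inner product of \<open>A\<^sub>X V\<close> and \<open>A\<^sub>X W\<close>.\<close>

lemma conformal:
  assumes X: "hor_field X"
  obtains \<mu> where "sm \<mu>" "\<And>V W x. vert_field V \<Longrightarrow> vert_field W \<Longrightarrow> x \<in> S \<Longrightarrow>
    g x (hori (D X V) x) (hori (D X W) x) = \<mu> x * g x (V x) (W x)"
proof -
  obtain c where c: "\<And>X Y Z W x. vf X \<Longrightarrow> vf Y \<Longrightarrow> vf Z \<Longrightarrow> vf W \<Longrightarrow> x \<in> S \<Longrightarrow>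
    R4 x X Y Z W = c * (g x (Y x) (Z x) * g x (X x) (W x) - g x (X x) (Z x) * g x (Y x) (W x))"
    by (rule constant_curvature_R4[OF space_form]) (rule that)
  note Xf = hor_field_vf[OF X]
  let ?m = "\<lambda>x. X x (\<lambda>y. - g y (H y) (X y)) + g x (H x) (D X X x) + (g x (H x) (X x))\<^sup>2"
  let ?l = "\<lambda>x. ?m x + c * g x (X x) (X x)"
  have f: "sm (\<lambda>y. - g y (H y) (X y))"
    using smooth_fun_diff[OF atlas open_S sm_const[of 0] sm_g[OF vf_H Xf]] by simp
  have "sm ?l"
    unfolding power2_eq_square
    by (intro smooth_fun_add[OF atlas open_S] smooth_fun_mult[OF atlas open_S] sm_const
        sm_deriv[OF Xf f] sm_g vf_H Xf vf_D)
  moreover have "g x (hori (D X V) x) (hori (D X W) x) = ?l x * g x (V x) (W x)"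
    if V: "vert_field V" and W: "vert_field W" and x: "x \<in> S" for V W x
  proof -
    have "R4 x X V X W = - (c * (g x (X x) (X x) * g x (V x) (W x)))"
      unfolding c[OF Xf vert_field_vf[OF V] Xf vert_field_vf[OF W] x] g_Hv[OF W X x] by simp
    then show ?thesis unfolding R4_mixed[OF X V W x] by (simp add: algebra_simps)
  qed
  ultimately show ?thesis by (rule that)
qed

lemma conformal_polarised:
  assumes X: "hor_field X" and Y: "hor_field Y" and V: "vert_field V" and W: "vert_field W" and x: "x \<in> S"
    and VW: "g x (V x) (W x) = 0"
  shows "g x (hori (D X V) x) (hori (D Y W) x) + g x (hori (D Y V) x) (hori (D X W) x) = 0"
proof -
  note f = hor_field_vf[OF X] hor_field_vf[OF Y]
  have 0: "g x (hori (D Z V) x) (hori (D Z W) x) = 0" if Z: "hor_field Z" for Z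
  proof -
    obtain \<mu> where "\<And>V W x. vert_field V \<Longrightarrow> vert_field W \<Longrightarrow> x \<in> S \<Longrightarrow>
      g x (hori (D Z V) x) (hori (D Z W) x) = \<mu> x * g x (V x) (W x)"
      by (rule conformal[OF Z]) (rule that)
    from this[OF V W x] show ?thesis by (simp add: VW)
  qed
  have a: "hori (D (X + Y) E) x = hori (D X E) x + hori (D Y E) x" if E: "vf E" for E
  proof -
    have "hori (D (X + Y) E) x = hori (D X E + D Y E) x"
      by (rule hori_cong) (simp only: plus_fun_apply[of "D X E"] D_add_left[OF f E x])
    then show ?thesis by (simp only: hori_add[OF vf_D[OF f(1) E] vf_D[OF f(2) E] x])
  qed
  have h: "hori (D Z E) x \<in> tangent_space A x" if "vf Z" "vf E" for Z E
    by (rule vf_tangent[OF hor_field_vf[OF splitting(2)[OF vf_D[OF that]]] x])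
  show ?thesis
    using 0[OF hor_field_add[OF X Y]] 0[OF X] 0[OF Y] vert_field_vf[OF V] vert_field_vf[OF W] f
    by (simp add: a g_bilinear h)
qed

section \<open>Horizontal derivatives of the integrability tensor\<close>

text \<open>This is \<open>g((D\<^sub>X A)\<^sub>Y Z, V)\<close>, the covariant derivative of \<open>A\<close> on horizontal arguments, for which
  \<open>A\<^sub>Y Z\<close> is the vertical part of \<open>D\<^sub>Y Z\<close>.\<close>

definition nabla_A :: "'a \<Rightarrow> 'a vfield \<Rightarrow> 'a vfield \<Rightarrow> 'a vfield \<Rightarrow> 'a vfield \<Rightarrow> real" where
  "nabla_A x V X Y Z = g x (D X (ver (D Y Z)) x) (V x) - g x (D (hori (D X Y)) Z x) (V x)
    - g x (D Y (hori (D X Z)) x) (V x)"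

lemma ver_D_hori_hori:
  assumes X: "hor_field X" and Y: "hor_field Y" and x: "x \<in> S"
  shows "ver (D X Y) x = (-1) *\<^sub>R ver (D Y X) x"
proof -
  note f = hor_field_vf[OF X] hor_field_vf[OF Y] and t = vf_tangent[OF _ x]
  let ?Z = "ver (D X Y) + ver (D Y X)"
  note s = splitting(1)[OF vf_D[OF f]] splitting(1)[OF vf_D[OF f(2,1)]]
  have Zx: "?Z x = ver (D X Y) x + ver (D Y X) x" by (rule plus_fun_apply)
  have "?Z x = 0"
  proof (rule vert_field_eq_0I[OF vert_field_add[OF s] x])
    fix W assume W: "vert_field W"
    show "g x (?Z x) (W x) = 0"
      unfolding Zx using t[OF vert_field_vf[OF s(1)]] t[OF vert_field_vf[OF s(2)]] t[OF vert_field_vf[OF W]]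
        g_ver[OF vf_D[OF f] W x] g_ver[OF vf_D[OF f(2,1)] W x] D_hori_hori[OF X Y W x]
      by (simp add: g_bilinear)
  qed
  then have "ver (D X Y) x = - ver (D Y X) x" unfolding Zx by (rule eq_neg_iff_add_eq_0[THEN iffD2])
  then show ?thesis by simp
qed

lemma nabla_A_skew:
  assumes X: "hor_field X" and Y: "hor_field Y" and Z: "hor_field Z" and V: "vert_field V" and x: "x \<in> S"
  shows "nabla_A x V X Y Z = - nabla_A x V X Z Y"
proof -
  note f = hor_field_vf[OF X] hor_field_vf[OF Y] hor_field_vf[OF Z] and t = vf_tangent[OF _ x]
  have vZY: "vf (ver (D Z Y))" and vYZ: "vf (ver (D Y Z))"
    using vert_field_vf[OF splitting(1)[OF vf_D]] f by auto
  have "D X (ver (D Y Z)) x = D X (\<lambda>y. (-1) *\<^sub>R ver (D Z Y) y) x"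
    by (rule D_cong[OF f(1) vYZ refl ver_D_hori_hori[OF Y Z] x])
  then have "g x (D X (ver (D Y Z)) x) (V x) = - g x (D X (ver (D Z Y)) x) (V x)"
    using t[OF vf_D[OF f(1) vZY]] t[OF vert_field_vf[OF V]]
    by (simp only: D_cscale_right[OF f(1) vZY x] g_scale(1) mult_minus1)
  then show ?thesis
    unfolding nabla_A_def
    using D_hori_hori[OF splitting(2)[OF vf_D[OF f(1,2)]] Z V x]
      D_hori_hori[OF splitting(2)[OF vf_D[OF f(1,3)]] Y V x] by simp
qed

text \<open>The component \<open>g(R(X,Y)Z, V)\<close>, which vanishes for constant curvature. The right-hand side comes from
  the vertical part of \<open>[X,Y]\<close>, which differentiates \<open>Z\<close> by the shape operator of the leaf.\<close>

lemma nabla_A_codazzi: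
  assumes X: "hor_field X" and Y: "hor_field Y" and Z: "hor_field Z" and V: "vert_field V" and x: "x \<in> S"
  shows "nabla_A x V X Y Z - nabla_A x V Y X Z = - 2 * g x (H x) (Z x) * g x (D X Y x) (V x)"
proof -
  obtain c where c: "\<And>X Y Z W x. vf X \<Longrightarrow> vf Y \<Longrightarrow> vf Z \<Longrightarrow> vf W \<Longrightarrow> x \<in> S \<Longrightarrow>
    R4 x X Y Z W = c * (g x (Y x) (Z x) * g x (X x) (W x) - g x (X x) (Z x) * g x (Y x) (W x))"
    by (rule constant_curvature_R4[OF space_form]) (rule that)
  note f = hor_field_vf[OF X] hor_field_vf[OF Y] hor_field_vf[OF Z] vert_field_vf[OF V] and t = vf_tangent[OF _ x]
  have s1: "g x (D P (D Q Z) x) (V x) = g x (D P (ver (D Q Z)) x) (V x) + g x (D P (hori (D Q Z)) x) (V x)"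
    if "vf P" "vf Q" for P Q
    unfolding D_split_right[OF that(1) vf_D[OF that(2) f(3)] x]
    using that f splitting[OF vf_D[OF that(2) f(3)]] by (intro g_add t vf_D) (auto intro: vert_field_vf hor_field_vf)
  have s2: "g x (D (D P Q) Z x) (V x) = g x (D (hori (D P Q)) Z x) (V x)
      - g x (D P Q x) (V x) * g x (H x) (Z x)" if "vf P" "vf Q" for P Q
  proof -
    note s = splitting[OF vf_D[OF that]]
    have "g x (D (D P Q) Z x) (V x) = g x (D (ver (D P Q)) Z x) (V x) + g x (D (hori (D P Q)) Z x) (V x)"
      unfolding D_split_left[OF f(3) vf_D[OF that] x]
      using s f by (intro g_add t vf_D) (auto intro: vert_field_vf hor_field_vf)
    then show ?thesis
      using D_vert_hori[OF s(1) Z V x] g_ver[OF vf_D[OF that] V x] by simp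
  qed
  have "R4 x X Y Z V = 0"
    unfolding c[OF f x] g_Hv[OF V X x] g_Hv[OF V Y x] by simp
  then show ?thesis
    unfolding R4_expand[OF f x] s1[OF f(1,2)] s1[OF f(2,1)] s2[OF f(1,2)] s2[OF f(2,1)] nabla_A_def
    using D_hori_hori[OF X Y V x] by (simp add: algebra_simps)
qed

text \<open>Three cyclic instances of the Codazzi identity, with the skew symmetry in the last two arguments,
  form a linear system for the derivative of \<open>A\<close>, in the same way in which metric compatibility and
  vanishing torsion determine a connection.\<close>

lemma nabla_A_formula:
  assumes X: "hor_field X" and Y: "hor_field Y" and Z: "hor_field Z" and V: "vert_field V" and x: "x \<in> S"
  shows "nabla_A x V Z X Y = g x (H x) (Z x) * g x (D X Y x) (V x)
    - g x (H x) (X x) * g x (D Y Z x) (V x) - g x (H x) (Y x) * g x (D Z X x) (V x)"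
  using nabla_A_codazzi[OF X Y Z V x] nabla_A_codazzi[OF Y Z X V x] nabla_A_codazzi[OF Z X Y V x]
    nabla_A_skew[OF Y X Z V x] nabla_A_skew[OF Z Y X V x] nabla_A_skew[OF X Z Y V x]
  by simp

text \<open>The function \<open>g(J\<^sub>V X, Y)\<close> agrees with \<open>g(V, A\<^sub>Y X)\<close> on \<open>S\<close>. Differentiating both expressions in the
  direction \<open>H\<close> transfers the formula for the derivative of \<open>A\<close> to \<open>J\<^sub>V X\<close>.\<close>

lemma D_H_hori_D_hori_vert:
  assumes X: "hor_field X" and Y: "hor_field Y" and V: "vert_field V" and x: "x \<in> S"
  shows "g x (D H (hori (D X V)) x) (Y x) =
    g x (D X (ver (D H V)) x) (Y x) + g x (D (hori (D H X)) V x) (Y x)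
    + g x (H x) (X x) * g x (D H V x) (Y x) - g x (H x) (Y x) * g x (D H V x) (X x)
    + g x (H x) (H x) * g x (D X V x) (Y x)"
proof -
  note Xf = hor_field_vf[OF X] and Yf = hor_field_vf[OF Y] and Vf = vert_field_vf[OF V] and t = vf_tangent[OF _ x]
  let ?J = "hori (D X V)" and ?X' = "hori (D H X)" and ?Y' = "hori (D H Y)"
    and ?N = "ver (D H V)" and ?Q = "ver (D Y X)"
  have XV: "vf (D X V)" and HV: "vf (D H V)" and HX: "vf (D H X)" and HY: "vf (D H Y)" and YX: "vf (D Y X)"
    using vf_D Xf Yf Vf vf_H by auto
  have J: "hor_field ?J" and X': "hor_field ?X'" and Y': "hor_field ?Y'" and N: "vert_field ?N" and Q: "vert_field ?Q"
    using splitting XV HX HY HV YX by auto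
  have a: "g y (D P V y) (R y) = g y (D R P y) (V y)" if "hor_field P" "hor_field R" "y \<in> S" for P R y
    using D_perp[OF hor_field_vf[OF that(1)] V that(2,3)] D_hori_hori[OF that(1,2) V that(3)] by simp
  have "H x (\<lambda>y. g y (?J y) (Y y)) = H x (\<lambda>y. g y (V y) (?Q y))"
  proof (rule tangent_cong[OF atlas t[OF vf_H] open_S x])
    fix y assume y: "y \<in> S"
    show "g y (?J y) (Y y) = g y (V y) (?Q y)"
      unfolding g_hori[OF XV Y y] g_ver_right[OF YX V y] a[OF X Y y]
      by (rule g_sym[OF vf_tangent[OF YX y] vf_tangent[OF Vf y]])
  qed
  then have "g x (D H ?J x) (Y x) = g x (D H V x) (?Q x) + g x (V x) (D H ?Q x) - g x (?J x) (D H Y x)"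
    using D_metric[OF vf_H hor_field_vf[OF J] Yf x] D_metric[OF vf_H Vf vert_field_vf[OF Q] x] by simp
  moreover have "g x (V x) (D H ?Q x) = nabla_A x V H Y X + g x (D ?Y' X x) (V x) + g x (D Y ?X' x) (V x)"
    unfolding nabla_A_def using g_sym[OF t[OF Vf] t[OF vf_D[OF vf_H vert_field_vf[OF Q]]]] by simp
  moreover have "g x (D H V x) (?Q x) = g x (D X ?N x) (Y x)"
    using g_ver[OF HV Q x] g_ver_right[OF YX N x] D_perp[OF Xf N Y x] D_hori_hori[OF X Y N x]
      g_sym[OF t[OF YX] t[OF vert_field_vf[OF N]]] by simp
  moreover have "g x (D ?Y' X x) (V x) = g x (?J x) (D H Y x)"
    using a[OF X Y' x] g_hori[OF XV Y' x] g_hori_right[OF HY J x] by simp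
  moreover have "g x (D Y ?X' x) (V x) = g x (D ?X' V x) (Y x)"
    using a[OF X' Y x] by simp
  moreover have "nabla_A x V H Y X = g x (H x) (H x) * g x (D X V x) (Y x)
      - g x (H x) (Y x) * g x (D H V x) (X x) + g x (H x) (X x) * g x (D H V x) (Y x)"
    using nabla_A_formula[OF Y X hor_field_H V x] a[OF X Y x] a[OF hor_field_H X x] a[OF hor_field_H Y x] D_hori_hori[OF hor_field_H Y V x]
    by simp
  ultimately show ?thesis by simp
qed

section \<open>The integrability tensor annihilates the mean curvature\<close>

text \<open>Differentiate \<open>g(J\<^sub>V X, J\<^sub>W X) = \<mu> g(V,W)\<close> in the direction \<open>H\<close>. The derivatives of \<open>V\<close> and \<open>W\<close> cancel by
  the relation itself, those of \<open>X\<close> and the terms with \<open>g(H,X)\<close> by its polarisation, and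
  \<open>|H|\<^sup>2 g(J\<^sub>V X, J\<^sub>W X)\<close> is \<open>0\<close> at \<open>x\<close>. What remains is the stated product, twice.\<close>

lemma D_H_orthogonal_product:
  assumes X: "hor_field X" and V: "vert_field V" and W: "vert_field W" and x: "x \<in> S" and VW: "g x (V x) (W x) = 0"
  shows "g x (D H V x) (X x) * g x (D H W x) (X x) = 0"
proof -
  obtain \<mu> where l: "sm \<mu>" "\<And>V W x. vert_field V \<Longrightarrow> vert_field W \<Longrightarrow> x \<in> S \<Longrightarrow>
    g x (hori (D X V) x) (hori (D X W) x) = \<mu> x * g x (V x) (W x)"
    by (rule conformal[OF X]) (rule that)
  note Xf = hor_field_vf[OF X] and t = vf_tangent[OF _ x]
  let ?X' = "hori (D H X)"
  have X': "hor_field ?X'" by (rule splitting(2)[OF vf_D[OF vf_H Xf]])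
  have J: "hor_field (hori (D P V))" if "vf P" "vert_field V" for P V
    by (rule splitting(2)[OF vf_D[OF that(1) vert_field_vf[OF that(2)]]])
  have N: "vert_field (ver (D H V))" if "vert_field V" for V
    by (rule splitting(1)[OF vf_D[OF vf_H vert_field_vf[OF that]]])
  \<comment> \<open>One of the two terms of the product rule; the other one is obtained by exchanging \<open>V\<close> and \<open>W\<close>.\<close>
  have half: "g x (D H (hori (D X V)) x) (hori (D X W) x) =
      \<mu> x * g x (D H V x) (W x) + g x (hori (D ?X' V) x) (hori (D X W) x)
      + g x (H x) (X x) * g x (hori (D H V) x) (hori (D X W) x)
      + g x (D H W x) (X x) * g x (D H V x) (X x)"
    if V: "vert_field V" and W: "vert_field W" and VW: "g x (V x) (W x) = 0" for V W
  proof -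
    note Vf = vert_field_vf[OF V] and JW = J[OF Xf W]
    have h: "g x (D P Q x) (hori (D X W) x) = g x (hori (D P Q) x) (hori (D X W) x)"
      if "vf P" "vf Q" for P Q
      by (rule g_hori[OF vf_D[OF that] JW x, symmetric])
    have "g x (H x) (hori (D X W) x) = - g x (D H W x) (X x)"
      using g_hori_right[OF vf_D[OF Xf vert_field_vf[OF W]] hor_field_H x] g_sym[OF t[OF vf_H] t[OF vf_D[OF Xf vert_field_vf[OF W]]]]
        D_perp[OF Xf W hor_field_H x] D_hori_hori[OF X hor_field_H W x] D_perp[OF vf_H W X x] by simp
    then show ?thesis
      unfolding D_H_hori_D_hori_vert[OF X JW V x] h[OF Xf vert_field_vf[OF N[OF V]]] h[OF hor_field_vf[OF X'] Vf]
        h[OF vf_H Vf] h[OF Xf Vf] l(2)[OF V W x] l(2)[OF N[OF V] W x] g_ver[OF vf_D[OF vf_H Vf] W x] VW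
      by simp
  qed
  have sVW: "g x (W x) (V x) = 0" using g_sym[OF t[OF vert_field_vf[OF V]] t[OF vert_field_vf[OF W]]] VW by simp
  let ?k = "\<lambda>y. g y (V y) (W y)"
  have "H x (\<lambda>y. g y (hori (D X V) y) (hori (D X W) y)) = H x (\<lambda>y. \<mu> y * ?k y)"
    by (rule tangent_cong[OF atlas t[OF vf_H] open_S x]) (rule l(2)[OF V W])
  also have "\<dots> = \<mu> x * H x ?k + H x \<mu> * ?k x"
    by (rule tangent_mult[OF atlas t[OF vf_H] sm_near[OF l(1) x] sm_near_g[OF vert_field_vf[OF V] vert_field_vf[OF W] x]])
  also have "\<dots> = \<mu> x * (g x (D H V x) (W x) + g x (D H W x) (V x))"
    using D_metric[OF vf_H vert_field_vf[OF V] vert_field_vf[OF W] x]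
      g_sym[OF t[OF vert_field_vf[OF V]] t[OF vf_D[OF vf_H vert_field_vf[OF W]]]] VW by simp
  finally have "g x (D H (hori (D X V)) x) (hori (D X W) x) + g x (D H (hori (D X W)) x) (hori (D X V) x)
      = \<mu> x * (g x (D H V x) (W x) + g x (D H W x) (V x))"
    using D_metric[OF vf_H hor_field_vf[OF J[OF Xf V]] hor_field_vf[OF J[OF Xf W]] x]
      g_sym[OF t[OF hor_field_vf[OF J[OF Xf V]]] t[OF vf_D[OF vf_H hor_field_vf[OF J[OF Xf W]]]]] by simp
  then have "g x (hori (D ?X' V) x) (hori (D X W) x) + g x (hori (D ?X' W) x) (hori (D X V) x)
      + g x (H x) (X x) * (g x (hori (D H V) x) (hori (D X W) x) + g x (hori (D H W) x) (hori (D X V) x))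
      + 2 * (g x (D H V x) (X x) * g x (D H W x) (X x)) = 0"
    unfolding half[OF V W VW] half[OF W V sVW] by (simp add: algebra_simps)
  moreover have "g x (hori (D P V) x) (hori (D X W) x) + g x (hori (D P W) x) (hori (D X V) x) = 0"
    if P: "hor_field P" for P
    using conformal_polarised[OF P X V W x VW]
      g_sym[OF t[OF hor_field_vf[OF J[OF hor_field_vf[OF P] W]]] t[OF hor_field_vf[OF J[OF Xf V]]]] by simp
  ultimately show ?thesis using X' hor_field_H by simp
qed

text \<open>With \<open>X = J\<^sub>V H + J\<^sub>W H\<close> and orthogonal \<open>V\<close>, \<open>W\<close> the vanishing product is
  \<open>\<mu>\<^sup>2 |V|\<^sup>2 |W|\<^sup>2\<close>, where \<open>\<mu>\<close> is the conformal factor that belongs to \<open>H\<close>.\<close>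

lemma D_H_vertical:
  assumes V: "vert_field V" and x: "x \<in> S"
  shows "D H V x \<in> vertical x"
proof -
  note t = vf_tangent[OF _ x]
  obtain \<mu> where l: "\<And>V W x. vert_field V \<Longrightarrow> vert_field W \<Longrightarrow> x \<in> S \<Longrightarrow>
    g x (hori (D H V) x) (hori (D H W) x) = \<mu> x * g x (V x) (W x)"
    by (rule conformal[OF hor_field_H]) (rule that)
  \<comment> \<open>Any vertical vector is orthogonal to \<open>0\<close>, so this merely provides a nonzero one.\<close>
  obtain V1 where V1: "vert_field V1" "V1 x \<noteq> 0"
    by (rule orthogonal_vertical[OF dim x vertical_closed(1)[OF in_U[OF x]]])
  obtain V2 where V2: "vert_field V2" "V2 x \<noteq> 0" "g x (V1 x) (V2 x) = 0"
    by (rule orthogonal_vertical[OF dim x vert_field_vertical[OF V1(1) x]])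
  let ?J1 = "hori (D H V1)" and ?J2 = "hori (D H V2)"
  have D1: "vf (D H V1)" and D2: "vf (D H V2)" using vf_D vf_H V1(1) V2(1) vert_field_vf by auto
  note J1 = splitting(2)[OF D1] and J2 = splitting(2)[OF D2]
  let ?X = "?J1 + ?J2"
  have Xx: "?X x = ?J1 x + ?J2 x" by (rule plus_fun_apply)
  have X: "hor_field ?X" by (rule hor_field_add[OF J1 J2])
  have "g x (D H V1 x) (?X x) = \<mu> x * g x (V1 x) (V1 x)"
    unfolding Xx using g_hori[OF D1 X x, unfolded Xx] t[OF hor_field_vf[OF J1]] t[OF hor_field_vf[OF J2]] l[OF V1(1) V1(1) x] l[OF V1(1) V2(1) x] V2(3)
    by (simp add: g_bilinear)
  moreover have "g x (D H V2 x) (?X x) = \<mu> x * g x (V2 x) (V2 x)"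
    unfolding Xx using g_hori[OF D2 X x, unfolded Xx] t[OF hor_field_vf[OF J1]] t[OF hor_field_vf[OF J2]] l[OF V2(1) V2(1) x] l[OF V2(1) V1(1) x] V2(3)
      g_sym[OF t[OF vert_field_vf[OF V1(1)]] t[OF vert_field_vf[OF V2(1)]]]
    by (simp add: g_bilinear)
  ultimately have "\<mu> x = 0"
    using D_H_orthogonal_product[OF X V1(1) V2(1) x V2(3)] V1(2) V2(2)
      g_eq_0_iff[OF t[OF vert_field_vf[OF V1(1)]]] g_eq_0_iff[OF t[OF vert_field_vf[OF V2(1)]]] by simp
  then have "g x (hori (D H V) x) (hori (D H V) x) = 0" using l[OF V V x] by simp
  then have "hori (D H V) x = 0"
    using g_eq_0_iff[OF t[OF hor_field_vf[OF splitting(2)[OF vf_D[OF vf_H vert_field_vf[OF V]]]]]] by simp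
  then show ?thesis using hori_eq_0_iff[OF x vf_D[OF vf_H vert_field_vf[OF V]]] by simp
qed

section \<open>The mean curvature vector field\<close>

lemma hor_field_tau: "hor_field \<tau>"
proof -
  have "hor_field (\<lambda>x. real (card L) *\<^sub>R H x)" by (rule hor_field_scale[OF hor_field_H sm_const])
  then show ?thesis by (simp only: tau_eq[symmetric])
qed

lemmas vf_tau = hor_field_vf[OF hor_field_tau]

lemma D_vert_tau_vertical:
  assumes "vert_field V" "x \<in> S" shows "D V \<tau> x \<in> vertical x"
proof -
  have "D V \<tau> x = D V (\<lambda>x. real (card L) *\<^sub>R H x) x"
    by (rule D_cong[OF vert_field_vf[OF assms(1)] vf_tau refl tau_eq assms(2)])
  then show ?thesis
    using vertical_closed(4)[OF in_U[OF assms(2)] D_vert_H_vertical[OF assms]]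
    by (simp only: D_cscale_right[OF vert_field_vf[OF assms(1)] vf_H assms(2)])
qed

lemma D_tau_vert_vertical:
  assumes "vert_field V" "x \<in> S" shows "D \<tau> V x \<in> vertical x"
proof -
  have "D \<tau> V x = D (\<lambda>x. real (card L) *\<^sub>R H x) V x"
    by (rule D_cong[OF vf_tau vert_field_vf[OF assms(1)] tau_eq refl assms(2)])
  then show ?thesis
    using vertical_closed(4)[OF in_U[OF assms(2)] D_H_vertical[OF assms]]
    by (simp only: D_cscale_left[OF vf_H vert_field_vf[OF assms(1)] assms(2)])
qed

lemma bracket_tau_vertical:
  assumes "vert_field V" "x \<in> S" shows "lie_bracket A V \<tau> x \<in> vertical x"
  unfolding D_torsion[OF vert_field_vf[OF assms(1)] vf_tau assms(2)]
  by (rule vertical_closed(3)[OF in_U[OF assms(2)] D_vert_tau_vertical[OF assms] D_tau_vert_vertical[OF assms]])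

text \<open>\<open>A\<^sub>\<tau>\<close> is skew, so its vertical part on horizontal vectors vanishes together with its horizontal part
  on vertical vectors.\<close>

lemma oneill_A_tau:
  assumes E: "vf E" and x: "x \<in> S" shows "oneill_A A g D L F \<tau> E x = 0"
proof -
  note s = splitting[OF E] and ht = splitting(2)[OF vf_tau]
  have eq: "hori \<tau> y = \<tau> y" if "y \<in> S" for y
    using ver_horizontal[where E = \<tau>, OF that hor_field_horizontal[OF hor_field_tau that]] by (simp add: hori_apply)
  have c: "D (hori \<tau>) Z x = D \<tau> Z x" if "vf Z" for Z
    by (rule D_cong[OF hor_field_vf[OF ht] that eq refl x])
  have "hori (D (hori \<tau>) (ver E)) x = hori (D \<tau> (ver E)) x"
    by (rule hori_cong, rule c[OF vert_field_vf[OF s(1)]])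
  also have "\<dots> = 0"
    using hori_eq_0_iff[OF x vf_D[OF vf_tau vert_field_vf[OF s(1)]]] D_tau_vert_vertical[OF s(1) x] by blast
  finally have 1: "hori (D (hori \<tau>) (ver E)) x = 0" .
  have T: "vf (D \<tau> (hori E))" by (rule vf_D[OF vf_tau hor_field_vf[OF s(2)]])
  have "ver (D (hori \<tau>) (hori E)) x = ver (D \<tau> (hori E)) x"
    by (rule ver_cong, rule c[OF hor_field_vf[OF s(2)]])
  also have "\<dots> = 0"
  proof (rule vert_field_eq_0I[OF splitting(1)[OF T] x])
    fix V assume V: "vert_field V"
    have "g x (D \<tau> V x) (hori E x) = 0"
      by (rule horizontal_orthogonal(1)[OF D_tau_vert_vertical[OF V x] hor_field_horizontal[OF s(2) x]])
    then show "g x (ver (D \<tau> (hori E)) x) (V x) = 0"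
      using g_ver[OF T V x] D_perp[OF vf_tau V s(2) x] by simp
  qed
  finally show ?thesis
    unfolding oneill_A_def using 1 by (simp add: plus_fun_apply[of "ver (D (hori \<tau>) (hori E))"])
qed

text \<open>The Lie derivative is \<open>g(E, D\<^sub>W \<tau>) + g(D\<^sub>E W, \<tau>)\<close>. For vertical \<open>E\<close> the two terms cancel by umbilicity.
  For horizontal \<open>E\<close> the first one vanishes because \<open>D\<^sub>W \<tau>\<close> is vertical, and the second one is
  \<open>g(A\<^sub>E W, \<tau>) = - g(A\<^sub>\<tau> W, E) = 0\<close>.\<close>

lemma lie_derivative_kappa:
  assumes W: "vert_field W" and E: "vf E" and x: "x \<in> S"
  shows "lie_derivative A W (mean_curvature_form A g D L F) E x = 0"
proof -
  note t = vf_tangent[OF _ x] and Wf = vert_field_vf[OF W] and s = splitting[OF E]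
  note tW = vf_D[OF Wf E] vf_D[OF E Wf] vf_D[OF Wf vf_tau] vf_tau
  have "lie_derivative A W (mean_curvature_form A g D L F) E x =
      g x (E x) (D W \<tau> x) + g x (D E W x) (\<tau> x)"
    unfolding lie_derivative_def mean_curvature_form_def D_metric[OF Wf E vf_tau x] D_torsion[OF Wf E x]
    using t[OF tW(1)] t[OF tW(2)] t[OF tW(4)] by (simp add: g_bilinear)
  moreover have "g x (D E W x) (\<tau> x) = g x (D (ver E) W x) (\<tau> x) + g x (D (hori E) W x) (\<tau> x)"
    unfolding D_split_left[OF Wf E x] using s Wf vf_tau by (intro g_add t vf_D) (auto intro: vert_field_vf hor_field_vf)
  moreover have "g x (D (ver E) W x) (\<tau> x) = g x (ver E x) (W x) * g x (H x) (\<tau> x)"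
    by (rule D_vert_vert[OF s(1) W hor_field_tau x])
  moreover have "g x (D (hori E) W x) (\<tau> x) = 0"
    using D_perp[OF hor_field_vf[OF s(2)] W hor_field_tau x] D_hori_hori[OF s(2) hor_field_tau W x] D_perp[OF vf_tau W s(2) x]
      horizontal_orthogonal(1)[OF D_tau_vert_vertical[OF W x] hor_field_horizontal[OF s(2) x]] by simp
  moreover have "g x (E x) (D W \<tau> x) = - (g x (ver E x) (W x) * g x (H x) (\<tau> x))"
  proof -
    have "g x (ver E x + hori E x) (D W \<tau> x) = g x (ver E x) (D W \<tau> x) + g x (hori E x) (D W \<tau> x)"
      using s tW(3) by (intro g_add t) (auto intro: vert_field_vf hor_field_vf)
    moreover have "g x (hori E x) (D W \<tau> x) = 0"
      by (rule horizontal_orthogonal(2)[OF D_vert_tau_vertical[OF W x] hor_field_horizontal[OF s(2) x]])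
    ultimately have "g x (E x) (D W \<tau> x) = g x (D W \<tau> x) (ver E x)"
      using g_sym[OF t[OF vert_field_vf[OF s(1)]] t[OF tW(3)]] by (simp only: splitting_sum[symmetric] add_0_right)
    then show ?thesis
      using D_vert_hori[OF W hor_field_tau s(1) x] g_sym[OF t[OF Wf] t[OF vert_field_vf[OF s(1)]]] by simp
  qed
  ultimately show ?thesis by simp
qed

end

theorem proposition2p4:
  fixes A :: "('a::{t2_space, second_countable_topology}, 'e::euclidean_space) chart set"
    and g :: "'a metric"
    and D :: "'a connection"
    and L :: "'e set"
    and F :: "('a, 'e) chart set"
  assumes "smooth_atlas A"
    and "riemannian_metric A g"
    and "levi_civita A g D"
    and "constant_curvature A g D"
    and "foliation A L F"
    and "bundle_like A g L F"
    and "totally_umbilical A g D L F"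
    and "card L \<ge> 2"
  shows "(\<forall>S V. open S \<and> vertical_field A L F S V \<longrightarrow>
            (\<forall>x\<in>S. hor A g L F (D V (mean_curvature A g D L F)) x = 0)) \<and>
         (basic_field A g L F UNIV (mean_curvature A g D L F) \<and>
            basic_one_form A L F (mean_curvature_form A g D L F)) \<and>
         (\<forall>S E. open S \<and> vector_field A S E \<longrightarrow>
            (\<forall>x\<in>S. oneill_A A g D L F (mean_curvature A g D L F) E x = 0))"
proof -
  let ?t = "mean_curvature A g D L F" and ?k = "mean_curvature_form A g D L F"
  have local: "\<exists>T U \<phi>. umbilic_on A g D T L F U \<phi> \<and> x \<in> T \<and> T \<subseteq> S" if "open S" "x \<in> S" for S x
  proof -
    have "smooth_atlas F" using assms(5) by (simp add: foliation_def)
    then obtain U \<phi> where c: "(U, \<phi>) \<in> F" "x \<in> U" by (rule smooth_atlas_cover)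
    have "open U" using is_chartD(1)[OF smooth_atlas_chart[OF \<open>smooth_atlas F\<close> c(1)]] .
    then have "umbilic_on A g D (S \<inter> U) L F U \<phi>"
      using assms c that by unfold_locales auto
    with c that show ?thesis by blast
  qed
  have vsub: "vertical_field A L F T V" if "vertical_field A L F S V" "T \<subseteq> S" for S T V
    using that vector_field_subset[OF assms(1)] by (auto simp: vertical_field_def)
  have t: "vector_field A UNIV ?t"
  proof (rule vector_field_local[OF assms(1)])
    fix x :: 'a
    obtain T U \<phi> where T: "umbilic_on A g D T L F U \<phi>" "x \<in> T" using local[of UNIV x] by auto
    interpret umbilic_on A g D T L F U \<phi> by fact
    show "\<exists>T. open T \<and> x \<in> T \<and> vector_field A T ?t" using open_S T(2) vf_tau by blast
  qed
  have th: "horizontal_field A g L F UNIV ?t"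
  proof -
    have "?t x \<in> horizontal_space A g L F x" for x
    proof -
      obtain T U \<phi> where T: "umbilic_on A g D T L F U \<phi>" "x \<in> T" using local[of UNIV x] by auto
      interpret umbilic_on A g D T L F U \<phi> by fact
      show ?thesis by (rule hor_field_horizontal[OF hor_field_tau T(2)])
    qed
    with t show ?thesis by (simp add: horizontal_field_def)
  qed
  have a: "hor A g L F (D V ?t) x = 0" if h: "open S" "vertical_field A L F S V" "x \<in> S" for S V x
  proof -
    obtain T U \<phi> where T: "umbilic_on A g D T L F U \<phi>" "x \<in> T" "T \<subseteq> S" using local[OF h(1,3)] by blast
    interpret umbilic_on A g D T L F U \<phi> by fact
    have V: "vert_field V" by (rule vsub[OF h(2) T(3)])
    show ?thesis
      using hori_eq_0_iff[OF T(2) vf_D[OF vert_field_vf[OF V] vf_tau]] D_vert_tau_vertical[OF V T(2)] by blast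
  qed
  have "lie_bracket A V ?t x \<in> vertical_space A L F x"
    if h: "open S" "vertical_field A L F S V" "x \<in> S" for S V x
  proof -
    obtain T U \<phi> where T: "umbilic_on A g D T L F U \<phi>" "x \<in> T" "T \<subseteq> S" using local[OF h(1,3)] by blast
    interpret umbilic_on A g D T L F U \<phi> by fact
    show ?thesis by (rule bracket_tau_vertical[OF vsub[OF h(2) T(3)] T(2)])
  qed
  then have b: "basic_field A g L F UNIV ?t"
    by (intro basic_fieldI[OF assms(1,5) open_UNIV th _ assms(2,3)])
  have "one_form A ?k"
  proof -
    interpret riemannian_on A g D UNIV using assms by unfold_locales auto
    have "?k x (a *\<^sub>R u + b *\<^sub>R v) = a * ?k x u + b * ?k x v"
      if "u \<in> tangent_space A x" "v \<in> tangent_space A x" for x u v a b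
      unfolding mean_curvature_form_def by (rule g_linear[OF that vf_tangent[OF t UNIV_I]])
    moreover have "smooth_fun A S (\<lambda>x. ?k x (X x))" if "open S" "vector_field A S X" for S X
    proof -
      interpret S: riemannian_on A g D S by (rule restrict[OF that(1)])
      show ?thesis unfolding mean_curvature_form_def
        by (rule S.sm_g[OF that(2) vector_field_subset[OF assms(1) t subset_UNIV]])
    qed
    ultimately show ?thesis unfolding one_form_def by blast
  qed
  moreover have "?k x (W x) = 0 \<and> (\<forall>E. vector_field A S E \<longrightarrow> lie_derivative A W ?k E x = 0)"
    if h: "open S" "vertical_field A L F S W" "x \<in> S" for S W x
  proof -
    obtain T U \<phi> where T: "umbilic_on A g D T L F U \<phi>" "x \<in> T" "T \<subseteq> S" using local[OF h(1,3)] by blast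
    interpret umbilic_on A g D T L F U \<phi> by fact
    have W: "vert_field W" by (rule vsub[OF h(2) T(3)])
    have "?k x (W x) = 0" unfolding mean_curvature_form_def by (rule g_vH[OF W hor_field_tau T(2)])
    moreover have "lie_derivative A W ?k E x = 0" if "vector_field A S E" for E
      by (rule lie_derivative_kappa[OF W vector_field_subset[OF assms(1) that T(3)] T(2)])
    ultimately show ?thesis by blast
  qed
  ultimately have k: "basic_one_form A L F ?k" unfolding basic_one_form_def by blast
  have c: "oneill_A A g D L F ?t E x = 0" if h: "open S" "vector_field A S E" "x \<in> S" for S E x
  proof -
    obtain T U \<phi> where T: "umbilic_on A g D T L F U \<phi>" "x \<in> T" "T \<subseteq> S" using local[OF h(1,3)] by blast
    interpret umbilic_on A g D T L F U \<phi> by fact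
    show ?thesis by (rule oneill_A_tau[OF vector_field_subset[OF assms(1) h(2) T(3)] T(2)])
  qed
  from a b k c show ?thesis by blast
qed

end
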